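(* Let $R$ be a right noetherian ring, and let $P$ and $Q$ be prime ideals of $R$. Let $E_Q$ be the tame indecomposable injective right $R$-module with assassinator $Q$. If $\mathrm{Ext}^1_R(R/P,\mathrm{ann}_{E_Q}(Q))$ has a nonzero torsionfree $R/P$-submodule, then $P\rightsquigarrow Q$.
   Context: Modules are right modules unless stated otherwise. $E_Q$ is the injective hull, as a right $R$-module, of any uniform right ideal of $R/Q$ (unique up to isomorphism); $\mathrm{ann}_{E_Q}(Q)=\{x\in E_Q:xQ=0\}$. $\mathrm{Ext}^1_R(R/P,M)$ is a right $R/P$-module via the left action of $R$ on $R/P$. Torsionfree is with respect to regular elements of the prime ring in question. $P\rightsquigarrow Q$ ($P$ is linked to $Q$) means there is an ideal $A$ with $PQ\subseteq A\subsetneq P\cap Q$ such that $(P\cap Q)/A$ is fully faithful as a left $R/P$-module (every nonzero submodule is faithful) and torsionfree as a right $R/Q$-module. *)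

theory Defs
  imports "HOL-Algebra.Module" "HOL-Algebra.QuotRing" "HOL-Algebra.Ideal_Product"
begin

section \<open>Right modules over a not necessarily commutative ring\<close>

text \<open>
  As for the library's \<^typ>\<open>('a, 'b) module\<close>, the record extends \<^typ>\<open>'b ring\<close> only to
  inherit the additive group; the fields \<^const>\<open>mult\<close> and \<^const>\<open>one\<close> play no role and are left
  \<^const>\<open>undefined\<close> in the constructions below.
\<close>

record ('a, 'b) right_module = "'b ring" +
  rsmult :: "['b, 'a] \<Rightarrow> 'b"  (infixl \<open>\<bullet>\<index>\<close> 70)

locale right_module = R?: ring R + M?: abelian_group M for R (structure) and M (structure) +
  assumes rsmult_closed: "\<lbrakk>x \<in> carrier M; a \<in> carrier R\<rbrakk> \<Longrightarrow> x \<bullet>\<^bsub>M\<^esub> a \<in> carrier M"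
    and rsmult_l_distr: "\<lbrakk>x \<in> carrier M; y \<in> carrier M; a \<in> carrier R\<rbrakk> \<Longrightarrow>
      (x \<oplus>\<^bsub>M\<^esub> y) \<bullet>\<^bsub>M\<^esub> a = x \<bullet>\<^bsub>M\<^esub> a \<oplus>\<^bsub>M\<^esub> y \<bullet>\<^bsub>M\<^esub> a"
    and rsmult_r_distr: "\<lbrakk>x \<in> carrier M; a \<in> carrier R; b \<in> carrier R\<rbrakk> \<Longrightarrow>
      x \<bullet>\<^bsub>M\<^esub> (a \<oplus>\<^bsub>R\<^esub> b) = x \<bullet>\<^bsub>M\<^esub> a \<oplus>\<^bsub>M\<^esub> x \<bullet>\<^bsub>M\<^esub> b"
    and rsmult_assoc: "\<lbrakk>x \<in> carrier M; a \<in> carrier R; b \<in> carrier R\<rbrakk> \<Longrightarrow>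
      x \<bullet>\<^bsub>M\<^esub> (a \<otimes>\<^bsub>R\<^esub> b) = (x \<bullet>\<^bsub>M\<^esub> a) \<bullet>\<^bsub>M\<^esub> b"
    and rsmult_one: "x \<in> carrier M \<Longrightarrow> x \<bullet>\<^bsub>M\<^esub> \<one>\<^bsub>R\<^esub> = x"

definition right_submodule ::
  "'b set \<Rightarrow> ('a, 'x) ring_scheme \<Rightarrow> ('a, 'b, 'y) right_module_scheme \<Rightarrow> bool" where
  "right_submodule H R M \<longleftrightarrow> additive_subgroup H M \<and>
     (\<forall>x\<in>H. \<forall>a\<in>carrier R. x \<bullet>\<^bsub>M\<^esub> a \<in> H)"

text \<open>Homomorphisms are taken extensional, so that equal homomorphisms are equal as HOL functions.\<close>

definition right_module_hom ::
  "('a, 'x) ring_scheme \<Rightarrow> ('a, 'b, 'y) right_module_scheme \<Rightarrow>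
   ('a, 'c, 'z) right_module_scheme \<Rightarrow> ('b \<Rightarrow> 'c) set" where
  "right_module_hom R M N = {f \<in> carrier M \<rightarrow>\<^sub>E carrier N.
     (\<forall>x\<in>carrier M. \<forall>y\<in>carrier M. f (x \<oplus>\<^bsub>M\<^esub> y) = f x \<oplus>\<^bsub>N\<^esub> f y) \<and>
     (\<forall>x\<in>carrier M. \<forall>a\<in>carrier R. f (x \<bullet>\<^bsub>M\<^esub> a) = f x \<bullet>\<^bsub>N\<^esub> a)}"

definition regular_right_module :: "('a, 'x) ring_scheme \<Rightarrow> ('a, 'a) right_module" where
  "regular_right_module R = \<lparr>carrier = carrier R, mult = undefined, one = undefined,
     zero = \<zero>\<^bsub>R\<^esub>, add = add R, rsmult = mult R\<rparr>"

lemma right_module_regular: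
  fixes R (structure)
  assumes "ring R"
  shows "right_module R (regular_right_module R)"
proof -
  interpret ring R by fact
  have "abelian_group (regular_right_module R)"
  proof (rule abelian_groupI)
    fix x assume "x \<in> carrier (regular_right_module R)"
    then show "\<exists>y\<in>carrier (regular_right_module R).
        y \<oplus>\<^bsub>regular_right_module R\<^esub> x = \<zero>\<^bsub>regular_right_module R\<^esub>"
      by (auto simp: regular_right_module_def intro!: bexI[of _ "\<ominus> x"] l_neg)
  qed (auto simp: regular_right_module_def a_ac)
  then show ?thesis
    by (intro right_module.intro right_module_axioms.intro)
       (auto simp: regular_right_module_def l_distr r_distr m_assoc assms)
qed

context right_module
begin

lemma rsmult_zero_right: "x \<in> carrier M \<Longrightarrow> x \<bullet>\<^bsub>M\<^esub> \<zero>\<^bsub>R\<^esub> = \<zero>\<^bsub>M\<^esub>"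
  using rsmult_r_distr[of x "\<zero>" "\<zero>"] rsmult_closed[of x "\<zero>"]
  by (metis M.add.l_cancel_one' R.l_zero R.zero_closed)

lemma rsmult_zero_left: "a \<in> carrier R \<Longrightarrow> \<zero>\<^bsub>M\<^esub> \<bullet>\<^bsub>M\<^esub> a = \<zero>\<^bsub>M\<^esub>"
  using rsmult_l_distr[of "\<zero>\<^bsub>M\<^esub>" "\<zero>\<^bsub>M\<^esub>" a] rsmult_closed[of "\<zero>\<^bsub>M\<^esub>" a]
  by (metis M.add.l_cancel_one' M.l_zero M.zero_closed)

lemma rsmult_minus_right:
  "\<lbrakk>x \<in> carrier M; a \<in> carrier R\<rbrakk> \<Longrightarrow> x \<bullet>\<^bsub>M\<^esub> (\<ominus>\<^bsub>R\<^esub> a) = \<ominus>\<^bsub>M\<^esub> (x \<bullet>\<^bsub>M\<^esub> a)"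
  using rsmult_r_distr[of x "\<ominus>\<^bsub>R\<^esub> a" a] rsmult_closed rsmult_zero_right[of x]
  by (metis M.minus_equality R.add.inv_closed R.l_neg)

lemma minus_eq_rsmult: "x \<in> carrier M \<Longrightarrow> \<ominus>\<^bsub>M\<^esub> x = x \<bullet>\<^bsub>M\<^esub> (\<ominus>\<^bsub>R\<^esub> \<one>\<^bsub>R\<^esub>)"
  by (simp add: rsmult_minus_right rsmult_one)

lemma right_submoduleI:
  assumes "H \<subseteq> carrier M" "\<zero>\<^bsub>M\<^esub> \<in> H"
    "\<And>x y. \<lbrakk>x \<in> H; y \<in> H\<rbrakk> \<Longrightarrow> x \<oplus>\<^bsub>M\<^esub> y \<in> H"
    "\<And>x a. \<lbrakk>x \<in> H; a \<in> carrier R\<rbrakk> \<Longrightarrow> x \<bullet>\<^bsub>M\<^esub> a \<in> H"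
  shows "right_submodule H R M"
  unfolding right_submodule_def
proof (intro conjI additive_subgroup.intro M.add.subgroupI ballI)
  fix x assume "x \<in> H"
  then show "\<ominus>\<^bsub>M\<^esub> x \<in> H" 
    using assms(1,4) minus_eq_rsmult by auto
qed (use assms in auto)

end

definition right_ideal :: "'a set \<Rightarrow> ('a, 'x) ring_scheme \<Rightarrow> bool" where
  "right_ideal I R \<longleftrightarrow> right_submodule I R (regular_right_module R)"

definition right_noetherian :: "('a, 'x) ring_scheme \<Rightarrow> bool" where
  "right_noetherian R \<longleftrightarrow>
     (\<forall>I :: nat \<Rightarrow> 'a set. (\<forall>n. right_ideal (I n) R) \<and> (\<forall>n. I n \<subseteq> I (Suc n)) \<longrightarrow>
        (\<exists>N. \<forall>n\<ge>N. I n = I N))"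

text \<open>The library's \<^locale>\<open>primeideal\<close> presupposes a commutative ring.\<close>

definition prime_ideal :: "'a set \<Rightarrow> ('a, 'x) ring_scheme \<Rightarrow> bool" where
  "prime_ideal P R \<longleftrightarrow> ideal P R \<and> P \<noteq> carrier R \<and>
     (\<forall>I J. ideal I R \<and> ideal J R \<and> ideal_prod R I J \<subseteq> P \<longrightarrow> I \<subseteq> P \<or> J \<subseteq> P)"

definition regular_elements :: "('a, 'x) ring_scheme \<Rightarrow> 'a set" where
  "regular_elements S = {c \<in> carrier S.
     \<forall>x\<in>carrier S. (c \<otimes>\<^bsub>S\<^esub> x = \<zero>\<^bsub>S\<^esub> \<longrightarrow> x = \<zero>\<^bsub>S\<^esub>) \<and> (x \<otimes>\<^bsub>S\<^esub> c = \<zero>\<^bsub>S\<^esub> \<longrightarrow> x = \<zero>\<^bsub>S\<^esub>)}"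

definition torsionfree :: "('a, 'x) ring_scheme \<Rightarrow> ('a, 'b, 'y) right_module_scheme \<Rightarrow> bool" where
  "torsionfree S M \<longleftrightarrow>
     (\<forall>x\<in>carrier M. \<forall>c\<in>regular_elements S. x \<bullet>\<^bsub>M\<^esub> c = \<zero>\<^bsub>M\<^esub> \<longrightarrow> x = \<zero>\<^bsub>M\<^esub>)"

definition uniform :: "('a, 'x) ring_scheme \<Rightarrow> ('a, 'b, 'y) right_module_scheme \<Rightarrow> bool" where
  "uniform R M \<longleftrightarrow> carrier M \<noteq> {\<zero>\<^bsub>M\<^esub>} \<and>
     (\<forall>X Y. right_submodule X R M \<and> X \<noteq> {\<zero>\<^bsub>M\<^esub>} \<and> right_submodule Y R M \<and> Y \<noteq> {\<zero>\<^bsub>M\<^esub>} \<longrightarrow>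
        X \<inter> Y \<noteq> {\<zero>\<^bsub>M\<^esub>})"

definition annihilator_in ::
  "('a, 'b, 'y) right_module_scheme \<Rightarrow> 'a set \<Rightarrow> 'b set" where
  "annihilator_in M I = {x \<in> carrier M. \<forall>a\<in>I. x \<bullet>\<^bsub>M\<^esub> a = \<zero>\<^bsub>M\<^esub>}"


section \<open>Injective modules and injective hulls\<close>

text \<open>
  A HOL definition cannot quantify over the types of the test modules, so they are taken with
  carriers in the element type of the ring.  This is no restriction: these test modules
  include the regular module, and \<open>injective_extend\<close> below (Baer's argument) gives the extension
  property for test modules over every type.
\<close>

definition injective ::
  "('a, 'x) ring_scheme \<Rightarrow> ('a, 'b, 'y) right_module_scheme \<Rightarrow> bool" where
  "injective R E \<longleftrightarrow> right_module R E \<and>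
     (\<forall>(B :: ('a, 'a) right_module) A f.
        right_module R B \<and> right_submodule A R B \<and> f \<in> right_module_hom R (B\<lparr>carrier := A\<rparr>) E \<longrightarrow>
        (\<exists>g\<in>right_module_hom R B E. \<forall>x\<in>A. g x = f x))"

lemma injective_extend:
  fixes B :: "('a, 'b, 'y) right_module_scheme"
  assumes E: "injective R E" and B: "right_module R B" and A: "right_submodule A R B"
    and f: "f \<in> right_module_hom R (B\<lparr>carrier := A\<rparr>) E"
  shows "\<exists>g\<in>right_module_hom R B E. \<forall>x\<in>A. g x = f x"
proof -
  interpret E: right_module R E using E by (simp add: injective_def)
  interpret B: right_module R B by fact
  interpret A: additive_subgroup A B using A by (simp add: right_submodule_def)
  have reg: "right_module R (regular_right_module R)"
    by (rule right_module_regular) unfold_locales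
  have Asm: "x \<bullet>\<^bsub>B\<^esub> a \<in> A" if "x \<in> A" "a \<in> carrier R" for x a
    using A that by (simp add: right_submodule_def)
  have fE: "f x \<in> carrier E" if "x \<in> A" for x
    using f that by (auto simp: right_module_hom_def)
  have fadd: "f (x \<oplus>\<^bsub>B\<^esub> y) = f x \<oplus>\<^bsub>E\<^esub> f y" if "x \<in> A" "y \<in> A" for x y
    using f that by (auto simp: right_module_hom_def)
  have fsm: "f (x \<bullet>\<^bsub>B\<^esub> a) = f x \<bullet>\<^bsub>E\<^esub> a" if "x \<in> A" "a \<in> carrier R" for x a
    using f that by (auto simp: right_module_hom_def)
  have f0: "f \<zero>\<^bsub>B\<^esub> = \<zero>\<^bsub>E\<^esub>"
    using fadd[of "\<zero>\<^bsub>B\<^esub>" "\<zero>\<^bsub>B\<^esub>"] fE[of "\<zero>\<^bsub>B\<^esub>"] A.zero_closed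
    by (metis B.M.l_zero B.M.zero_closed E.M.add.l_cancel_one')
  define G0 where "G0 = (\<lambda>x. (x, f x)) ` A"
  define \<G> where "\<G> = {G. G0 \<subseteq> G \<and> G \<subseteq> carrier B \<times> carrier E \<and>
     (\<forall>x y x' y'. (x, y) \<in> G \<longrightarrow> (x', y') \<in> G \<longrightarrow> (x \<oplus>\<^bsub>B\<^esub> x', y \<oplus>\<^bsub>E\<^esub> y') \<in> G) \<and>
     (\<forall>x y a. (x, y) \<in> G \<longrightarrow> a \<in> carrier R \<longrightarrow> (x \<bullet>\<^bsub>B\<^esub> a, y \<bullet>\<^bsub>E\<^esub> a) \<in> G) \<and>
     (\<forall>y. (\<zero>\<^bsub>B\<^esub>, y) \<in> G \<longrightarrow> y = \<zero>\<^bsub>E\<^esub>)}"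
  have \<G>I: "X \<in> \<G>" if "G0 \<subseteq> X" "X \<subseteq> carrier B \<times> carrier E"
      "\<And>x y x' y'. \<lbrakk>(x, y) \<in> X; (x', y') \<in> X\<rbrakk> \<Longrightarrow> (x \<oplus>\<^bsub>B\<^esub> x', y \<oplus>\<^bsub>E\<^esub> y') \<in> X"
      "\<And>x y a. \<lbrakk>(x, y) \<in> X; a \<in> carrier R\<rbrakk> \<Longrightarrow> (x \<bullet>\<^bsub>B\<^esub> a, y \<bullet>\<^bsub>E\<^esub> a) \<in> X"
      "\<And>y. (\<zero>\<^bsub>B\<^esub>, y) \<in> X \<Longrightarrow> y = \<zero>\<^bsub>E\<^esub>" for X
    unfolding \<G>_def using that by (intro CollectI conjI allI impI)
  have "G0 \<in> \<G>"
    unfolding \<G>_def G0_def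
    using f0 by (auto simp: fE fadd fsm Asm A.a_closed)
  have "\<exists>G\<in>\<G>. \<forall>X\<in>\<G>. G \<subseteq> X \<longrightarrow> X = G"
  proof (rule subset_Zorn_nonempty)
    show "\<G> \<noteq> {}" using \<open>G0 \<in> \<G>\<close> by blast
  next
    fix \<C> assume ne: "\<C> \<noteq> {}" and ch: "subset.chain \<G> \<C>"
    have sub: "\<C> \<subseteq> \<G>" and lin: "\<And>X Y. X \<in> \<C> \<Longrightarrow> Y \<in> \<C> \<Longrightarrow> X \<subseteq> Y \<or> Y \<subseteq> X"
      using ch by (auto simp: subset_chain_def)
    have "(x \<oplus>\<^bsub>B\<^esub> x', y \<oplus>\<^bsub>E\<^esub> y') \<in> \<Union>\<C>" if xy: "(x, y) \<in> \<Union>\<C>" "(x', y') \<in> \<Union>\<C>" for x y x' y'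
    proof -
      obtain Y Z where YZ: "Y \<in> \<C>" "(x, y) \<in> Y" "Z \<in> \<C>" "(x', y') \<in> Z"
        using xy by blast
      obtain X where "X \<in> \<C>" "(x, y) \<in> X" "(x', y') \<in> X"
        using lin[OF YZ(1) YZ(3)] YZ by blast
      moreover have "X \<in> \<G>" using sub \<open>X \<in> \<C>\<close> by blast
      then have "\<forall>x y x' y'. (x, y) \<in> X \<longrightarrow> (x', y') \<in> X \<longrightarrow> (x \<oplus>\<^bsub>B\<^esub> x', y \<oplus>\<^bsub>E\<^esub> y') \<in> X"
        unfolding \<G>_def by simp
      ultimately show ?thesis by blast
    qed
    moreover have "G0 \<subseteq> \<Union>\<C>" using ne sub unfolding \<G>_def by blast
    moreover have "\<Union>\<C> \<subseteq> carrier B \<times> carrier E" using sub unfolding \<G>_def by blast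
    moreover have "(x \<bullet>\<^bsub>B\<^esub> a, y \<bullet>\<^bsub>E\<^esub> a) \<in> \<Union>\<C>" if "(x, y) \<in> \<Union>\<C>" "a \<in> carrier R" for x y a
      using that sub unfolding \<G>_def by blast
    moreover have "y = \<zero>\<^bsub>E\<^esub>" if "(\<zero>\<^bsub>B\<^esub>, y) \<in> \<Union>\<C>" for y
      using that sub unfolding \<G>_def by blast
    ultimately show "\<Union>\<C> \<in> \<G>" by (intro \<G>I)
  qed
  then obtain G where "G \<in> \<G>" and max: "\<And>X. X \<in> \<G> \<Longrightarrow> G \<subseteq> X \<Longrightarrow> X = G" by blast
  have G0: "G0 \<subseteq> G" and GE: "\<And>x y. (x, y) \<in> G \<Longrightarrow> x \<in> carrier B \<and> y \<in> carrier E"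
    and Gadd: "\<And>x y x' y'. \<lbrakk>(x, y) \<in> G; (x', y') \<in> G\<rbrakk> \<Longrightarrow> (x \<oplus>\<^bsub>B\<^esub> x', y \<oplus>\<^bsub>E\<^esub> y') \<in> G"
    and Gsm: "\<And>x y a. \<lbrakk>(x, y) \<in> G; a \<in> carrier R\<rbrakk> \<Longrightarrow> (x \<bullet>\<^bsub>B\<^esub> a, y \<bullet>\<^bsub>E\<^esub> a) \<in> G"
    and G0': "\<And>y. (\<zero>\<^bsub>B\<^esub>, y) \<in> G \<Longrightarrow> y = \<zero>\<^bsub>E\<^esub>"
    using \<open>G \<in> \<G>\<close> unfolding \<G>_def by blast+
  have Gneg: "(\<ominus>\<^bsub>B\<^esub> x, \<ominus>\<^bsub>E\<^esub> y) \<in> G" if "(x, y) \<in> G" for x y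
    using Gsm[OF that, of "\<ominus>\<^bsub>R\<^esub> \<one>\<^bsub>R\<^esub>"] GE[OF that]
    by (simp add: B.minus_eq_rsmult E.minus_eq_rsmult)
  have zG: "(\<zero>\<^bsub>B\<^esub>, \<zero>\<^bsub>E\<^esub>) \<in> G"
    using G0 f0 A.zero_closed unfolding G0_def by force
  have uniq: "y = y'" if "(x, y) \<in> G" "(x, y') \<in> G" for x y y'
  proof -
    have "(x \<oplus>\<^bsub>B\<^esub> \<ominus>\<^bsub>B\<^esub> x, y \<oplus>\<^bsub>E\<^esub> \<ominus>\<^bsub>E\<^esub> y') \<in> G" using Gadd[OF that(1) Gneg[OF that(2)]] .
    then have "y \<oplus>\<^bsub>E\<^esub> \<ominus>\<^bsub>E\<^esub> y' = \<zero>\<^bsub>E\<^esub>" using G0' GE[OF that(1)] by (simp add: B.M.r_neg)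
    then show ?thesis using GE that by (metis E.M.add.inv_closed E.M.minus_equality E.M.minus_minus)
  qed
  have total: "\<exists>y. (b, y) \<in> G" if b: "b \<in> carrier B" for b
  proof -
    define I where "I = {r \<in> carrier R. \<exists>y. (b \<bullet>\<^bsub>B\<^esub> r, y) \<in> G}"
    define h where "h = (\<lambda>r\<in>I. THE y. (b \<bullet>\<^bsub>B\<^esub> r, y) \<in> G)"
    have hG: "(b \<bullet>\<^bsub>B\<^esub> r, h r) \<in> G" if rI: "r \<in> I" for r
    proof -
      obtain y where "(b \<bullet>\<^bsub>B\<^esub> r, y) \<in> G" using rI I_def by blast
      then have "(b \<bullet>\<^bsub>B\<^esub> r, THE y. (b \<bullet>\<^bsub>B\<^esub> r, y) \<in> G) \<in> G"
        by (rule theI) (use uniq \<open>(b \<bullet>\<^bsub>B\<^esub> r, y) \<in> G\<close> in blast)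
      then show ?thesis using rI by (simp add: h_def)
    qed
    have hI: "h r = y" if "(b \<bullet>\<^bsub>B\<^esub> r, y) \<in> G" "r \<in> carrier R" for r y
      using hG[of r] uniq that unfolding I_def by blast
    have Iadd: "r \<oplus>\<^bsub>R\<^esub> s \<in> I \<and> h (r \<oplus>\<^bsub>R\<^esub> s) = h r \<oplus>\<^bsub>E\<^esub> h s" if "r \<in> I" "s \<in> I" for r s
    proof -
      have rs: "r \<in> carrier R" "s \<in> carrier R" using that I_def by auto
      have "(b \<bullet>\<^bsub>B\<^esub> (r \<oplus>\<^bsub>R\<^esub> s), h r \<oplus>\<^bsub>E\<^esub> h s) \<in> G"
        using Gadd[OF hG[OF that(1)] hG[OF that(2)]] rs b by (simp add: B.rsmult_r_distr)
      then show ?thesis using hI rs I_def by auto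
    qed
    have Ism: "r \<otimes>\<^bsub>R\<^esub> s \<in> I \<and> h (r \<otimes>\<^bsub>R\<^esub> s) = h r \<bullet>\<^bsub>E\<^esub> s" if "r \<in> I" "s \<in> carrier R" for r s
    proof -
      have rs: "r \<in> carrier R" using that I_def by auto
      have "(b \<bullet>\<^bsub>B\<^esub> (r \<otimes>\<^bsub>R\<^esub> s), h r \<bullet>\<^bsub>E\<^esub> s) \<in> G"
        using Gsm[OF hG[OF that(1)] that(2)] rs that b by (simp add: B.rsmult_assoc)
      then show ?thesis using hI rs that I_def by auto
    qed
    have "\<zero>\<^bsub>R\<^esub> \<in> I" using zG b by (auto simp: I_def B.rsmult_zero_right)
    then have Isub: "right_submodule I R (regular_right_module R)"
      by (intro right_module.right_submoduleI[OF reg])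
         (use Iadd Ism in \<open>auto simp: regular_right_module_def I_def\<close>)
    have "h \<in> right_module_hom R ((regular_right_module R)\<lparr>carrier := I\<rparr>) E"
    proof -
      have "h \<in> I \<rightarrow>\<^sub>E carrier E"
        using hG GE by (intro PiE_I) (blast, simp add: h_def)
      then show ?thesis
        using Iadd Ism by (simp add: right_module_hom_def regular_right_module_def)
    qed
    then obtain k where k: "k \<in> right_module_hom R (regular_right_module R) E"
        and kh: "\<forall>r\<in>I. k r = h r"
      using E reg Isub unfolding injective_def by blast
    define e where "e = k \<one>\<^bsub>R\<^esub>"
    have e: "e \<in> carrier E"
      using k by (auto simp: e_def right_module_hom_def regular_right_module_def)
    have ke: "k r = e \<bullet>\<^bsub>E\<^esub> r" if "r \<in> carrier R" for r
    proof -
      have "\<forall>x\<in>carrier R. \<forall>a\<in>carrier R. k (x \<otimes>\<^bsub>R\<^esub> a) = k x \<bullet>\<^bsub>E\<^esub> a"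
        using k by (simp add: right_module_hom_def regular_right_module_def)
      then have "k (\<one>\<^bsub>R\<^esub> \<otimes>\<^bsub>R\<^esub> r) = k \<one>\<^bsub>R\<^esub> \<bullet>\<^bsub>E\<^esub> r"
        using that E.R.one_closed by blast
      then show ?thesis using that by (simp add: e_def)
    qed
    define G' where "G' = {(x \<oplus>\<^bsub>B\<^esub> b \<bullet>\<^bsub>B\<^esub> r, y \<oplus>\<^bsub>E\<^esub> e \<bullet>\<^bsub>E\<^esub> r) | x y r. (x, y) \<in> G \<and> r \<in> carrier R}"
    have G'I: "(x \<oplus>\<^bsub>B\<^esub> b \<bullet>\<^bsub>B\<^esub> r, y \<oplus>\<^bsub>E\<^esub> e \<bullet>\<^bsub>E\<^esub> r) \<in> G'" if "(x, y) \<in> G" "r \<in> carrier R" for x y r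
      using that unfolding G'_def by blast
    have sub: "G \<subseteq> G'"
    proof clarify
      fix x y assume "(x, y) \<in> G"
      from G'I[OF this, of "\<zero>\<^bsub>R\<^esub>"] GE[OF this] show "(x, y) \<in> G'"
        using b e by (simp add: B.rsmult_zero_right E.rsmult_zero_right)
    qed
    have "G' \<in> \<G>"
    proof -
      have "G0 \<subseteq> G'" using G0 sub by blast
      moreover have "G' \<subseteq> carrier B \<times> carrier E"
        using GE b e by (auto simp: G'_def intro!: B.M.a_closed E.M.a_closed B.rsmult_closed E.rsmult_closed)
      moreover have "(u \<oplus>\<^bsub>B\<^esub> u', v \<oplus>\<^bsub>E\<^esub> v') \<in> G'" if uv: "(u, v) \<in> G'" "(u', v') \<in> G'" for u v u' v'
      proof -
        obtain x y r where 1: "(x, y) \<in> G" "r \<in> carrier R" "u = x \<oplus>\<^bsub>B\<^esub> b \<bullet>\<^bsub>B\<^esub> r" "v = y \<oplus>\<^bsub>E\<^esub> e \<bullet>\<^bsub>E\<^esub> r"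
          using uv unfolding G'_def by blast
        obtain x' y' r' where 2: "(x', y') \<in> G" "r' \<in> carrier R" "u' = x' \<oplus>\<^bsub>B\<^esub> b \<bullet>\<^bsub>B\<^esub> r'" "v' = y' \<oplus>\<^bsub>E\<^esub> e \<bullet>\<^bsub>E\<^esub> r'"
          using uv unfolding G'_def by blast
        have c: "x \<in> carrier B" "y \<in> carrier E" "x' \<in> carrier B" "y' \<in> carrier E" using GE 1 2 by auto
        have "u \<oplus>\<^bsub>B\<^esub> u' = (x \<oplus>\<^bsub>B\<^esub> x') \<oplus>\<^bsub>B\<^esub> b \<bullet>\<^bsub>B\<^esub> (r \<oplus>\<^bsub>R\<^esub> r')"
          using c b 1(2) 2(2) B.rsmult_closed unfolding 1(3) 2(3)
          by (simp add: B.rsmult_r_distr B.M.a_ac)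
        moreover have "v \<oplus>\<^bsub>E\<^esub> v' = (y \<oplus>\<^bsub>E\<^esub> y') \<oplus>\<^bsub>E\<^esub> e \<bullet>\<^bsub>E\<^esub> (r \<oplus>\<^bsub>R\<^esub> r')"
          using c e 1(2) 2(2) E.rsmult_closed unfolding 1(4) 2(4)
          by (simp add: E.rsmult_r_distr E.M.a_ac)
        ultimately show ?thesis using G'I[OF Gadd[OF 1(1) 2(1)], of "r \<oplus>\<^bsub>R\<^esub> r'"] 1(2) 2(2) by simp
      qed
      moreover have "(u \<bullet>\<^bsub>B\<^esub> a, v \<bullet>\<^bsub>E\<^esub> a) \<in> G'" if uv: "(u, v) \<in> G'" "a \<in> carrier R" for u v a
      proof -
        obtain x y r where 1: "(x, y) \<in> G" "r \<in> carrier R" "u = x \<oplus>\<^bsub>B\<^esub> b \<bullet>\<^bsub>B\<^esub> r" "v = y \<oplus>\<^bsub>E\<^esub> e \<bullet>\<^bsub>E\<^esub> r"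
          using uv unfolding G'_def by blast
        have c: "x \<in> carrier B" "y \<in> carrier E" using GE 1 by auto
        have "u \<bullet>\<^bsub>B\<^esub> a = x \<bullet>\<^bsub>B\<^esub> a \<oplus>\<^bsub>B\<^esub> b \<bullet>\<^bsub>B\<^esub> (r \<otimes>\<^bsub>R\<^esub> a)"
          using c b 1(2) uv(2) B.rsmult_closed unfolding 1(3)
          by (simp add: B.rsmult_l_distr B.rsmult_assoc)
        moreover have "v \<bullet>\<^bsub>E\<^esub> a = y \<bullet>\<^bsub>E\<^esub> a \<oplus>\<^bsub>E\<^esub> e \<bullet>\<^bsub>E\<^esub> (r \<otimes>\<^bsub>R\<^esub> a)"
          using c e 1(2) uv(2) E.rsmult_closed unfolding 1(4)
          by (simp add: E.rsmult_l_distr E.rsmult_assoc)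
        ultimately show ?thesis using G'I[OF Gsm[OF 1(1) uv(2)], of "r \<otimes>\<^bsub>R\<^esub> a"] 1(2) uv(2) by simp
      qed
      moreover have "v = \<zero>\<^bsub>E\<^esub>" if v: "(\<zero>\<^bsub>B\<^esub>, v) \<in> G'" for v
      proof -
        obtain x y r where 1: "(x, y) \<in> G" "r \<in> carrier R" "\<zero>\<^bsub>B\<^esub> = x \<oplus>\<^bsub>B\<^esub> b \<bullet>\<^bsub>B\<^esub> r" "v = y \<oplus>\<^bsub>E\<^esub> e \<bullet>\<^bsub>E\<^esub> r"
          using v unfolding G'_def by blast
        have c: "x \<in> carrier B" "y \<in> carrier E" "b \<bullet>\<^bsub>B\<^esub> r \<in> carrier B"
          using GE 1 b B.rsmult_closed by auto
        have "b \<bullet>\<^bsub>B\<^esub> r = \<ominus>\<^bsub>B\<^esub> x" using 1(3) c by (metis B.M.a_comm B.M.minus_equality)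
        then have bG: "(b \<bullet>\<^bsub>B\<^esub> r, \<ominus>\<^bsub>E\<^esub> y) \<in> G" using Gneg[OF 1(1)] by simp
        then have "r \<in> I" "h r = \<ominus>\<^bsub>E\<^esub> y" using hI 1(2) I_def by auto
        then have "e \<bullet>\<^bsub>E\<^esub> r = \<ominus>\<^bsub>E\<^esub> y" using ke kh 1(2) by metis
        then show ?thesis using 1(4) c by (simp add: E.M.r_neg)
      qed
      ultimately show ?thesis by (intro \<G>I)
    qed
    then have "G' = G" using max sub by blast
    moreover have "(b, e) \<in> G'"
      using G'I[OF zG, of "\<one>\<^bsub>R\<^esub>"] b e by (simp add: B.rsmult_one E.rsmult_one)
    ultimately show ?thesis by blast
  qed
  define g where "g = (\<lambda>x\<in>carrier B. THE y. (x, y) \<in> G)"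
  have gI: "g x = y" if "(x, y) \<in> G" for x y
    using that uniq GE unfolding g_def by (simp add: the_equality)
  have gG: "(x, g x) \<in> G" if "x \<in> carrier B" for x
    using total[OF that] gI by blast
  have "g \<in> right_module_hom R B E"
  proof -
    have "g \<in> carrier B \<rightarrow>\<^sub>E carrier E"
      using gG GE by (intro PiE_I) (blast, simp add: g_def)
    moreover have "g (x \<oplus>\<^bsub>B\<^esub> y) = g x \<oplus>\<^bsub>E\<^esub> g y" if "x \<in> carrier B" "y \<in> carrier B" for x y
      using gI[OF Gadd[OF gG gG]] that .
    moreover have "g (x \<bullet>\<^bsub>B\<^esub> a) = g x \<bullet>\<^bsub>E\<^esub> a" if "x \<in> carrier B" "a \<in> carrier R" for x a
      using gI[OF Gsm[OF gG]] that .
    ultimately show ?thesis by (simp add: right_module_hom_def)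
  qed
  moreover have "\<forall>x\<in>A. g x = f x" using G0 gI unfolding G0_def by blast
  ultimately show ?thesis by blast
qed

definition essential ::
  "('a, 'x) ring_scheme \<Rightarrow> ('a, 'b, 'y) right_module_scheme \<Rightarrow> 'b set \<Rightarrow> bool" where
  "essential R E N \<longleftrightarrow> right_submodule N R E \<and>
     (\<forall>X. right_submodule X R E \<and> X \<noteq> {\<zero>\<^bsub>E\<^esub>} \<longrightarrow> X \<inter> N \<noteq> {\<zero>\<^bsub>E\<^esub>})"

definition injective_hull ::
  "('a, 'x) ring_scheme \<Rightarrow> ('a, 'b, 'y) right_module_scheme \<Rightarrow>
   ('a, 'c, 'z) right_module_scheme \<Rightarrow> bool" where
  "injective_hull R M E \<longleftrightarrow> injective R E \<and>
     (\<exists>i\<in>right_module_hom R M E. inj_on i (carrier M) \<and> essential R E (i ` carrier M))"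

definition quotient_right_module :: "('a, 'x) ring_scheme \<Rightarrow> 'a set \<Rightarrow> ('a, 'a set) right_module" where
  "quotient_right_module R I = \<lparr>carrier = carrier (R Quot I), mult = undefined, one = undefined,
     zero = \<zero>\<^bsub>R Quot I\<^esub>, add = add (R Quot I),
     rsmult = (\<lambda>X r. X \<otimes>\<^bsub>R Quot I\<^esub> (I +>\<^bsub>R\<^esub> r))\<rparr>"

text \<open>
  \<open>tame_injective R Q E\<close>: \<open>E\<close> is (a copy of) the tame indecomposable injective right \<open>R\<close>-module
  with assassinator \<open>Q\<close>.
\<close>

definition tame_injective ::
  "('a, 'x) ring_scheme \<Rightarrow> 'a set \<Rightarrow> ('a, 'b, 'y) right_module_scheme \<Rightarrow> bool" where
  "tame_injective R Q E \<longleftrightarrow> (\<exists>U. right_ideal U (R Quot Q) \<and>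
     uniform (R Quot Q) ((regular_right_module (R Quot Q))\<lparr>carrier := U\<rparr>) \<and>
     injective_hull R ((quotient_right_module R Q)\<lparr>carrier := U\<rparr>) E)"


section \<open>The first Ext group\<close>

definition hom_group ::
  "('a, 'x) ring_scheme \<Rightarrow> ('a, 'b, 'y) right_module_scheme \<Rightarrow>
   ('a, 'c, 'z) right_module_scheme \<Rightarrow> ('b \<Rightarrow> 'c) ring" where
  "hom_group R M N = \<lparr>carrier = right_module_hom R M N, mult = undefined, one = undefined,
     zero = (\<lambda>x\<in>carrier M. \<zero>\<^bsub>N\<^esub>), add = (\<lambda>f g. \<lambda>x\<in>carrier M. f x \<oplus>\<^bsub>N\<^esub> g x)\<rparr>"

text \<open>The free right \<open>R\<close>-module on a set \<open>X\<close>: finitely supported functions from \<open>X\<close> to \<open>R\<close>.\<close>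

definition free_right_module ::
  "('a, 'x) ring_scheme \<Rightarrow> 'n set \<Rightarrow> ('a, 'n \<Rightarrow> 'a) right_module" where
  "free_right_module R X = \<lparr>
     carrier = {\<phi>. (\<forall>x\<in>X. \<phi> x \<in> carrier R) \<and> (\<forall>x. x \<notin> X \<longrightarrow> \<phi> x = \<zero>\<^bsub>R\<^esub>) \<and> finite {x. \<phi> x \<noteq> \<zero>\<^bsub>R\<^esub>}},
     mult = undefined, one = undefined,
     zero = (\<lambda>_. \<zero>\<^bsub>R\<^esub>), add = (\<lambda>\<phi> \<psi> x. \<phi> x \<oplus>\<^bsub>R\<^esub> \<psi> x), rsmult = (\<lambda>\<phi> a x. \<phi> x \<otimes>\<^bsub>R\<^esub> a)\<rparr>"

text \<open>The kernel \<open>K\<close> of the canonical projection from the free module \<open>F\<close> on the set \<open>N\<close> to \<open>N\<close>.\<close>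

definition relation_module ::
  "('a, 'x) ring_scheme \<Rightarrow> ('a, 'n, 'y) right_module_scheme \<Rightarrow> ('a, 'n \<Rightarrow> 'a) right_module" where
  "relation_module R N = (free_right_module R (carrier N))\<lparr>carrier :=
     {\<phi> \<in> carrier (free_right_module R (carrier N)).
        (\<Oplus>\<^bsub>N\<^esub>x\<in>{x. \<phi> x \<noteq> \<zero>\<^bsub>R\<^esub>}. x \<bullet>\<^bsub>N\<^esub> \<phi> x) = \<zero>\<^bsub>N\<^esub>}\<rparr>"

text \<open>The map of free modules induced by a map \<open>h\<close> of basis sets.\<close>

definition free_map :: "('a, 'x) ring_scheme \<Rightarrow> ('n \<Rightarrow> 'n) \<Rightarrow> ('n \<Rightarrow> 'a) \<Rightarrow> 'n \<Rightarrow> 'a" where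
  "free_map R h \<phi> = (\<lambda>y. \<Oplus>\<^bsub>R\<^esub>x\<in>{x. \<phi> x \<noteq> \<zero>\<^bsub>R\<^esub> \<and> h x = y}. \<phi> x)"

text \<open>
  \<open>ext1 R N l M\<close> is \<open>Ext\<^sup>1\<^sub>R(N, M)\<close>, computed from the canonical projective presentation
  \<open>0 \<rightarrow> K \<rightarrow> F \<rightarrow> N \<rightarrow> 0\<close> as the cokernel of the restriction map
  \<open>Hom\<^sub>R(F, M) \<rightarrow> Hom\<^sub>R(K, M)\<close>.  If \<open>N\<close> is an \<open>S\<close>-\<open>R\<close>-bimodule with left action \<open>l\<close>, then \<open>Ext\<^sup>1\<close> is a
  right \<open>S\<close>-module: \<open>s\<close> acts by \<open>Ext\<^sup>1(l s, M)\<close>, that is, by composing cocycles with the lift of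
  the endomorphism \<open>l s\<close> of \<open>N\<close> to \<open>F\<close>.  The action on cosets is written in the style of
  \<^const>\<open>rcoset_mult\<close>, as the union of the (equal) cosets of the images of all representatives.
\<close>

definition ext1 ::
  "('a, 'x) ring_scheme \<Rightarrow> ('a, 'n, 'y) right_module_scheme \<Rightarrow> ('s \<Rightarrow> 'n \<Rightarrow> 'n) \<Rightarrow>
   ('a, 'm, 'z) right_module_scheme \<Rightarrow> ('s, (('n \<Rightarrow> 'a) \<Rightarrow> 'm) set) right_module" where
  "ext1 R N l M =
    (let F = free_right_module R (carrier N);
         K = relation_module R N;
         H = hom_group R K M;
         B = (\<lambda>g. restrict g (carrier K)) ` right_module_hom R F M
     in \<lparr>carrier = a_rcosets\<^bsub>H\<^esub> B, mult = undefined, one = undefined,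
         zero = B, add = set_add H,
         rsmult = (\<lambda>X s. \<Union>f\<in>X. B +>\<^bsub>H\<^esub> (\<lambda>\<phi>\<in>carrier K. f (free_map R (l s) \<phi>)))\<rparr>)"


section \<open>Links between prime ideals\<close>

definition fully_faithful :: "('a, 'x) ring_scheme \<Rightarrow> ('a, 'b, 'y) module_scheme \<Rightarrow> bool" where
  "fully_faithful S M \<longleftrightarrow> (\<forall>H. submodule H S M \<and> H \<noteq> {\<zero>\<^bsub>M\<^esub>} \<longrightarrow>
     (\<forall>s\<in>carrier S. (\<forall>x\<in>H. s \<odot>\<^bsub>M\<^esub> x = \<zero>\<^bsub>M\<^esub>) \<longrightarrow> s = \<zero>\<^bsub>S\<^esub>))"

text \<open>
  \<open>I/A\<close> for ideals \<open>A \<subseteq> I\<close>, as a left and as a right module.  The scalars are cosets of an ideal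
  \<open>P\<close> with \<open>PI \<subseteq> A\<close> (respectively \<open>Q\<close> with \<open>IQ \<subseteq> A\<close>); for such cosets \<open>[mod A:] (P + r) (A + x)\<close>
  is the coset \<open>A + rx\<close>, since \<^const>\<open>rcoset_mult\<close> multiplies all representatives.
\<close>

definition left_factor ::
  "('a, 'x) ring_scheme \<Rightarrow> 'a set \<Rightarrow> 'a set \<Rightarrow> ('a set, 'a set) module" where
  "left_factor R I A = \<lparr>carrier = (\<lambda>x. A +>\<^bsub>R\<^esub> x) ` I, mult = undefined, one = undefined,
     zero = A, add = set_add R, smult = (\<lambda>s X. rcoset_mult R A s X)\<rparr>"

definition right_factor ::
  "('a, 'x) ring_scheme \<Rightarrow> 'a set \<Rightarrow> 'a set \<Rightarrow> ('a set, 'a set) right_module" where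
  "right_factor R I A = \<lparr>carrier = (\<lambda>x. A +>\<^bsub>R\<^esub> x) ` I, mult = undefined, one = undefined,
     zero = A, add = set_add R, rsmult = (\<lambda>X s. rcoset_mult R A X s)\<rparr>"

definition linked :: "('a, 'x) ring_scheme \<Rightarrow> 'a set \<Rightarrow> 'a set \<Rightarrow> bool" where
  "linked R P Q \<longleftrightarrow> (\<exists>A. ideal A R \<and> ideal_prod R P Q \<subseteq> A \<and> A \<subset> P \<inter> Q \<and>
     fully_faithful (R Quot P) (left_factor R (P \<inter> Q) A) \<and>
     torsionfree (R Quot Q) (right_factor R (P \<inter> Q) A))"

end

theory Submission
  imports Defs
begin

text \<open>
  Let \<open>M = ann\<^sub>E(Q)\<close>.  Applying \<open>Hom\<^sub>R(-, M)\<close> to \<open>0 \<rightarrow> P \<rightarrow> R \<rightarrow> R/P \<rightarrow> 0\<close> represents a class in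
  \<open>Ext\<^sup>1\<^sub>R(R/P, M)\<close> by a homomorphism \<open>f : P \<rightarrow> M\<close>, and the class is zero exactly if \<open>f\<close> is left
  multiplication by some \<open>m \<in> M\<close>.  Since \<open>MQ = 0\<close>, such multiplications vanish on \<open>P \<inter> Q\<close>.
  Conversely, if \<open>f\<close> vanishes on \<open>P \<inter> Q\<close>, it extends by zero on \<open>Q\<close> to \<open>P + Q\<close> and then, as \<open>E\<close> is
  injective, to \<open>R \<rightarrow> E\<close> with the image of \<open>1\<close> annihilated by \<open>Q\<close>; so the class is zero.  Hence
  \<open>Ext\<^sup>1\<^sub>R(R/P, M)\<close> embeds in \<open>Hom\<^sub>R((P \<inter> Q)/PQ, M)\<close>, with \<open>R/P\<close> acting by \<open>(fr)(x) = f(rx)\<close>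
  (\<open>ext_class_eq\<close>, \<open>ext_rsmult\<close>).

  Among the nonzero families of such homomorphisms that come from classes in the given torsionfree
  submodule and are closed under the action, choose one whose common kernel \<open>A\<close> is maximal; the
  chain condition allows this because common kernels are ideals.  Then \<open>(P \<inter> Q)/A\<close> embeds in a power of \<open>M\<close>, and \<open>M\<close> is torsionfree
  over \<open>R/Q\<close> because it is an essential extension of a right ideal of \<open>R/Q\<close>, whose singular ideal is
  zero (\<open>tame_injective_annihilator_torsionfree\<close>).  If a nonzero left submodule \<open>L/A\<close> had a nonzero
  annihilator in \<open>R/P\<close>, Goldie's theorem would supply a regular element \<open>c\<close> of that annihilator.
  Multiplying by \<open>c\<close> gives nonzero members of the family that vanish on \<open>L\<close>; those members form a
  smaller family with the same properties, whose kernel contains \<open>A\<close> and \<open>L\<close>, contradicting the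
  maximality of \<open>A\<close> (\<open>linked_from_torsionfree_family\<close>).

  The part of Goldie's theorem needed here, that an essential right ideal of a prime right
  noetherian ring contains a regular element (\<open>essential_right_ideal_has_regular_element\<close>), is proved
  from the ascending chain condition for right ideals, without rings of fractions.
\<close>

section \<open>Right ideals and the ascending chain condition\<close>

context ring
begin

lemma right_ideal_iff:
  "right_ideal I R \<longleftrightarrow> I \<subseteq> carrier R \<and> \<zero> \<in> I \<and> (\<forall>x\<in>I. \<forall>y\<in>I. x \<oplus> y \<in> I) \<and>
     (\<forall>x\<in>I. \<forall>a\<in>carrier R. x \<otimes> a \<in> I)"
proof
  assume I: "right_ideal I R"
  then interpret I: additive_subgroup I "regular_right_module R"
    by (simp add: right_ideal_def right_submodule_def)
  show "I \<subseteq> carrier R \<and> \<zero> \<in> I \<and> (\<forall>x\<in>I. \<forall>y\<in>I. x \<oplus> y \<in> I) \<and>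
     (\<forall>x\<in>I. \<forall>a\<in>carrier R. x \<otimes> a \<in> I)"
    using I I.a_subset I.zero_closed I.a_closed
    by (auto simp: right_ideal_def right_submodule_def regular_right_module_def)
next
  interpret M: right_module R "regular_right_module R"
    by (rule right_module_regular) unfold_locales
  assume "I \<subseteq> carrier R \<and> \<zero> \<in> I \<and> (\<forall>x\<in>I. \<forall>y\<in>I. x \<oplus> y \<in> I) \<and>
     (\<forall>x\<in>I. \<forall>a\<in>carrier R. x \<otimes> a \<in> I)"
  then show "right_ideal I R"
    unfolding right_ideal_def
    by (intro M.right_submoduleI) (auto simp: regular_right_module_def)
qed

text \<open>Closure under negation is automatic, since \<open>-x = (-1)x\<close>.\<close>

lemma ideal_by_closure:
  assumes "I \<subseteq> carrier R" "\<zero> \<in> I" "\<And>x y. \<lbrakk>x \<in> I; y \<in> I\<rbrakk> \<Longrightarrow> x \<oplus> y \<in> I"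
    and left: "\<And>x a. \<lbrakk>x \<in> I; a \<in> carrier R\<rbrakk> \<Longrightarrow> a \<otimes> x \<in> I"
    and right: "\<And>x a. \<lbrakk>x \<in> I; a \<in> carrier R\<rbrakk> \<Longrightarrow> x \<otimes> a \<in> I"
  shows "ideal I R"
proof (intro idealI add.subgroupI)
  fix x assume x: "x \<in> I"
  then have "\<ominus> x = \<ominus> \<one> \<otimes> x" using assms(1) by (auto simp: l_minus)
  also have "\<dots> \<in> I" using left x by simp
  finally show "\<ominus> x \<in> I" .
qed (use assms ring_axioms in auto)

lemma right_noetherian_maximal:
  assumes noeth: "right_noetherian R"
    and ne: "I0 \<in> \<F>" and ideals: "\<And>I. I \<in> \<F> \<Longrightarrow> right_ideal I R"
  obtains I where "I \<in> \<F>" "\<And>J. \<lbrakk>J \<in> \<F>; I \<subseteq> J\<rbrakk> \<Longrightarrow> J = I"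
proof (rule ccontr)
  assume "\<not> thesis"
  then have "\<exists>J. J \<in> \<F> \<and> I \<subset> J" if "I \<in> \<F>" for I
    using that \<open>\<And>I. \<lbrakk>I \<in> \<F>; \<And>J. \<lbrakk>J \<in> \<F>; I \<subseteq> J\<rbrakk> \<Longrightarrow> J = I\<rbrakk> \<Longrightarrow> thesis\<close> by (metis psubsetI)
  then obtain f where f: "\<And>I. I \<in> \<F> \<Longrightarrow> f I \<in> \<F> \<and> I \<subset> f I" by metis
  define C where "C n = (f ^^ n) I0" for n
  have C: "C n \<in> \<F>" for n
    by (induction n) (auto simp: C_def ne f)
  have step: "C n \<subset> C (Suc n)" for n
    using f[OF C[of n]] by (simp add: C_def)
  then have "\<exists>N. \<forall>n\<ge>N. C n = C N"
    using noeth C ideals unfolding right_noetherian_def by (meson psubset_imp_subset)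
  then show False
    using step by (metis le_SucI order_refl psubset_eq)
qed

definition right_annihilator :: "'a \<Rightarrow> 'a set" where
  "right_annihilator a = {x \<in> carrier R. a \<otimes> x = \<zero>}"

lemma right_annihilator_right_ideal:
  assumes "a \<in> carrier R" shows "right_ideal (right_annihilator a) R"
  using assms by (auto simp: right_ideal_iff right_annihilator_def r_distr m_assoc[symmetric])

lemma principal_right_ideal:
  assumes "a \<in> carrier R" shows "right_ideal ((\<otimes>) a ` carrier R) R"
  unfolding right_ideal_iff
proof (intro conjI ballI)
  show "\<zero> \<in> (\<otimes>) a ` carrier R"
    using assms by (intro image_eqI[of _ _ "\<zero>"]) auto
qed (use assms in \<open>auto simp: r_distr[symmetric] m_assoc\<close>)

definition essential_right_ideal :: "'a set \<Rightarrow> bool" where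
  "essential_right_ideal I \<longleftrightarrow>
     (\<forall>K. right_ideal K R \<and> K \<noteq> {\<zero>} \<longrightarrow> (\<exists>x\<in>I \<inter> K. x \<noteq> \<zero>))"

text \<open>
  If \<open>c\<close> has zero right annihilator and \<open>cR \<inter> K = 0\<close>, then the sum \<open>K + cK + c\<^sup>2K + \<dots>\<close> is direct.
  Its partial sums \<open>T\<^sub>0 = K\<close>, \<open>T\<^sub>n\<^sub>+\<^sub>1 = K + cT\<^sub>n\<close> stabilise, and cancelling \<open>c\<close> pulls the equality
  \<open>T\<^sub>n\<^sub>+\<^sub>1 = T\<^sub>n\<close> down to \<open>T\<^sub>1 = T\<^sub>0\<close>, which forces \<open>cK \<subseteq> cR \<inter> K = 0\<close>.
\<close>

lemma right_cancellable_generates_essential: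
  assumes noeth: "right_noetherian R" and c: "c \<in> carrier R"
    and cancel: "\<And>x. \<lbrakk>x \<in> carrier R; c \<otimes> x = \<zero>\<rbrakk> \<Longrightarrow> x = \<zero>"
  shows "essential_right_ideal ((\<otimes>) c ` carrier R)"
  unfolding essential_right_ideal_def
proof (intro allI impI, rule ccontr)
  fix K
  assume "right_ideal K R \<and> K \<noteq> {\<zero>}" and disj': "\<not> (\<exists>x\<in>(\<otimes>) c ` carrier R \<inter> K. x \<noteq> \<zero>)"
  then have Kr: "right_ideal K R" and Kn: "K \<noteq> {\<zero>}" by auto
  have disj: "x = \<zero>" if "x \<in> carrier R" "c \<otimes> x \<in> K" for x
    using disj' cancel that by blast
  have K: "K \<subseteq> carrier R" "\<zero> \<in> K" "\<And>x y. \<lbrakk>x \<in> K; y \<in> K\<rbrakk> \<Longrightarrow> x \<oplus> y \<in> K"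
    "\<And>x a. \<lbrakk>x \<in> K; a \<in> carrier R\<rbrakk> \<Longrightarrow> x \<otimes> a \<in> K"
    using Kr by (auto simp: right_ideal_iff)
  define next_sum where "next_sum T = {k \<oplus> c \<otimes> t |k t. k \<in> K \<and> t \<in> T}" for T
  define T where "T n = (next_sum ^^ n) K" for n
  have T0: "T 0 = K" and TS: "\<And>n. T (Suc n) = next_sum (T n)"
    by (auto simp: T_def)
  have ideals: "right_ideal (T n) R" for n
  proof (induction n)
    case (Suc n)
    then have Tn: "T n \<subseteq> carrier R" "\<zero> \<in> T n" "\<And>x y. \<lbrakk>x \<in> T n; y \<in> T n\<rbrakk> \<Longrightarrow> x \<oplus> y \<in> T n"
      "\<And>x a. \<lbrakk>x \<in> T n; a \<in> carrier R\<rbrakk> \<Longrightarrow> x \<otimes> a \<in> T n"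
      by (auto simp: right_ideal_iff)
    show ?case unfolding right_ideal_iff TS next_sum_def
    proof (intro conjI ballI)
      show "{k \<oplus> c \<otimes> t |k t. k \<in> K \<and> t \<in> T n} \<subseteq> carrier R"
        using K(1) Tn(1) c by auto
      show "\<zero> \<in> {k \<oplus> c \<otimes> t |k t. k \<in> K \<and> t \<in> T n}"
        using K(2) Tn(2) c by force
    next
      fix x y assume "x \<in> {k \<oplus> c \<otimes> t |k t. k \<in> K \<and> t \<in> T n}"
        "y \<in> {k \<oplus> c \<otimes> t |k t. k \<in> K \<and> t \<in> T n}"
      then obtain k t k' t' where 1: "x = k \<oplus> c \<otimes> t" "y = k' \<oplus> c \<otimes> t'" "k \<in> K" "t \<in> T n"
        "k' \<in> K" "t' \<in> T n" by blast
      have "k \<in> carrier R" "k' \<in> carrier R" "t \<in> carrier R" "t' \<in> carrier R"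
        using 1 K(1) Tn(1) by auto
      then have "x \<oplus> y = (k \<oplus> k') \<oplus> c \<otimes> (t \<oplus> t')"
        using c by (simp add: 1 r_distr a_ac)
      then show "x \<oplus> y \<in> {k \<oplus> c \<otimes> t |k t. k \<in> K \<and> t \<in> T n}"
        using 1 K(3) Tn(3) by blast
    next
      fix x a assume a: "a \<in> carrier R" and "x \<in> {k \<oplus> c \<otimes> t |k t. k \<in> K \<and> t \<in> T n}"
      then obtain k t where 1: "x = k \<oplus> c \<otimes> t" "k \<in> K" "t \<in> T n" by blast
      have "k \<in> carrier R" "t \<in> carrier R"
        using 1 K(1) Tn(1) by auto
      then have "x \<otimes> a = k \<otimes> a \<oplus> c \<otimes> (t \<otimes> a)"
        using a c by (simp add: 1 l_distr m_assoc)
      then show "x \<otimes> a \<in> {k \<oplus> c \<otimes> t |k t. k \<in> K \<and> t \<in> T n}"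
        using 1 K(4) Tn(4) a by blast
    qed
  qed (use Kr T0 in simp)
  have sub: "T n \<subseteq> carrier R" for n
    using ideals[of n] by (simp add: right_ideal_iff)
  have zT: "\<zero> \<in> T n" for n
    using ideals[of n] by (simp add: right_ideal_iff)
  have incr: "T n \<subseteq> T (Suc n)" for n
  proof (induction n)
    case 0
    show ?case
    proof
      fix k assume "k \<in> T 0"
      then have "k = k \<oplus> c \<otimes> \<zero>" "k \<in> K" using T0 K(1) c by auto
      then show "k \<in> T (Suc 0)"
        unfolding TS next_sum_def using zT[of 0] by blast
    qed
  next
    case (Suc n)
    then have "next_sum (T n) \<subseteq> next_sum (T (Suc n))" by (auto simp: next_sum_def)
    then show ?case by (simp only: TS)
  qed
  obtain N where N: "T (Suc N) = T N"
    using noeth ideals incr unfolding right_noetherian_def by (metis le_SucI order_refl)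
  have "T (Suc n) = T n \<Longrightarrow> T 1 = T 0" for n
  proof (induction n)
    case (Suc n)
    have "T (Suc n) \<subseteq> T n"
    proof
      fix t assume t: "t \<in> T (Suc n)"
      have "\<zero> \<oplus> c \<otimes> t \<in> T (Suc (Suc n))"
        unfolding TS[of "Suc n"] next_sum_def using K(2) t by blast
      then have "\<zero> \<oplus> c \<otimes> t \<in> next_sum (T n)"
        using Suc.prems TS by simp
      then obtain k t' where k: "\<zero> \<oplus> c \<otimes> t = k \<oplus> c \<otimes> t'" "k \<in> K" "t' \<in> T n"
        unfolding next_sum_def by blast
      have cc: "t \<in> carrier R" "t' \<in> carrier R" "k \<in> carrier R"
        using t k sub K(1) by blast+
      have "c \<otimes> t = k \<oplus> c \<otimes> t'" using k(1) cc c by simp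
      then have "c \<otimes> (t \<ominus> t') = k"
        using cc c by (simp add: a_minus_def r_distr r_minus a_assoc r_neg)
      then have "t \<ominus> t' = \<zero>" using disj[of "t \<ominus> t'"] k(2) cc by simp
      then have "t = t'" using cc by (metis a_minus_def add.inv_closed minus_equality minus_minus)
      then show "t \<in> T n" using k(3) by simp
    qed
    then show ?case using Suc.IH incr[of n] by blast
  qed simp
  then have "T 1 = K" using N T0 by metis
  have "x = \<zero>" if "x \<in> K" for x
  proof (rule disj)
    show "x \<in> carrier R" using that K(1) by blast
    have "\<zero> \<oplus> c \<otimes> x \<in> T 1"
      using TS[of 0] T0 K(2) that by (auto simp: next_sum_def)
    then show "c \<otimes> x \<in> K" using \<open>T 1 = K\<close> c \<open>x \<in> carrier R\<close> by simp
  qed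
  then show False using Kn K(2) by blast
qed

end

section \<open>Goldie's theorem for prime right noetherian rings\<close>

text \<open>
  Primeness of the ring is required in its elementwise form, which the zero ring satisfies as well.
\<close>

locale prime_right_noetherian = ring R for R (structure) +
  assumes noetherian: "right_noetherian R"
    and prime: "\<lbrakk>a \<in> carrier R; b \<in> carrier R; \<And>x. x \<in> carrier R \<Longrightarrow> a \<otimes> x \<otimes> b = \<zero>\<rbrakk> \<Longrightarrow>
      a = \<zero> \<or> b = \<zero>"
begin

text \<open>
  Among the nonzero \<open>k \<in> K\<close> choose one with maximal right annihilator.  Primeness gives \<open>t\<close> with
  \<open>ktk \<noteq> 0\<close>, and \<open>ktk\<close> then has the same right annihilator as \<open>k\<close>; so \<open>ktktx = 0\<close> implies \<open>ktx = 0\<close>,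
  and \<open>b = kt\<close> works.
\<close>

lemma right_ideal_has_stable_element:
  assumes Kr: "right_ideal K R" and "K \<noteq> {\<zero>}"
  obtains b where "b \<in> K" "b \<noteq> \<zero>" "\<And>x. \<lbrakk>x \<in> carrier R; b \<otimes> (b \<otimes> x) = \<zero>\<rbrakk> \<Longrightarrow> b \<otimes> x = \<zero>"
proof -
  have K: "K \<subseteq> carrier R" "\<zero> \<in> K" "\<And>x a. \<lbrakk>x \<in> K; a \<in> carrier R\<rbrakk> \<Longrightarrow> x \<otimes> a \<in> K"
    using Kr by (auto simp: right_ideal_iff)
  obtain k0 where "k0 \<in> K - {\<zero>}" using assms K(2) by blast
  then have ne: "right_annihilator k0 \<in> right_annihilator ` (K - {\<zero>})" by blast
  obtain I where I: "I \<in> right_annihilator ` (K - {\<zero>})"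
    and max: "\<And>J. \<lbrakk>J \<in> right_annihilator ` (K - {\<zero>}); I \<subseteq> J\<rbrakk> \<Longrightarrow> J = I"
    using right_noetherian_maximal[OF noetherian ne] right_annihilator_right_ideal K(1) by blast
  obtain k where k: "k \<in> K" "k \<noteq> \<zero>" and Ik: "I = right_annihilator k" using I by auto
  have kc: "k \<in> carrier R" using k K by blast
  obtain t where t: "t \<in> carrier R" and ktk: "k \<otimes> t \<otimes> k \<noteq> \<zero>"
    using prime[of k k] k kc by blast
  have ktkK: "k \<otimes> t \<otimes> k \<in> K" using K(3) k(1) kc t by blast
  have "right_annihilator k \<subseteq> right_annihilator (k \<otimes> t \<otimes> k)"
    using kc t by (auto simp: right_annihilator_def m_assoc)
  then have eq: "right_annihilator (k \<otimes> t \<otimes> k) = right_annihilator k"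
    using max ktkK ktk Ik by blast
  show thesis
  proof
    show "k \<otimes> t \<in> K" using K(3) k(1) t by blast
    show "k \<otimes> t \<noteq> \<zero>" using ktk kc by auto
    fix x assume x: "x \<in> carrier R" and "k \<otimes> t \<otimes> (k \<otimes> t \<otimes> x) = \<zero>"
    then have "t \<otimes> x \<in> right_annihilator (k \<otimes> t \<otimes> k)"
      using kc t by (simp add: right_annihilator_def m_assoc)
    then have "t \<otimes> x \<in> right_annihilator k" by (simp add: eq)
    then show "k \<otimes> t \<otimes> x = \<zero>" using kc t x by (simp add: right_annihilator_def m_assoc)
  qed
qed

text \<open>
  This is the vanishing of the right singular ideal.  If \<open>z \<noteq> 0\<close> had essential annihilator, so would each \<open>zt\<close>;
  but for \<open>b = zt\<close> as in the preceding lemma the annihilator of \<open>b\<close> meets \<open>bR\<close> in zero.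
\<close>

lemma essential_annihilator_imp_zero:
  assumes z: "z \<in> carrier R" and ess: "essential_right_ideal (right_annihilator z)"
  shows "z = \<zero>"
proof (rule ccontr)
  assume "z \<noteq> \<zero>"
  have "z \<otimes> \<one> \<in> (\<otimes>) z ` carrier R" by blast
  then have "(\<otimes>) z ` carrier R \<noteq> {\<zero>}" using \<open>z \<noteq> \<zero>\<close> z by auto
  from right_ideal_has_stable_element[OF principal_right_ideal[OF z] this]
  obtain b where b: "b \<in> (\<otimes>) z ` carrier R" "b \<noteq> \<zero>"
    and stable: "\<And>x. \<lbrakk>x \<in> carrier R; b \<otimes> (b \<otimes> x) = \<zero>\<rbrakk> \<Longrightarrow> b \<otimes> x = \<zero>" by blast
  obtain t where t: "t \<in> carrier R" and bt: "b = z \<otimes> t" using b by blast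
  have bc: "b \<in> carrier R" using bt t z by simp
  define K where "K = (\<otimes>) (t \<otimes> b) ` carrier R"
  have "right_ideal K R"
    unfolding K_def using principal_right_ideal t bc by simp
  moreover have "b \<otimes> b \<noteq> \<zero>"
    using stable[of \<one>] bc b(2) by auto
  then have "t \<otimes> b \<noteq> \<zero>" using bt z bc t by (metis m_assoc r_null)
  then have "K \<noteq> {\<zero>}" unfolding K_def using t bc
    by (metis image_eqI m_closed one_closed r_one singletonD)
  ultimately obtain x where x: "x \<in> right_annihilator z" "x \<in> K" "x \<noteq> \<zero>"
    using ess unfolding essential_right_ideal_def by blast
  obtain s where s: "s \<in> carrier R" "x = t \<otimes> b \<otimes> s" using x(2) K_def by blast
  have "b \<otimes> (b \<otimes> s) = \<zero>"
    using x(1) s t z bc bt by (simp add: right_annihilator_def m_assoc)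
  then have "b \<otimes> s = \<zero>" using stable s by blast
  then show False using x(3) s t bc by (simp add: m_assoc)
qed

text \<open>
  Instead of an infinite direct sum \<open>c\<^sub>1R + c\<^sub>2R + \<dots>\<close>, a maximality argument is used.
  Choose a right ideal \<open>J \<subseteq> I\<close> maximal with the property that some \<open>c \<in> J\<close> satisfies
  \<open>J \<inter> r(c) = 0\<close>, where \<open>r\<close> denotes right annihilators.  If \<open>r(c) \<inter> I\<close> were nonzero, a stable
  element \<open>b\<close> of it would give the larger \<open>J + bR\<close>, with \<open>c + b\<close> in the role of \<open>c\<close>.
\<close>

lemma right_ideal_has_element_with_small_annihilator:
  assumes Ir: "right_ideal I R"
  obtains c where "c \<in> I" "\<And>x. \<lbrakk>x \<in> I; c \<otimes> x = \<zero>\<rbrakk> \<Longrightarrow> x = \<zero>"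
proof -
  have I: "I \<subseteq> carrier R" "\<zero> \<in> I" "\<And>x y. \<lbrakk>x \<in> I; y \<in> I\<rbrakk> \<Longrightarrow> x \<oplus> y \<in> I"
    "\<And>x a. \<lbrakk>x \<in> I; a \<in> carrier R\<rbrakk> \<Longrightarrow> x \<otimes> a \<in> I"
    using Ir by (auto simp: right_ideal_iff)
  define \<J> where "\<J> = {J. right_ideal J R \<and> J \<subseteq> I \<and> (\<exists>c\<in>J. \<forall>x\<in>J. c \<otimes> x = \<zero> \<longrightarrow> x = \<zero>)}"
  have "{\<zero>} \<in> \<J>" using I(2) by (auto simp: \<J>_def right_ideal_iff)
  then obtain J where "J \<in> \<J>" and max: "\<And>J'. \<lbrakk>J' \<in> \<J>; J \<subseteq> J'\<rbrakk> \<Longrightarrow> J' = J"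
    using right_noetherian_maximal[OF noetherian, of _ \<J>] \<J>_def by blast
  then obtain c where Jr: "right_ideal J R" and JI: "J \<subseteq> I" and c: "c \<in> J"
    and cJ: "\<And>x. \<lbrakk>x \<in> J; c \<otimes> x = \<zero>\<rbrakk> \<Longrightarrow> x = \<zero>" by (auto simp: \<J>_def)
  have J: "J \<subseteq> carrier R" "\<zero> \<in> J" "\<And>x y. \<lbrakk>x \<in> J; y \<in> J\<rbrakk> \<Longrightarrow> x \<oplus> y \<in> J"
    "\<And>x a. \<lbrakk>x \<in> J; a \<in> carrier R\<rbrakk> \<Longrightarrow> x \<otimes> a \<in> J"
    using Jr by (auto simp: right_ideal_iff)
  have cc: "c \<in> carrier R" using c J by blast
  have "right_annihilator c \<inter> I = {\<zero>}"
  proof (rule ccontr)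
    assume ne: "right_annihilator c \<inter> I \<noteq> {\<zero>}"
    have "right_ideal (right_annihilator c \<inter> I) R"
      using right_annihilator_right_ideal[OF cc] Ir by (auto simp: right_ideal_iff)
    from right_ideal_has_stable_element[OF this ne]
    obtain b where b: "b \<in> right_annihilator c" "b \<in> I" "b \<noteq> \<zero>"
      and stable: "\<And>x. \<lbrakk>x \<in> carrier R; b \<otimes> (b \<otimes> x) = \<zero>\<rbrakk> \<Longrightarrow> b \<otimes> x = \<zero>" by blast
    have bc: "b \<in> carrier R" and cb: "c \<otimes> b = \<zero>" using b by (auto simp: right_annihilator_def)
    define J' where "J' = {j \<oplus> b \<otimes> s |j s. j \<in> J \<and> s \<in> carrier R}"
    have "j = j \<oplus> b \<otimes> \<zero>" if "j \<in> J" for j using that J(1) bc by auto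
    then have JJ': "J \<subseteq> J'" unfolding J'_def using zero_closed by blast
    have "b = \<zero> \<oplus> b \<otimes> \<one>" using bc by simp
    then have bJ': "b \<in> J'" unfolding J'_def using J(2) one_closed by blast
    have "c \<oplus> b = c \<oplus> b \<otimes> \<one>" using bc by simp
    then have cbJ': "c \<oplus> b \<in> J'" unfolding J'_def using c one_closed by blast
    have "right_ideal J' R" unfolding right_ideal_iff
    proof (intro conjI ballI)
      show "J' \<subseteq> carrier R" using J(1) bc by (auto simp: J'_def)
      show "\<zero> \<in> J'" using J(2) JJ' by blast
    next
      fix x y assume "x \<in> J'" "y \<in> J'"
      then obtain j s j' s' where 1: "x = j \<oplus> b \<otimes> s" "y = j' \<oplus> b \<otimes> s'" "j \<in> J" "j' \<in> J"
        "s \<in> carrier R" "s' \<in> carrier R" unfolding J'_def by blast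
      then have "x \<oplus> y = (j \<oplus> j') \<oplus> b \<otimes> (s \<oplus> s')"
        using bc J(1) by (simp add: r_distr a_ac subset_iff)
      then show "x \<oplus> y \<in> J'" unfolding J'_def using 1 J(3) by blast
    next
      fix x a assume a: "a \<in> carrier R" and "x \<in> J'"
      then obtain j s where 1: "x = j \<oplus> b \<otimes> s" "j \<in> J" "s \<in> carrier R" unfolding J'_def by blast
      then have "x \<otimes> a = j \<otimes> a \<oplus> b \<otimes> (s \<otimes> a)"
        using bc J(1) a by (simp add: l_distr m_assoc subset_iff)
      then show "x \<otimes> a \<in> J'" unfolding J'_def using 1 J(4) a by blast
    qed
    moreover have "J' \<subseteq> I" using I JI b(2) by (auto simp: J'_def)
    moreover have "y = \<zero>" if yJ': "y \<in> J'" and y0: "(c \<oplus> b) \<otimes> y = \<zero>" for y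
    proof -
      obtain j s where 1: "y = j \<oplus> b \<otimes> s" "j \<in> J" "s \<in> carrier R" using yJ' unfolding J'_def by blast
      have jc: "j \<in> carrier R" using 1 J by blast
      then have yc: "y \<in> carrier R" using 1 bc by simp
      have "c \<otimes> (c \<otimes> y) = c \<otimes> ((c \<oplus> b) \<otimes> y)"
        using cc bc yc cb by (simp add: l_distr r_distr m_assoc[symmetric])
      then have "c \<otimes> (c \<otimes> y) = \<zero>" using y0 cc by simp
      moreover have "c \<otimes> y \<in> J" using J(4) c yc by blast
      ultimately have cy: "c \<otimes> y = \<zero>" using cJ by blast
      have "c \<otimes> y = c \<otimes> j"
        using 1 cc bc jc cb by (simp add: r_distr m_assoc[symmetric])
      then have "j = \<zero>" using cy cJ 1 by simp
      then have y: "y = b \<otimes> s" using 1 bc by simp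
      have "b \<otimes> y = \<zero>" using y0 cy cc bc yc by (simp add: l_distr)
      then show ?thesis using stable[of s] 1 y by simp
    qed
    ultimately have "J' \<in> \<J>" using cbJ' by (auto simp: \<J>_def)
    then have "J' = J" using max JJ' by blast
    then show False using bJ' cJ cb b(3) by blast
  qed
  then have "x = \<zero>" if "x \<in> I" "c \<otimes> x = \<zero>" for x
    using that I(1) unfolding right_annihilator_def by blast
  then show thesis using that c JI by blast
qed

text \<open>
  An element \<open>c\<close> of an essential right ideal whose right annihilator misses that ideal is
  right cancellable; then \<open>cR\<close> is essential and annihilated on the left by every \<open>x\<close> with
  \<open>xc = 0\<close>, so that \<open>x\<close> lies in the singular ideal.
\<close>

theorem essential_right_ideal_has_regular_element:
  assumes Ir: "right_ideal I R" and ess: "essential_right_ideal I"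
  shows "\<exists>c\<in>I. c \<in> regular_elements R"
proof -
  obtain c where c: "c \<in> I" and cI: "\<And>x. \<lbrakk>x \<in> I; c \<otimes> x = \<zero>\<rbrakk> \<Longrightarrow> x = \<zero>"
    using right_ideal_has_element_with_small_annihilator[OF Ir] by blast
  have cc: "c \<in> carrier R" using c Ir by (auto simp: right_ideal_iff)
  have "right_annihilator c = {\<zero>}"
    using ess cI right_annihilator_right_ideal[OF cc]
    unfolding essential_right_ideal_def by (auto simp: right_annihilator_def)
  then have l: "x = \<zero>" if "x \<in> carrier R" "c \<otimes> x = \<zero>" for x
    using that by (auto simp: right_annihilator_def)
  then have ess': "essential_right_ideal ((\<otimes>) c ` carrier R)"
    using right_cancellable_generates_essential[OF noetherian cc] by blast
  have "x = \<zero>" if x: "x \<in> carrier R" "x \<otimes> c = \<zero>" for x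
  proof (rule essential_annihilator_imp_zero[OF x(1)])
    have "(\<otimes>) c ` carrier R \<subseteq> right_annihilator x"
      using x cc by (auto simp: right_annihilator_def m_assoc[symmetric])
    then show "essential_right_ideal (right_annihilator x)"
      using ess' unfolding essential_right_ideal_def by blast
  qed
  then have "c \<in> regular_elements R" using cc l unfolding regular_elements_def by blast
  then show ?thesis using c by blast
qed

text \<open>A nonzero ideal of a prime ring is essential: \<open>kRa\<close> is nonzero and lies in both ideals.\<close>

corollary nonzero_ideal_has_regular_element:
  assumes "ideal I R" and "I \<noteq> {\<zero>}"
  shows "\<exists>c\<in>I. c \<in> regular_elements R"
proof (rule essential_right_ideal_has_regular_element)
  interpret I: ideal I R by fact
  show "right_ideal I R"
    using I.a_subset I.I_r_closed by (auto simp: right_ideal_iff)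
  obtain a where a: "a \<in> I" "a \<noteq> \<zero>" using assms(2) I.zero_closed by blast
  show "essential_right_ideal I" unfolding essential_right_ideal_def
  proof (intro allI impI)
    fix K assume K: "right_ideal K R \<and> K \<noteq> {\<zero>}"
    then obtain k where k: "k \<in> K" "k \<noteq> \<zero>" "k \<in> carrier R" by (auto simp: right_ideal_iff)
    then obtain x where x: "x \<in> carrier R" "k \<otimes> x \<otimes> a \<noteq> \<zero>"
      using prime[of k a] a I.a_subset by blast
    have "k \<otimes> x \<otimes> a \<in> I" using I.I_l_closed a k x by simp
    moreover have "k \<otimes> x \<otimes> a \<in> K" using K k x a I.a_subset by (auto simp: right_ideal_iff)
    ultimately show "\<exists>x\<in>I \<inter> K. x \<noteq> \<zero>" using x by blast
  qed
qed

end

section \<open>Factor rings\<close>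

context ideal
begin

lemma quot_carrier_cases:
  assumes "X \<in> carrier (R Quot I)"
  obtains r where "r \<in> carrier R" "X = I +> r"
  using assms by (auto simp: FactRing_def A_RCOSETS_def')

lemma quot_coset_closed: "r \<in> carrier R \<Longrightarrow> I +> r \<in> carrier (R Quot I)"
  by (simp add: FactRing_def a_rcosetsI a_subset)

lemma quot_zero: "\<zero>\<^bsub>R Quot I\<^esub> = I"
  by (simp add: FactRing_def)

lemma quot_one: "\<one>\<^bsub>R Quot I\<^esub> = I +> \<one>"
  by (simp add: FactRing_def)

lemma quot_mult:
  "\<lbrakk>x \<in> carrier R; y \<in> carrier R\<rbrakk> \<Longrightarrow> (I +> x) \<otimes>\<^bsub>R Quot I\<^esub> (I +> y) = I +> (x \<otimes> y)"
  by (simp add: FactRing_def rcoset_mult_add)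

lemma quot_add:
  "\<lbrakk>x \<in> carrier R; y \<in> carrier R\<rbrakk> \<Longrightarrow> (I +> x) \<oplus>\<^bsub>R Quot I\<^esub> (I +> y) = I +> (x \<oplus> y)"
  by (simp add: FactRing_def a_rcos_sum)

lemma coset_eq_self_iff: "x \<in> carrier R \<Longrightarrow> I +> x = I \<longleftrightarrow> x \<in> I"
  using a_coset_join1 a_coset_join2 a_subgroup by (metis a_rcos_self a_rcos_const)

lemma right_noetherian_quot:
  assumes "right_noetherian R"
  shows "right_noetherian (R Quot I)"
  unfolding right_noetherian_def
proof (intro allI impI)
  interpret S: ring "R Quot I" by (rule quotient_is_ring)
  fix L :: "nat \<Rightarrow> 'a set set"
  assume L: "(\<forall>n. right_ideal (L n) (R Quot I)) \<and> (\<forall>n. L n \<subseteq> L (Suc n))"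
  define L' where "L' n = {r \<in> carrier R. I +> r \<in> L n}" for n
  have ideals: "right_ideal (L' n) R" for n
  proof -
    have "right_ideal (L n) (R Quot I)" using L by blast
    then show ?thesis
      using coset_eq_self_iff[of \<zero>]
      by (auto simp: S.right_ideal_iff right_ideal_iff L'_def quot_zero quot_add[symmetric]
            quot_mult[symmetric] quot_coset_closed)
  qed
  moreover have "L' n \<subseteq> L' (Suc n)" for n
    using L by (auto simp: L'_def)
  ultimately obtain N where N: "\<And>n. n \<ge> N \<Longrightarrow> L' n = L' N"
    using assms unfolding right_noetherian_def by meson
  have "L n = (+>) I ` L' n" for n
  proof -
    have "L n \<subseteq> carrier (R Quot I)" using L by (auto simp: S.right_ideal_iff)
    then show ?thesis unfolding L'_def by (auto elim: quot_carrier_cases)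
  qed
  then show "\<exists>N. \<forall>n\<ge>N. L n = L N" using N by metis
qed

end

text \<open>
  If \<open>aRb \<subseteq> P\<close>, then \<open>J = {y. aRy \<subseteq> P}\<close> is an ideal
  containing \<open>b\<close>, the left annihilator of \<open>J\<close> modulo \<open>P\<close> is an ideal containing \<open>a\<close>, and the
  product of the two ideals lies in \<open>P\<close>.
\<close>

lemma (in ring) prime_ideal_elements:
  assumes P: "prime_ideal P R" and a: "a \<in> carrier R" and b: "b \<in> carrier R"
    and ab: "\<And>x. x \<in> carrier R \<Longrightarrow> a \<otimes> x \<otimes> b \<in> P"
  shows "a \<in> P \<or> b \<in> P"
proof -
  interpret P: ideal P R using P by (simp add: prime_ideal_def)
  have Pc: "x \<in> P \<Longrightarrow> x \<in> carrier R" for x using P.a_subset by blast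
  define J where "J = {y \<in> carrier R. \<forall>x\<in>carrier R. a \<otimes> x \<otimes> y \<in> P}"
  define I where "I = {z \<in> carrier R. \<forall>y\<in>J. z \<otimes> y \<in> P}"
  have Jc: "y \<in> J \<Longrightarrow> y \<in> carrier R" for y by (simp add: J_def)
  have Jl: "r \<otimes> y \<in> J" if "y \<in> J" "r \<in> carrier R" for r y
  proof -
    have "a \<otimes> x \<otimes> (r \<otimes> y) = a \<otimes> (x \<otimes> r) \<otimes> y" if "x \<in> carrier R" for x
      using that a \<open>y \<in> J\<close> \<open>r \<in> carrier R\<close> by (simp add: J_def m_assoc)
    then show ?thesis using that by (simp add: J_def)
  qed
  have J: "ideal J R"
  proof (rule ideal_by_closure)
    fix y x assume yx: "y \<in> J" "x \<in> carrier R"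
    have "a \<otimes> u \<otimes> (y \<otimes> x) = (a \<otimes> u \<otimes> y) \<otimes> x" if "u \<in> carrier R" for u
      using that yx a by (simp add: J_def m_assoc)
    then show "y \<otimes> x \<in> J" using yx by (simp add: J_def P.I_r_closed)
  qed (use a Jl in \<open>auto simp: J_def r_distr\<close>)
  have Ir: "z \<otimes> r \<in> I" if "z \<in> I" "r \<in> carrier R" for z r
    using that Jl Jc by (auto simp: I_def m_assoc)
  have I: "ideal I R"
    using Jc Ir P.I_l_closed
    by (intro ideal_by_closure) (auto simp: I_def l_distr m_assoc)
  have "ideal_prod R I J \<subseteq> P"
  proof
    fix x assume "x \<in> ideal_prod R I J"
    then show "x \<in> P" by induction (auto simp: I_def)
  qed
  then have "I \<subseteq> P \<or> J \<subseteq> P" using P I J unfolding prime_ideal_def by blast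
  moreover have "b \<in> J" using b ab by (simp add: J_def)
  moreover have "a \<in> I"
  proof -
    have "a \<otimes> y \<in> P" if "y \<in> J" for y
      using that a Jc[OF that] unfolding J_def by (metis (no_types, lifting) mem_Collect_eq one_closed r_one)
    then show ?thesis using a by (simp add: I_def)
  qed
  ultimately show ?thesis by blast
qed

lemma (in ring) prime_right_noetherian_quot:
  assumes "right_noetherian R" and P: "prime_ideal P R"
  shows "prime_right_noetherian (R Quot P)"
proof (intro prime_right_noetherian.intro prime_right_noetherian_axioms.intro)
  interpret P: ideal P R using P by (simp add: prime_ideal_def)
  show "ring (R Quot P)" by (rule P.quotient_is_ring)
  show "right_noetherian (R Quot P)" using P.right_noetherian_quot assms(1) .
  fix X Y
  assume X: "X \<in> carrier (R Quot P)" and Y: "Y \<in> carrier (R Quot P)"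
    and XY: "\<And>Z. Z \<in> carrier (R Quot P) \<Longrightarrow> X \<otimes>\<^bsub>R Quot P\<^esub> Z \<otimes>\<^bsub>R Quot P\<^esub> Y = \<zero>\<^bsub>R Quot P\<^esub>"
  obtain a where a: "a \<in> carrier R" "X = P +> a" using X by (rule P.quot_carrier_cases)
  obtain b where b: "b \<in> carrier R" "Y = P +> b" using Y by (rule P.quot_carrier_cases)
  have "a \<otimes> x \<otimes> b \<in> P" if x: "x \<in> carrier R" for x
    using XY[OF P.quot_coset_closed[OF x]] a b x
    by (simp add: P.quot_mult P.quot_zero P.coset_eq_self_iff)
  then have "a \<in> P \<or> b \<in> P" using prime_ideal_elements P a b by blast
  then show "X = \<zero>\<^bsub>R Quot P\<^esub> \<or> Y = \<zero>\<^bsub>R Quot P\<^esub>"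
    using a b by (simp add: P.quot_zero P.coset_eq_self_iff)
qed

section \<open>Links from homomorphisms on an intersection of primes\<close>

text \<open>
  The family \<open>\<F>\<close> consists of homomorphisms \<open>(P \<inter> Q)/PQ \<rightarrow> M\<close>, it is closed under the right action
  of \<open>R/P\<close> given by \<open>(fr)(x) = f(rx)\<close>, and it is torsionfree for it.  For a subfamily \<open>\<G>\<close> closed
  under the action, the common kernel \<open>A\<close> is an ideal and \<open>(P \<inter> Q)/A\<close> embeds in a power of \<open>M\<close>,
  so it is torsionfree on the right.

  For faithfulness on the left, choose \<open>\<G> \<noteq> 0\<close> with \<open>A\<close> maximal.  If a nonzero left submodule
  \<open>L/A\<close> were unfaithful over \<open>R/P\<close>, its annihilator would contain a regular element \<open>c\<close> by Goldie's
  theorem.  Then \<open>fc\<close> vanishes on \<open>L\<close> for every \<open>f\<close> in \<open>\<G>\<close>, and \<open>fc \<noteq> 0\<close> when \<open>f \<noteq> 0\<close>.  So the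
  subfamily of all members of \<open>\<G>\<close> that vanish on \<open>L\<close> is again nonzero; by maximality it has the
  same common kernel \<open>A\<close>, whence \<open>L \<subseteq> A\<close>.
\<close>

lemma linked_from_torsionfree_family:
  fixes R (structure) and M (structure)
  assumes M: "right_module R M" and noeth: "right_noetherian R"
    and P: "prime_ideal P R" and Q: "ideal Q R"
    and tf_M: "\<And>x c. \<lbrakk>x \<in> carrier M; c \<in> carrier R; Q +>\<^bsub>R\<^esub> c \<in> regular_elements (R Quot Q);
        x \<bullet>\<^bsub>M\<^esub> c = \<zero>\<^bsub>M\<^esub>\<rbrakk> \<Longrightarrow> x = \<zero>\<^bsub>M\<^esub>"
    and closed: "\<And>f x. \<lbrakk>f \<in> \<F>; x \<in> P \<inter> Q\<rbrakk> \<Longrightarrow> f x \<in> carrier M"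
    and add: "\<And>f x y. \<lbrakk>f \<in> \<F>; x \<in> P \<inter> Q; y \<in> P \<inter> Q\<rbrakk> \<Longrightarrow> f (x \<oplus>\<^bsub>R\<^esub> y) = f x \<oplus>\<^bsub>M\<^esub> f y"
    and scale: "\<And>f x a. \<lbrakk>f \<in> \<F>; x \<in> P \<inter> Q; a \<in> carrier R\<rbrakk> \<Longrightarrow> f (x \<otimes>\<^bsub>R\<^esub> a) = f x \<bullet>\<^bsub>M\<^esub> a"
    and PQ: "\<And>f p q. \<lbrakk>f \<in> \<F>; p \<in> P; q \<in> Q\<rbrakk> \<Longrightarrow> f (p \<otimes>\<^bsub>R\<^esub> q) = \<zero>\<^bsub>M\<^esub>"
    and act: "\<And>f r. \<lbrakk>f \<in> \<F>; r \<in> carrier R\<rbrakk> \<Longrightarrow> \<exists>g\<in>\<F>. \<forall>x\<in>P \<inter> Q. g x = f (r \<otimes>\<^bsub>R\<^esub> x)"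
    and tf: "\<And>f c x. \<lbrakk>f \<in> \<F>; c \<in> carrier R; P +>\<^bsub>R\<^esub> c \<in> regular_elements (R Quot P);
        \<forall>x\<in>P \<inter> Q. f (c \<otimes>\<^bsub>R\<^esub> x) = \<zero>\<^bsub>M\<^esub>; x \<in> P \<inter> Q\<rbrakk> \<Longrightarrow> f x = \<zero>\<^bsub>M\<^esub>"
    and nonzero: "f0 \<in> \<F>" "x0 \<in> P \<inter> Q" "f0 x0 \<noteq> \<zero>\<^bsub>M\<^esub>"
  shows "linked R P Q"
proof -
  interpret R: ring R using M by (rule right_module.axioms(1))
  interpret M: right_module R M by fact
  interpret P: ideal P R using P by (simp add: prime_ideal_def)
  interpret Q: ideal Q R by (rule Q)
  interpret S: prime_right_noetherian "R Quot P"
    using R.prime_right_noetherian_quot noeth P .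
  have c: "x \<in> P \<Longrightarrow> x \<in> carrier R" "x \<in> Q \<Longrightarrow> x \<in> carrier R" for x
    using P.a_subset Q.a_subset by auto
  define acted where "acted \<G> \<longleftrightarrow> \<G> \<subseteq> \<F> \<and>
    (\<forall>f\<in>\<G>. \<forall>r\<in>carrier R. \<exists>g\<in>\<G>. \<forall>x\<in>P \<inter> Q. g x = f (r \<otimes>\<^bsub>R\<^esub> x)) \<and>
    (\<exists>f\<in>\<G>. \<exists>x\<in>P \<inter> Q. f x \<noteq> \<zero>\<^bsub>M\<^esub>)" for \<G>
  define ker where "ker \<G> = {x \<in> P \<inter> Q. \<forall>f\<in>\<G>. f x = \<zero>\<^bsub>M\<^esub>}" for \<G>
  have ker_right_ideal: "right_ideal (ker \<G>) R" if "acted \<G>" for \<G>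
  proof -
    have sub: "\<G> \<subseteq> \<F>" using that by (simp add: acted_def)
    have kerI: "x \<in> ker \<G>" if "x \<in> P" "x \<in> Q" "\<And>f. f \<in> \<G> \<Longrightarrow> f x = \<zero>\<^bsub>M\<^esub>" for x
      using that by (simp add: ker_def)
    have kerD: "x \<in> P" "x \<in> Q" if "x \<in> ker \<G>" for x
      using that by (auto simp: ker_def)
    have kerD': "f x = \<zero>\<^bsub>M\<^esub>" if "x \<in> ker \<G>" "f \<in> \<G>" for x f
      using that by (auto simp: ker_def)
    show ?thesis unfolding R.right_ideal_iff
    proof (intro conjI ballI subsetI)
      fix x assume "x \<in> ker \<G>"
      then show "x \<in> carrier R" using kerD c by blast
    next
      show "\<zero>\<^bsub>R\<^esub> \<in> ker \<G>"
        using PQ[of _ "\<zero>\<^bsub>R\<^esub>" "\<zero>\<^bsub>R\<^esub>"] sub by (intro kerI) auto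
    next
      fix x y assume xy: "x \<in> ker \<G>" "y \<in> ker \<G>"
      show "x \<oplus>\<^bsub>R\<^esub> y \<in> ker \<G>"
      proof (rule kerI)
        fix f assume f: "f \<in> \<G>"
        then have "f \<in> \<F>" using sub by blast
        then show "f (x \<oplus>\<^bsub>R\<^esub> y) = \<zero>\<^bsub>M\<^esub>"
          using add[of f x y] kerD[OF xy(1)] kerD[OF xy(2)] kerD'[OF xy(1) f] kerD'[OF xy(2) f]
          by simp
      qed (use kerD[OF xy(1)] kerD[OF xy(2)] in simp_all)
    next
      fix x a assume xa: "x \<in> ker \<G>" "a \<in> carrier R"
      show "x \<otimes>\<^bsub>R\<^esub> a \<in> ker \<G>"
      proof (rule kerI)
        fix f assume f: "f \<in> \<G>"
        then have "f \<in> \<F>" using sub by blast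
        then show "f (x \<otimes>\<^bsub>R\<^esub> a) = \<zero>\<^bsub>M\<^esub>"
          using scale[of f x a] xa(2) kerD[OF xa(1)] kerD'[OF xa(1) f] M.rsmult_zero_left
          by simp
      qed (use kerD[OF xa(1)] xa(2) P.I_r_closed Q.I_r_closed in simp_all)
    qed
  qed
  have "acted \<F>" using act nonzero by (auto simp: acted_def)
  then have "ker \<F> \<in> ker ` Collect acted" by blast
  then obtain A where "A \<in> ker ` Collect acted"
    and max': "\<And>B. \<lbrakk>B \<in> ker ` Collect acted; A \<subseteq> B\<rbrakk> \<Longrightarrow> B = A"
    using R.right_noetherian_maximal[OF noeth, of "ker \<F>" "ker ` Collect acted"] ker_right_ideal
    by blast
  then obtain \<G> where \<G>: "acted \<G>" and A: "A = ker \<G>" by blast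
  have max: "ker \<G>' = A" if "acted \<G>'" "A \<subseteq> ker \<G>'" for \<G>'
    using that max' by blast
  have \<G>\<F>: "\<And>f. f \<in> \<G> \<Longrightarrow> f \<in> \<F>" using \<G> by (auto simp: acted_def)
  have A_right: "right_ideal A R" using ker_right_ideal[OF \<G>] A by simp
  have A_left: "r \<otimes>\<^bsub>R\<^esub> x \<in> A" if x: "x \<in> A" and r: "r \<in> carrier R" for x r
  proof -
    have "f (r \<otimes>\<^bsub>R\<^esub> x) = \<zero>\<^bsub>M\<^esub>" if "f \<in> \<G>" for f
    proof -
      obtain g where "g \<in> \<G>" "\<forall>x\<in>P \<inter> Q. g x = f (r \<otimes>\<^bsub>R\<^esub> x)"
        using \<G> \<open>f \<in> \<G>\<close> r unfolding acted_def by blast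
      then show ?thesis using x by (auto simp: A ker_def)
    qed
    then show ?thesis using x r by (auto simp: A ker_def P.I_l_closed Q.I_l_closed)
  qed
  have A_ideal: "ideal A R"
    using A_right A_left by (intro R.ideal_by_closure) (auto simp: R.right_ideal_iff)
  interpret A: ideal A R by (rule A_ideal)
  have A_PQ: "A \<subseteq> P \<inter> Q" by (auto simp: A ker_def)
  have A_neq: "A \<noteq> P \<inter> Q" using \<G> by (auto simp: A ker_def acted_def)
  have prodA: "p \<otimes>\<^bsub>R\<^esub> q \<in> A" if "p \<in> P" "q \<in> Q" for p q
    using that PQ \<G>\<F> c by (auto simp: A ker_def P.I_r_closed Q.I_l_closed)
  have "ideal_prod R P Q \<subseteq> A"
  proof
    fix x assume "x \<in> ideal_prod R P Q"
    then show "x \<in> A" by induction (auto intro: prodA)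
  qed
  moreover have "fully_faithful (R Quot P) (left_factor R (P \<inter> Q) A)"
    unfolding fully_faithful_def
  proof (intro allI impI ballI, rule ccontr)
    fix H s
    assume H: "submodule H (R Quot P) (left_factor R (P \<inter> Q) A) \<and>
        H \<noteq> {\<zero>\<^bsub>left_factor R (P \<inter> Q) A\<^esub>}"
      and s: "s \<in> carrier (R Quot P)"
      and sH: "\<forall>X\<in>H. s \<odot>\<^bsub>left_factor R (P \<inter> Q) A\<^esub> X = \<zero>\<^bsub>left_factor R (P \<inter> Q) A\<^esub>"
      and s_nz: "s \<noteq> \<zero>\<^bsub>R Quot P\<^esub>"
    interpret H: submodule H "R Quot P" "left_factor R (P \<inter> Q) A" using H by blast
    obtain t where t: "t \<in> carrier R" "s = P +>\<^bsub>R\<^esub> t" using s by (rule P.quot_carrier_cases)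
    have left: "rcoset_mult R A (P +>\<^bsub>R\<^esub> r) (A +>\<^bsub>R\<^esub> x) = A +>\<^bsub>R\<^esub> (r \<otimes>\<^bsub>R\<^esub> x)"
      if r: "r \<in> carrier R" and x: "x \<in> P \<inter> Q" for r x
    proof -
      have "A +>\<^bsub>R\<^esub> (a \<otimes>\<^bsub>R\<^esub> b) = A +>\<^bsub>R\<^esub> (r \<otimes>\<^bsub>R\<^esub> x)"
        if a: "a \<in> P +>\<^bsub>R\<^esub> r" and b: "b \<in> A +>\<^bsub>R\<^esub> x" for a b
      proof -
        obtain p where p: "p \<in> P" "a = p \<oplus>\<^bsub>R\<^esub> r" using a by (auto simp: a_r_coset_def')
        obtain y where y: "y \<in> A" "b = y \<oplus>\<^bsub>R\<^esub> x" using b by (auto simp: a_r_coset_def')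
        have cc: "p \<in> carrier R" "y \<in> carrier R" "x \<in> carrier R" "y \<in> Q"
          using p y x c A_PQ by auto
        have "a \<otimes>\<^bsub>R\<^esub> b = (p \<otimes>\<^bsub>R\<^esub> y \<oplus>\<^bsub>R\<^esub> p \<otimes>\<^bsub>R\<^esub> x \<oplus>\<^bsub>R\<^esub> r \<otimes>\<^bsub>R\<^esub> y) \<oplus>\<^bsub>R\<^esub> r \<otimes>\<^bsub>R\<^esub> x"
          using cc r by (simp add: p y R.l_distr R.r_distr R.a_ac)
        moreover have "p \<otimes>\<^bsub>R\<^esub> y \<oplus>\<^bsub>R\<^esub> p \<otimes>\<^bsub>R\<^esub> x \<oplus>\<^bsub>R\<^esub> r \<otimes>\<^bsub>R\<^esub> y \<in> A"
          using prodA p y x r A_left cc by auto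
        ultimately have "a \<otimes>\<^bsub>R\<^esub> b \<in> A +>\<^bsub>R\<^esub> (r \<otimes>\<^bsub>R\<^esub> x)"
          by (auto simp: a_r_coset_def')
        then show ?thesis using A.a_repr_independence' r cc by simp
      qed
      moreover have "r \<in> P +>\<^bsub>R\<^esub> r" "x \<in> A +>\<^bsub>R\<^esub> x"
        using r x c P.a_rcos_self A.a_rcos_self by auto
      ultimately show ?thesis unfolding rcoset_mult_def by blast
    qed
    define L where "L = {x \<in> P \<inter> Q. A +>\<^bsub>R\<^esub> x \<in> H}"
    have L_left: "r \<otimes>\<^bsub>R\<^esub> x \<in> L" if "r \<in> carrier R" "x \<in> L" for r x
      using H.smult_closed[OF P.quot_coset_closed, of r "A +>\<^bsub>R\<^esub> x"] that left[of r x]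
      by (auto simp: L_def left_factor_def P.I_l_closed Q.I_l_closed)
    have Lc: "x \<in> L \<Longrightarrow> x \<in> carrier R" for x using c by (auto simp: L_def)
    define I where "I = {r \<in> carrier R. \<forall>x\<in>L. r \<otimes>\<^bsub>R\<^esub> x \<in> A}"
    have I_r: "r \<otimes>\<^bsub>R\<^esub> a \<in> I" if "r \<in> I" "a \<in> carrier R" for r a
      using that L_left Lc by (auto simp: I_def R.m_assoc)
    have I: "ideal I R"
      using Lc A_left I_r
      by (intro R.ideal_by_closure) (auto simp: I_def R.l_distr R.m_assoc)
    have tI: "t \<in> I"
    proof -
      have "t \<otimes>\<^bsub>R\<^esub> x \<in> A" if "x \<in> L" for x
      proof -
        have "A +>\<^bsub>R\<^esub> (t \<otimes>\<^bsub>R\<^esub> x) = A"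
          using sH that left[OF t(1), of x] t by (auto simp: L_def left_factor_def)
        then show ?thesis using A.coset_eq_self_iff t Lc[OF that] by simp
      qed
      then show ?thesis using t by (simp add: I_def)
    qed
    have "ideal ((+>\<^bsub>R\<^esub>) P ` I) (R Quot P)"
      using R.ring_ideal_imp_quot_ideal[OF P.is_ideal I] .
    moreover have "(+>\<^bsub>R\<^esub>) P ` I \<noteq> {\<zero>\<^bsub>R Quot P\<^esub>}" using tI t s_nz by blast
    ultimately obtain a where a: "a \<in> I" "P +>\<^bsub>R\<^esub> a \<in> regular_elements (R Quot P)"
      using S.nonzero_ideal_has_regular_element by blast
    have ac: "a \<in> carrier R" using a by (simp add: I_def)
    define \<G>' where "\<G>' = {f \<in> \<G>. \<forall>x\<in>L. f x = \<zero>\<^bsub>M\<^esub>}"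
    have act': "\<exists>g\<in>\<G>'. \<forall>x\<in>P \<inter> Q. g x = f (r \<otimes>\<^bsub>R\<^esub> x)"
      if f: "f \<in> \<G>" and r: "r \<in> carrier R" and fr: "\<forall>x\<in>L. f (r \<otimes>\<^bsub>R\<^esub> x) = \<zero>\<^bsub>M\<^esub>" for f r
    proof -
      obtain g where "g \<in> \<G>" "\<forall>x\<in>P \<inter> Q. g x = f (r \<otimes>\<^bsub>R\<^esub> x)"
        using \<G> f r unfolding acted_def by blast
      then show ?thesis using fr by (intro bexI[of _ g]) (auto simp: \<G>'_def L_def)
    qed
    have "acted \<G>'" unfolding acted_def
    proof (intro conjI ballI)
      show "\<G>' \<subseteq> \<F>" using \<G>\<F> by (auto simp: \<G>'_def)
    next
      fix f r assume "f \<in> \<G>'" "r \<in> carrier R"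
      then show "\<exists>g\<in>\<G>'. \<forall>x\<in>P \<inter> Q. g x = f (r \<otimes>\<^bsub>R\<^esub> x)"
        using L_left by (intro act') (auto simp: \<G>'_def)
    next
      obtain f x where f: "f \<in> \<G>" "x \<in> P \<inter> Q" "f x \<noteq> \<zero>\<^bsub>M\<^esub>"
        using \<G> unfolding acted_def by blast
      obtain y where y: "y \<in> P \<inter> Q" "f (a \<otimes>\<^bsub>R\<^esub> y) \<noteq> \<zero>\<^bsub>M\<^esub>"
        using tf[OF \<G>\<F>[OF f(1)] ac a(2)] f by blast
      have "\<forall>x\<in>L. f (a \<otimes>\<^bsub>R\<^esub> x) = \<zero>\<^bsub>M\<^esub>"
        using a(1) f(1) by (auto simp: I_def A ker_def)
      then obtain g where "g \<in> \<G>'" "\<forall>x\<in>P \<inter> Q. g x = f (a \<otimes>\<^bsub>R\<^esub> x)"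
        using act' f(1) ac by blast
      then show "\<exists>f\<in>\<G>'. \<exists>x\<in>P \<inter> Q. f x \<noteq> \<zero>\<^bsub>M\<^esub>" using y by (metis)
    qed
    moreover have "A \<subseteq> ker \<G>'" by (auto simp: A ker_def \<G>'_def)
    ultimately have "ker \<G>' = A" by (rule max)
    moreover have "L \<subseteq> ker \<G>'" by (auto simp: L_def ker_def \<G>'_def)
    ultimately have LA: "L \<subseteq> A" by simp
    have "X = A" if X: "X \<in> H" for X
    proof -
      obtain x where x: "x \<in> P \<inter> Q" "X = A +>\<^bsub>R\<^esub> x"
        using subsetD[OF H.subset X] by (auto simp: left_factor_def)
      then have "x \<in> A" using LA X by (auto simp: L_def)
      then show ?thesis using x A.a_rcos_const by simp
    qed
    moreover have "A \<in> H" using H.one_closed by (simp add: left_factor_def)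
    ultimately have "H = {A}" by blast
    then show False using H by (simp add: left_factor_def)
  qed
  moreover have "torsionfree (R Quot Q) (right_factor R (P \<inter> Q) A)"
    unfolding torsionfree_def
  proof (intro ballI impI)
    fix X s
    assume "X \<in> carrier (right_factor R (P \<inter> Q) A)" and s: "s \<in> regular_elements (R Quot Q)"
      and Xs: "X \<bullet>\<^bsub>right_factor R (P \<inter> Q) A\<^esub> s = \<zero>\<^bsub>right_factor R (P \<inter> Q) A\<^esub>"
    then obtain x where x: "x \<in> P \<inter> Q" "X = A +>\<^bsub>R\<^esub> x" by (auto simp: right_factor_def)
    have "s \<in> carrier (R Quot Q)" using s by (simp add: regular_elements_def)
    then obtain t where t: "t \<in> carrier R" "s = Q +>\<^bsub>R\<^esub> t" by (rule Q.quot_carrier_cases)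
    have "x \<in> X" "t \<in> s" using x t c A.a_rcos_self Q.a_rcos_self by auto
    then have "A +>\<^bsub>R\<^esub> (x \<otimes>\<^bsub>R\<^esub> t) \<subseteq> A"
      using Xs by (auto simp: right_factor_def rcoset_mult_def)
    then have "x \<otimes>\<^bsub>R\<^esub> t \<in> A" using A.a_rcos_self[of "x \<otimes>\<^bsub>R\<^esub> t"] x t c by auto
    then have "f x \<bullet>\<^bsub>M\<^esub> t = \<zero>\<^bsub>M\<^esub>" if "f \<in> \<G>" for f
      using that scale[OF \<G>\<F>[OF that] x(1) t(1)] by (simp add: A ker_def)
    then have "f x = \<zero>\<^bsub>M\<^esub>" if "f \<in> \<G>" for f
      using that tf_M[of "f x" t] closed \<G>\<F> x t s by simp
    then have "x \<in> A" using x by (simp add: A ker_def)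
    then show "X = \<zero>\<^bsub>right_factor R (P \<inter> Q) A\<^esub>"
      using x A.a_rcos_const by (simp add: right_factor_def)
  qed
  ultimately show ?thesis
    unfolding linked_def using A_ideal A_PQ A_neq by blast
qed

section \<open>Modules annihilated by a prime ideal\<close>

context right_module
begin

lemma right_submoduleD:
  assumes "right_submodule H R M"
  shows "H \<subseteq> carrier M" "\<zero>\<^bsub>M\<^esub> \<in> H" "\<And>x y. \<lbrakk>x \<in> H; y \<in> H\<rbrakk> \<Longrightarrow> x \<oplus>\<^bsub>M\<^esub> y \<in> H"
    "\<And>x. x \<in> H \<Longrightarrow> \<ominus>\<^bsub>M\<^esub> x \<in> H" "\<And>x a. \<lbrakk>x \<in> H; a \<in> carrier R\<rbrakk> \<Longrightarrow> x \<bullet>\<^bsub>M\<^esub> a \<in> H"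
proof -
  interpret H: additive_subgroup H M using assms by (simp add: right_submodule_def)
  show "H \<subseteq> carrier M" "\<zero>\<^bsub>M\<^esub> \<in> H" "\<And>x y. \<lbrakk>x \<in> H; y \<in> H\<rbrakk> \<Longrightarrow> x \<oplus>\<^bsub>M\<^esub> y \<in> H"
    using H.a_subset by auto
  show sm: "\<And>x a. \<lbrakk>x \<in> H; a \<in> carrier R\<rbrakk> \<Longrightarrow> x \<bullet>\<^bsub>M\<^esub> a \<in> H"
    using assms by (simp add: right_submodule_def)
  show "\<And>x. x \<in> H \<Longrightarrow> \<ominus>\<^bsub>M\<^esub> x \<in> H"
    using sm H.a_subset by (simp add: minus_eq_rsmult subset_iff)
qed

lemma right_module_of_submodule:
  assumes "right_submodule H R M"
  shows "right_module R (M\<lparr>carrier := H\<rparr>)"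
proof -
  note H = right_submoduleD[OF assms]
  have "abelian_group (M\<lparr>carrier := H\<rparr>)"
  proof (rule abelian_groupI)
    fix x assume "x \<in> carrier (M\<lparr>carrier := H\<rparr>)"
    then show "\<exists>y\<in>carrier (M\<lparr>carrier := H\<rparr>).
        y \<oplus>\<^bsub>M\<lparr>carrier := H\<rparr>\<^esub> x = \<zero>\<^bsub>M\<lparr>carrier := H\<rparr>\<^esub>"
      using H by (intro bexI[of _ "\<ominus>\<^bsub>M\<^esub> x"]) (auto simp: M.l_neg)
  qed (use H in \<open>auto simp: M.a_ac subset_iff\<close>)
  then show ?thesis
    using H by (intro right_module.intro right_module_axioms.intro R.ring_axioms)
      (auto simp: subset_iff rsmult_l_distr rsmult_r_distr rsmult_assoc rsmult_one)
qed

lemma annihilator_in_submodule: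
  assumes "ideal I R"
  shows "right_submodule (annihilator_in M I) R M"
proof -
  interpret I: ideal I R by fact
  have c: "a \<in> carrier R" if "a \<in> I" for a using that I.a_subset by blast
  show ?thesis
  proof (rule right_submoduleI)
    fix x a assume xa: "x \<in> annihilator_in M I" "a \<in> carrier R"
    have "(x \<bullet>\<^bsub>M\<^esub> a) \<bullet>\<^bsub>M\<^esub> b = x \<bullet>\<^bsub>M\<^esub> (a \<otimes>\<^bsub>R\<^esub> b)" if "b \<in> I" for b
      using xa that c by (simp add: annihilator_in_def rsmult_assoc)
    then show "x \<bullet>\<^bsub>M\<^esub> a \<in> annihilator_in M I"
      using xa I.I_l_closed by (simp add: annihilator_in_def rsmult_closed)
  qed (auto simp: annihilator_in_def rsmult_zero_left rsmult_l_distr c)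
qed

lemma rsmult_eq_of_coset_eq:
  assumes "ideal I R" "x \<in> annihilator_in M I" "a \<in> carrier R" "b \<in> carrier R" "I +>\<^bsub>R\<^esub> a = I +>\<^bsub>R\<^esub> b"
  shows "x \<bullet>\<^bsub>M\<^esub> a = x \<bullet>\<^bsub>M\<^esub> b"
proof -
  interpret I: ideal I R by fact
  have "a \<in> I +>\<^bsub>R\<^esub> b" using I.a_rcos_self assms(3,5) by blast
  then obtain q where q: "q \<in> I" "a = q \<oplus>\<^bsub>R\<^esub> b" by (auto simp: a_r_coset_def')
  then show ?thesis
    using assms(2,4) I.a_Hcarr[OF q(1)] by (simp add: annihilator_in_def rsmult_r_distr rsmult_closed)
qed

end

text \<open>
  Suppose \<open>0 \<noteq> x \<in> ann\<^sub>E(Q)\<close> and \<open>xc = 0\<close> with \<open>c\<close> regular modulo \<open>Q\<close>.  By essentiality some nonzero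
  \<open>xr\<close> is an element \<open>u\<close> of the uniform right ideal of \<open>R/Q\<close>.  The right ideal of all \<open>s\<close> with
  \<open>rs \<in> cR + Q\<close> is essential modulo \<open>Q\<close> because \<open>cR\<close> is, and it annihilates \<open>u\<close>; so \<open>u\<close> lies in
  the singular ideal of \<open>R/Q\<close>, which is zero.
\<close>

lemma tame_injective_annihilator_torsionfree:
  fixes R (structure) and E (structure)
  assumes "right_noetherian R" and Q: "prime_ideal Q R" and tame: "tame_injective R Q E"
    and x: "x \<in> annihilator_in E Q" and c: "c \<in> carrier R"
    and reg: "Q +>\<^bsub>R\<^esub> c \<in> regular_elements (R Quot Q)" and xc: "x \<bullet>\<^bsub>E\<^esub> c = \<zero>\<^bsub>E\<^esub>"
  shows "x = \<zero>\<^bsub>E\<^esub>"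
proof (rule ccontr)
  assume xnz: "x \<noteq> \<zero>\<^bsub>E\<^esub>"
  let ?S = "R Quot Q"
  obtain U i where U: "right_ideal U ?S" and E: "right_module R E"
    and i: "i \<in> right_module_hom R ((quotient_right_module R Q)\<lparr>carrier := U\<rparr>) E"
    and inj: "inj_on i U" and ess: "essential R E (i ` U)"
    using tame by (auto simp: tame_injective_def injective_hull_def injective_def)
  interpret R: ring R using E by (rule right_module.axioms(1))
  interpret E: right_module R E by (rule E)
  interpret Q: ideal Q R using Q by (simp add: prime_ideal_def)
  interpret S: prime_right_noetherian ?S
    using R.prime_right_noetherian_quot assms(1) Q .
  have Usub: "U \<subseteq> carrier ?S" and U0: "Q \<in> U"
    and Umult: "\<And>u s. \<lbrakk>u \<in> U; s \<in> carrier ?S\<rbrakk> \<Longrightarrow> u \<otimes>\<^bsub>?S\<^esub> s \<in> U"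
    using U by (auto simp: S.right_ideal_iff Q.quot_zero)
  have i_scale: "i (u \<otimes>\<^bsub>?S\<^esub> (Q +>\<^bsub>R\<^esub> s)) = i u \<bullet>\<^bsub>E\<^esub> s" if "u \<in> U" "s \<in> carrier R" for u s
    using i that by (auto simp: right_module_hom_def quotient_right_module_def)
  have i_closed: "i u \<in> carrier E" if "u \<in> U" for u
    using i that by (auto simp: right_module_hom_def)
  have Q0: "Q +>\<^bsub>R\<^esub> \<zero>\<^bsub>R\<^esub> = \<zero>\<^bsub>?S\<^esub>"
    using Q.coset_eq_self_iff[of "\<zero>\<^bsub>R\<^esub>"] by (simp add: Q.quot_zero)
  have U0': "\<zero>\<^bsub>?S\<^esub> \<in> U" using U0 by (simp only: Q.quot_zero)
  have "i (\<zero>\<^bsub>?S\<^esub> \<otimes>\<^bsub>?S\<^esub> \<zero>\<^bsub>?S\<^esub>) = i \<zero>\<^bsub>?S\<^esub> \<bullet>\<^bsub>E\<^esub> \<zero>\<^bsub>R\<^esub>"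
    using i_scale[OF U0' R.zero_closed] by (simp only: Q0)
  then have i0: "i \<zero>\<^bsub>?S\<^esub> = \<zero>\<^bsub>E\<^esub>"
    using E.rsmult_zero_right[OF i_closed[OF U0']] by simp
  have xE: "x \<in> carrier E" using x by (simp add: annihilator_in_def)
  define X where "X = (\<lambda>r. x \<bullet>\<^bsub>E\<^esub> r) ` carrier R"
  have "right_submodule X R E"
  proof (rule E.right_submoduleI)
    show "\<zero>\<^bsub>E\<^esub> \<in> X"
      using E.rsmult_zero_right[OF xE] R.zero_closed unfolding X_def by (metis image_eqI)
  next
    fix y a assume "y \<in> X" "a \<in> carrier R"
    then show "y \<bullet>\<^bsub>E\<^esub> a \<in> X"
      using xE unfolding X_def by (auto simp: E.rsmult_assoc[symmetric])
  qed (use xE in \<open>auto simp: X_def E.rsmult_closed E.rsmult_r_distr[symmetric]\<close>)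
  moreover have "x \<in> X"
    using E.rsmult_one[OF xE] R.one_closed unfolding X_def by (metis image_eqI)
  ultimately have "X \<inter> i ` U \<noteq> {\<zero>\<^bsub>E\<^esub>}" "\<zero>\<^bsub>E\<^esub> \<in> X"
    using ess xnz E.right_submoduleD(2) unfolding essential_def by blast+
  moreover have "\<zero>\<^bsub>E\<^esub> \<in> i ` U" using i0 U0' by (metis image_eqI)
  ultimately obtain y where y: "y \<in> X" "y \<in> i ` U" "y \<noteq> \<zero>\<^bsub>E\<^esub>" by blast
  obtain r where r: "r \<in> carrier R" and yr: "y = x \<bullet>\<^bsub>E\<^esub> r"
    using y(1) unfolding X_def by (rule imageE)
  obtain u' where "u' \<in> U" "y = i u'" using y(2) by (rule imageE)
  then obtain u where u: "u \<in> U" "i u = x \<bullet>\<^bsub>E\<^esub> r" "i u \<noteq> \<zero>\<^bsub>E\<^esub>" using y(3) yr by metis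
  have uS: "u \<in> carrier ?S" using u Usub by blast
  have kills: "u \<otimes>\<^bsub>?S\<^esub> k = \<zero>\<^bsub>?S\<^esub>"
    if k: "k \<in> carrier ?S" and t: "t \<in> carrier ?S"
      and eq: "(Q +>\<^bsub>R\<^esub> r) \<otimes>\<^bsub>?S\<^esub> k = (Q +>\<^bsub>R\<^esub> c) \<otimes>\<^bsub>?S\<^esub> t" for k t
  proof -
    obtain s where s: "s \<in> carrier R" "k = Q +>\<^bsub>R\<^esub> s" using k by (rule Q.quot_carrier_cases)
    obtain w where w: "w \<in> carrier R" "t = Q +>\<^bsub>R\<^esub> w" using t by (rule Q.quot_carrier_cases)
    have "i (u \<otimes>\<^bsub>?S\<^esub> k) = x \<bullet>\<^bsub>E\<^esub> (r \<otimes>\<^bsub>R\<^esub> s)"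
      using i_scale u s r xE by (simp add: E.rsmult_assoc)
    also have "\<dots> = x \<bullet>\<^bsub>E\<^esub> (c \<otimes>\<^bsub>R\<^esub> w)"
      using eq s w r c
      by (intro E.rsmult_eq_of_coset_eq[OF Q.is_ideal x]) (simp_all add: Q.quot_mult)
    also have "\<dots> = \<zero>\<^bsub>E\<^esub>"
      using xE c w xc by (simp add: E.rsmult_assoc E.rsmult_zero_left)
    finally have "i (u \<otimes>\<^bsub>?S\<^esub> k) = i \<zero>\<^bsub>?S\<^esub>" using i0 by simp
    then show ?thesis
      using inj Umult[OF u(1) k] U0' by (simp only: inj_on_eq_iff)
  qed
  have cess: "S.essential_right_ideal ((\<otimes>\<^bsub>?S\<^esub>) (Q +>\<^bsub>R\<^esub> c) ` carrier ?S)"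
    using S.right_cancellable_generates_essential[OF S.noetherian Q.quot_coset_closed[OF c]] reg
    unfolding regular_elements_def by blast
  have "S.essential_right_ideal (S.right_annihilator u)"
    unfolding S.essential_right_ideal_def
  proof (intro allI impI)
    fix K assume K: "right_ideal K ?S \<and> K \<noteq> {\<zero>\<^bsub>?S\<^esub>}"
    then have Kr: "K \<subseteq> carrier ?S" "\<zero>\<^bsub>?S\<^esub> \<in> K" "\<And>x y. \<lbrakk>x \<in> K; y \<in> K\<rbrakk> \<Longrightarrow> x \<oplus>\<^bsub>?S\<^esub> y \<in> K"
      "\<And>x a. \<lbrakk>x \<in> K; a \<in> carrier ?S\<rbrakk> \<Longrightarrow> x \<otimes>\<^bsub>?S\<^esub> a \<in> K"
      by (auto simp: S.right_ideal_iff)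
    have rS: "Q +>\<^bsub>R\<^esub> r \<in> carrier ?S" and cS: "Q +>\<^bsub>R\<^esub> c \<in> carrier ?S"
      using Q.quot_coset_closed r c by auto
    define rK where "rK = (\<otimes>\<^bsub>?S\<^esub>) (Q +>\<^bsub>R\<^esub> r) ` K"
    have "\<exists>k\<in>K. k \<noteq> \<zero>\<^bsub>?S\<^esub> \<and> (\<exists>t\<in>carrier ?S. (Q +>\<^bsub>R\<^esub> r) \<otimes>\<^bsub>?S\<^esub> k = (Q +>\<^bsub>R\<^esub> c) \<otimes>\<^bsub>?S\<^esub> t)"
    proof (cases "rK = {\<zero>\<^bsub>?S\<^esub>}")
      case True
      obtain k where k: "k \<in> K" "k \<noteq> \<zero>\<^bsub>?S\<^esub>" using K Kr by blast
      then have "(Q +>\<^bsub>R\<^esub> r) \<otimes>\<^bsub>?S\<^esub> k = (Q +>\<^bsub>R\<^esub> c) \<otimes>\<^bsub>?S\<^esub> \<zero>\<^bsub>?S\<^esub>"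
        using True cS unfolding rK_def by auto
      then show ?thesis using k S.zero_closed by blast
    next
      case False
      have "right_ideal rK ?S" unfolding S.right_ideal_iff
      proof (intro conjI ballI)
        show "rK \<subseteq> carrier ?S" using Kr(1) rS by (auto simp: rK_def)
        show "\<zero>\<^bsub>?S\<^esub> \<in> rK" using Kr(2) rS unfolding rK_def by (metis S.r_null image_eqI)
      next
        fix y z assume "y \<in> rK" "z \<in> rK"
        then obtain k k' where k: "k \<in> K" "k' \<in> K"
          "y = (Q +>\<^bsub>R\<^esub> r) \<otimes>\<^bsub>?S\<^esub> k" "z = (Q +>\<^bsub>R\<^esub> r) \<otimes>\<^bsub>?S\<^esub> k'" by (auto simp: rK_def)
        then have "y \<oplus>\<^bsub>?S\<^esub> z = (Q +>\<^bsub>R\<^esub> r) \<otimes>\<^bsub>?S\<^esub> (k \<oplus>\<^bsub>?S\<^esub> k')"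
          using Kr(1) rS by (simp add: S.r_distr subset_iff)
        then show "y \<oplus>\<^bsub>?S\<^esub> z \<in> rK" using Kr(3) k unfolding rK_def by blast
      next
        fix y a assume "y \<in> rK" and a: "a \<in> carrier ?S"
        then obtain k where k: "k \<in> K" "y = (Q +>\<^bsub>R\<^esub> r) \<otimes>\<^bsub>?S\<^esub> k" by (auto simp: rK_def)
        then have "y \<otimes>\<^bsub>?S\<^esub> a = (Q +>\<^bsub>R\<^esub> r) \<otimes>\<^bsub>?S\<^esub> (k \<otimes>\<^bsub>?S\<^esub> a)"
          using Kr(1) rS a by (simp add: S.m_assoc subset_iff)
        then show "y \<otimes>\<^bsub>?S\<^esub> a \<in> rK" using Kr(4) k a unfolding rK_def by blast
      qed
      then obtain y where y: "y \<in> (\<otimes>\<^bsub>?S\<^esub>) (Q +>\<^bsub>R\<^esub> c) ` carrier ?S" "y \<in> rK" "y \<noteq> \<zero>\<^bsub>?S\<^esub>"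
        using cess False unfolding S.essential_right_ideal_def by blast
      then obtain k t where k: "k \<in> K" "t \<in> carrier ?S" "y = (Q +>\<^bsub>R\<^esub> r) \<otimes>\<^bsub>?S\<^esub> k"
        "y = (Q +>\<^bsub>R\<^esub> c) \<otimes>\<^bsub>?S\<^esub> t" unfolding rK_def by blast
      have "k \<noteq> \<zero>\<^bsub>?S\<^esub>" using k(3) y(3) S.r_null[OF rS] by metis
      moreover have "(Q +>\<^bsub>R\<^esub> r) \<otimes>\<^bsub>?S\<^esub> k = (Q +>\<^bsub>R\<^esub> c) \<otimes>\<^bsub>?S\<^esub> t"
        using k(3,4) by (rule trans[OF sym])
      ultimately show ?thesis using k(1,2) by blast
    qed
    then obtain k t where k: "k \<in> K" "k \<noteq> \<zero>\<^bsub>?S\<^esub>" "t \<in> carrier ?S"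
      "(Q +>\<^bsub>R\<^esub> r) \<otimes>\<^bsub>?S\<^esub> k = (Q +>\<^bsub>R\<^esub> c) \<otimes>\<^bsub>?S\<^esub> t" by blast
    have kS: "k \<in> carrier ?S" using k(1) Kr(1) by blast
    have "k \<in> S.right_annihilator u"
      using kS kills[OF kS k(3,4)] by (simp only: S.right_annihilator_def mem_Collect_eq)
    then show "\<exists>x\<in>S.right_annihilator u \<inter> K. x \<noteq> \<zero>\<^bsub>?S\<^esub>" using k(1,2) by blast
  qed
  then have "u = \<zero>\<^bsub>?S\<^esub>" by (rule S.essential_annihilator_imp_zero[OF uS])
  then show False using u(3) i0 by simp
qed

section \<open>Free modules and canonical presentations\<close>

lemma (in ideal) right_module_quotient: "right_module R (quotient_right_module R I)"
proof -
  interpret S: ring "R Quot I" by (rule quotient_is_ring)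
  have "abelian_group (quotient_right_module R I)"
  proof (rule abelian_groupI)
    fix x assume "x \<in> carrier (quotient_right_module R I)"
    then show "\<exists>y\<in>carrier (quotient_right_module R I).
        y \<oplus>\<^bsub>quotient_right_module R I\<^esub> x = \<zero>\<^bsub>quotient_right_module R I\<^esub>"
      by (auto simp: quotient_right_module_def intro!: bexI[of _ "\<ominus>\<^bsub>R Quot I\<^esub> x"] S.l_neg)
  qed (auto simp: quotient_right_module_def S.a_ac)
  then show ?thesis
    using quot_one S.r_one
    by (intro right_module.intro right_module_axioms.intro ring_axioms)
       (auto simp: quotient_right_module_def quot_coset_closed S.l_distr S.r_distr S.m_assoc
          quot_add[symmetric] quot_mult[symmetric])
qed

definition single :: "('a, 'x) ring_scheme \<Rightarrow> 'n \<Rightarrow> 'a \<Rightarrow> 'n \<Rightarrow> 'a" where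
  "single R x a = (\<lambda>y. if y = x then a else \<zero>\<^bsub>R\<^esub>)"

definition presentation_map ::
  "('a, 'x) ring_scheme \<Rightarrow> ('a, 'n, 'y) right_module_scheme \<Rightarrow> ('n \<Rightarrow> 'a) \<Rightarrow> 'n" where
  "presentation_map R N \<phi> = (\<Oplus>\<^bsub>N\<^esub>x\<in>{x. \<phi> x \<noteq> \<zero>\<^bsub>R\<^esub>}. x \<bullet>\<^bsub>N\<^esub> \<phi> x)"

context ring
begin

lemma right_module_free: "right_module R (free_right_module R X)"
proof -
  let ?F = "free_right_module R X"
  have fin_add: "finite {x. \<phi> x \<oplus> \<psi> x \<noteq> \<zero>}"
    if "finite {x. \<phi> x \<noteq> \<zero>}" "finite {x. \<psi> x \<noteq> \<zero>}" for \<phi> \<psi> :: "'c \<Rightarrow> 'a"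
    by (rule finite_subset[OF _ finite_UnI[OF that]]) auto
  have fin_neg: "finite {x. \<ominus> \<phi> x \<noteq> \<zero>}" if "finite {x. \<phi> x \<noteq> \<zero>}" for \<phi> :: "'c \<Rightarrow> 'a"
    by (rule finite_subset[OF _ that]) auto
  have fin_mult: "finite {x. \<phi> x \<otimes> a \<noteq> \<zero>}"
    if "finite {x. \<phi> x \<noteq> \<zero>}" "a \<in> carrier R" for \<phi> :: "'c \<Rightarrow> 'a" and a
    by (rule finite_subset[OF _ that(1)]) (auto simp: that(2))
  have val: "\<phi> x \<in> carrier R" if "\<phi> \<in> carrier ?F" for \<phi> x
    using that by (cases "x \<in> X") (auto simp: free_right_module_def)
  have "abelian_group ?F"
  proof (rule abelian_groupI)
    fix \<phi> assume \<phi>: "\<phi> \<in> carrier ?F"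
    then have "(\<lambda>x. \<ominus> \<phi> x) \<in> carrier ?F" using fin_neg by (simp add: free_right_module_def)
    moreover have "(\<lambda>x. \<ominus> \<phi> x) \<oplus>\<^bsub>?F\<^esub> \<phi> = \<zero>\<^bsub>?F\<^esub>"
      using val[OF \<phi>] by (simp add: free_right_module_def l_neg)
    ultimately show "\<exists>\<psi>\<in>carrier ?F. \<psi> \<oplus>\<^bsub>?F\<^esub> \<phi> = \<zero>\<^bsub>?F\<^esub>" by blast
  next
    fix \<phi> \<psi> \<chi> assume "\<phi> \<in> carrier ?F" "\<psi> \<in> carrier ?F" "\<chi> \<in> carrier ?F"
    then show "(\<phi> \<oplus>\<^bsub>?F\<^esub> \<psi>) \<oplus>\<^bsub>?F\<^esub> \<chi> = \<phi> \<oplus>\<^bsub>?F\<^esub> (\<psi> \<oplus>\<^bsub>?F\<^esub> \<chi>)"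
      using val[of \<phi>] val[of \<psi>] val[of \<chi>] by (simp add: free_right_module_def a_assoc)
  next
    fix \<phi> \<psi> assume "\<phi> \<in> carrier ?F" "\<psi> \<in> carrier ?F"
    then show "\<phi> \<oplus>\<^bsub>?F\<^esub> \<psi> = \<psi> \<oplus>\<^bsub>?F\<^esub> \<phi>"
      using val[of \<phi>] val[of \<psi>] by (simp add: free_right_module_def a_comm)
  next
    fix \<phi> assume "\<phi> \<in> carrier ?F"
    then show "\<zero>\<^bsub>?F\<^esub> \<oplus>\<^bsub>?F\<^esub> \<phi> = \<phi>"
      using val[of \<phi>] by (simp add: free_right_module_def)
  qed (auto simp: free_right_module_def fin_add)
  moreover have "right_module_axioms R ?F"
  proof (rule right_module_axioms.intro)
    fix \<phi> a assume "\<phi> \<in> carrier ?F" "a \<in> carrier R"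
    then show "\<phi> \<bullet>\<^bsub>?F\<^esub> a \<in> carrier ?F" by (simp add: free_right_module_def fin_mult)
  next
    fix \<phi> \<psi> a assume "\<phi> \<in> carrier ?F" "\<psi> \<in> carrier ?F" "a \<in> carrier R"
    then show "(\<phi> \<oplus>\<^bsub>?F\<^esub> \<psi>) \<bullet>\<^bsub>?F\<^esub> a = \<phi> \<bullet>\<^bsub>?F\<^esub> a \<oplus>\<^bsub>?F\<^esub> \<psi> \<bullet>\<^bsub>?F\<^esub> a"
      using val[of \<phi>] val[of \<psi>] by (simp add: free_right_module_def l_distr)
  next
    fix \<phi> a b assume "\<phi> \<in> carrier ?F" "a \<in> carrier R" "b \<in> carrier R"
    then show "\<phi> \<bullet>\<^bsub>?F\<^esub> (a \<oplus> b) = \<phi> \<bullet>\<^bsub>?F\<^esub> a \<oplus>\<^bsub>?F\<^esub> \<phi> \<bullet>\<^bsub>?F\<^esub> b"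
      and "\<phi> \<bullet>\<^bsub>?F\<^esub> (a \<otimes> b) = (\<phi> \<bullet>\<^bsub>?F\<^esub> a) \<bullet>\<^bsub>?F\<^esub> b"
      using val[of \<phi>] by (simp_all add: free_right_module_def r_distr m_assoc)
  next
    fix \<phi> assume "\<phi> \<in> carrier ?F"
    then show "\<phi> \<bullet>\<^bsub>?F\<^esub> \<one> = \<phi>" using val[of \<phi>] by (simp add: free_right_module_def)
  qed
  ultimately show ?thesis using ring_axioms by (intro right_module.intro)
qed

lemma single_closed:
  assumes "x \<in> X" "a \<in> carrier R" shows "single R x a \<in> carrier (free_right_module R X)"
proof -
  have "finite {y. single R x a y \<noteq> \<zero>}"
    by (rule finite_subset[of _ "{x}"]) (auto simp: single_def)
  then show ?thesis using assms by (auto simp: free_right_module_def single_def)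
qed

lemma single_add:
  "\<lbrakk>a \<in> carrier R; b \<in> carrier R\<rbrakk> \<Longrightarrow>
    single R x (a \<oplus> b) = single R x a \<oplus>\<^bsub>free_right_module R X\<^esub> single R x b"
  by (auto simp: free_right_module_def single_def)

lemma single_mult:
  "b \<in> carrier R \<Longrightarrow> single R x (a \<otimes> b) = single R x a \<bullet>\<^bsub>free_right_module R X\<^esub> b"
  by (auto simp: free_right_module_def single_def)

lemma single_zero: "single R x \<zero> = \<zero>\<^bsub>free_right_module R X\<^esub>"
  by (auto simp: free_right_module_def single_def)

lemma free_map_single:
  assumes "a \<in> carrier R" shows "free_map R h (single R x a) = single R (h x) a"
proof (cases "a = \<zero>")
  case False
  have "{z. single R x a z \<noteq> \<zero> \<and> h z = y} = (if y = h x then {x} else {})" for y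
    using False by (auto simp: single_def)
  then show ?thesis using assms by (auto simp: free_map_def single_def)
qed (auto simp: free_map_def single_def)

end

context right_module
begin

abbreviation "presentation \<equiv> presentation_map R M"

lemma finsum_rsmult:
  assumes "finite A" "f \<in> A \<rightarrow> carrier M" "a \<in> carrier R"
  shows "(\<Oplus>\<^bsub>M\<^esub>x\<in>A. f x) \<bullet>\<^bsub>M\<^esub> a = (\<Oplus>\<^bsub>M\<^esub>x\<in>A. f x \<bullet>\<^bsub>M\<^esub> a)"
  using assms
proof (induction A rule: finite_induct)
  case (insert x A)
  then have f: "f \<in> A \<rightarrow> carrier M" "f x \<in> carrier M" by auto
  have fa: "(\<lambda>x. f x \<bullet>\<^bsub>M\<^esub> a) \<in> A \<rightarrow> carrier M"
    using f(1) insert.prems(2) rsmult_closed by auto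
  have "finsum M f (insert x A) = f x \<oplus>\<^bsub>M\<^esub> finsum M f A"
    using insert f by simp
  moreover have "finsum M (\<lambda>x. f x \<bullet>\<^bsub>M\<^esub> a) (insert x A) =
      f x \<bullet>\<^bsub>M\<^esub> a \<oplus>\<^bsub>M\<^esub> finsum M (\<lambda>x. f x \<bullet>\<^bsub>M\<^esub> a) A"
    using insert f fa rsmult_closed by simp
  ultimately show ?case using insert f by (simp add: rsmult_l_distr)
qed (simp add: rsmult_zero_left)

lemma free_support:
  assumes "\<phi> \<in> carrier (free_right_module R (carrier M))"
  shows "finite {x. \<phi> x \<noteq> \<zero>\<^bsub>R\<^esub>}" "{x. \<phi> x \<noteq> \<zero>\<^bsub>R\<^esub>} \<subseteq> carrier M" "\<phi> x \<in> carrier R"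
  using assms by (auto simp: free_right_module_def)

lemma presentation_superset:
  assumes \<phi>: "\<phi> \<in> carrier (free_right_module R (carrier M))"
    and A: "finite A" "{x. \<phi> x \<noteq> \<zero>\<^bsub>R\<^esub>} \<subseteq> A" "A \<subseteq> carrier M"
  shows "presentation \<phi> = (\<Oplus>\<^bsub>M\<^esub>x\<in>A. x \<bullet>\<^bsub>M\<^esub> \<phi> x)"
  unfolding presentation_map_def
  using A free_support[OF \<phi>]
  by (intro M.add.finprod_mono_neutral_cong_left)
     (auto simp: subset_iff rsmult_zero_right intro!: rsmult_closed)

lemma presentation_closed:
  assumes "\<phi> \<in> carrier (free_right_module R (carrier M))"
  shows "presentation \<phi> \<in> carrier M"
  unfolding presentation_map_def
  using free_support[OF assms] by (intro M.finsum_closed) (auto intro!: rsmult_closed)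

lemma presentation_add:
  assumes \<phi>: "\<phi> \<in> carrier (free_right_module R (carrier M))"
    and \<psi>: "\<psi> \<in> carrier (free_right_module R (carrier M))"
  shows "presentation (\<phi> \<oplus>\<^bsub>free_right_module R (carrier M)\<^esub> \<psi>) =
      presentation \<phi> \<oplus>\<^bsub>M\<^esub> presentation \<psi>"
proof -
  interpret F: right_module R "free_right_module R (carrier M)" by (rule right_module_free)
  note s = free_support[OF \<phi>] free_support[OF \<psi>]
  define A where "A = {x. \<phi> x \<noteq> \<zero>\<^bsub>R\<^esub>} \<union> {x. \<psi> x \<noteq> \<zero>\<^bsub>R\<^esub>}"
  have A: "finite A" "A \<subseteq> carrier M" using s by (auto simp: A_def)
  have sum: "\<phi> \<oplus>\<^bsub>free_right_module R (carrier M)\<^esub> \<psi> = (\<lambda>x. \<phi> x \<oplus>\<^bsub>R\<^esub> \<psi> x)"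
    by (simp add: free_right_module_def)
  have "presentation (\<phi> \<oplus>\<^bsub>free_right_module R (carrier M)\<^esub> \<psi>) =
      (\<Oplus>\<^bsub>M\<^esub>x\<in>A. x \<bullet>\<^bsub>M\<^esub> (\<phi> x \<oplus>\<^bsub>R\<^esub> \<psi> x))"
    using A F.M.a_closed[OF \<phi> \<psi>] unfolding sum
    by (intro presentation_superset) (auto simp: A_def)
  also have "\<dots> = (\<Oplus>\<^bsub>M\<^esub>x\<in>A. x \<bullet>\<^bsub>M\<^esub> \<phi> x \<oplus>\<^bsub>M\<^esub> x \<bullet>\<^bsub>M\<^esub> \<psi> x)"
    using A s by (intro M.finsum_cong') (auto simp: rsmult_r_distr rsmult_closed subset_iff)
  also have "\<dots> = (\<Oplus>\<^bsub>M\<^esub>x\<in>A. x \<bullet>\<^bsub>M\<^esub> \<phi> x) \<oplus>\<^bsub>M\<^esub> (\<Oplus>\<^bsub>M\<^esub>x\<in>A. x \<bullet>\<^bsub>M\<^esub> \<psi> x)"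
    using A s by (intro M.finsum_addf) (auto simp: rsmult_closed subset_iff)
  also have "\<dots> = presentation \<phi> \<oplus>\<^bsub>M\<^esub> presentation \<psi>"
    using A presentation_superset[OF \<phi>, of A] presentation_superset[OF \<psi>, of A]
    by (auto simp: A_def)
  finally show ?thesis .
qed

lemma presentation_rsmult:
  assumes \<phi>: "\<phi> \<in> carrier (free_right_module R (carrier M))" and a: "a \<in> carrier R"
  shows "presentation (\<phi> \<bullet>\<^bsub>free_right_module R (carrier M)\<^esub> a) = presentation \<phi> \<bullet>\<^bsub>M\<^esub> a"
proof -
  interpret F: right_module R "free_right_module R (carrier M)" by (rule right_module_free)
  note s = free_support[OF \<phi>]
  have scaled: "\<phi> \<bullet>\<^bsub>free_right_module R (carrier M)\<^esub> a = (\<lambda>x. \<phi> x \<otimes>\<^bsub>R\<^esub> a)"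
    by (simp add: free_right_module_def)
  have "presentation (\<phi> \<bullet>\<^bsub>free_right_module R (carrier M)\<^esub> a) =
      (\<Oplus>\<^bsub>M\<^esub>x\<in>{x. \<phi> x \<noteq> \<zero>\<^bsub>R\<^esub>}. x \<bullet>\<^bsub>M\<^esub> (\<phi> x \<otimes>\<^bsub>R\<^esub> a))"
    using s a F.rsmult_closed[OF \<phi> a] unfolding scaled
    by (intro presentation_superset) auto
  also have "\<dots> = (\<Oplus>\<^bsub>M\<^esub>x\<in>{x. \<phi> x \<noteq> \<zero>\<^bsub>R\<^esub>}. (x \<bullet>\<^bsub>M\<^esub> \<phi> x) \<bullet>\<^bsub>M\<^esub> a)"
    using s a by (intro M.finsum_cong') (auto simp: rsmult_assoc rsmult_closed subset_iff)
  also have "\<dots> = presentation \<phi> \<bullet>\<^bsub>M\<^esub> a"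
    unfolding presentation_map_def
    using s a by (intro finsum_rsmult[symmetric]) (auto simp: rsmult_closed subset_iff)
  finally show ?thesis .
qed

lemma presentation_single:
  assumes "x \<in> carrier M" "a \<in> carrier R"
  shows "presentation (single R x a) = x \<bullet>\<^bsub>M\<^esub> a"
proof -
  have "presentation (single R x a) = (\<Oplus>\<^bsub>M\<^esub>y\<in>{x}. y \<bullet>\<^bsub>M\<^esub> single R x a y)"
    using assms by (intro presentation_superset single_closed) (auto simp: single_def)
  also have "\<dots> = x \<bullet>\<^bsub>M\<^esub> a"
    using assms rsmult_closed by (simp add: single_def)
  finally show ?thesis .
qed

lemma carrier_relation_module:
  "carrier (relation_module R M) =
    {\<phi> \<in> carrier (free_right_module R (carrier M)). presentation \<phi> = \<zero>\<^bsub>M\<^esub>}"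
  by (simp add: relation_module_def presentation_map_def)

lemma relation_module_operations:
  "add (relation_module R M) = add (free_right_module R (carrier M))"
  "zero (relation_module R M) = zero (free_right_module R (carrier M))"
  "rsmult (relation_module R M) = rsmult (free_right_module R (carrier M))"
  by (simp_all add: relation_module_def)

lemma right_module_relation: "right_module R (relation_module R M)"
proof -
  interpret F: right_module R "free_right_module R (carrier M)" by (rule right_module_free)
  have "presentation \<zero>\<^bsub>free_right_module R (carrier M)\<^esub> = \<zero>\<^bsub>M\<^esub>"
    by (simp add: presentation_map_def free_right_module_def)
  then have "right_submodule (carrier (relation_module R M)) R (free_right_module R (carrier M))"
    unfolding carrier_relation_module
    by (intro F.right_submoduleI)
       (auto simp: presentation_add presentation_rsmult rsmult_zero_left F.rsmult_closed)
  from F.right_module_of_submodule[OF this] show ?thesis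
    by (simp add: relation_module_def)
qed

end

section \<open>Homomorphisms of right modules\<close>

lemma right_module_homD:
  assumes "f \<in> right_module_hom R M N"
  shows "f \<in> extensional (carrier M)" "\<And>x. x \<in> carrier M \<Longrightarrow> f x \<in> carrier N"
    "\<And>x y. \<lbrakk>x \<in> carrier M; y \<in> carrier M\<rbrakk> \<Longrightarrow> f (x \<oplus>\<^bsub>M\<^esub> y) = f x \<oplus>\<^bsub>N\<^esub> f y"
    "\<And>x a. \<lbrakk>x \<in> carrier M; a \<in> carrier R\<rbrakk> \<Longrightarrow> f (x \<bullet>\<^bsub>M\<^esub> a) = f x \<bullet>\<^bsub>N\<^esub> a"
  using assms by (auto simp: right_module_hom_def PiE_iff)

lemma right_module_homI:
  assumes "f \<in> extensional (carrier M)" "\<And>x. x \<in> carrier M \<Longrightarrow> f x \<in> carrier N"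
    "\<And>x y. \<lbrakk>x \<in> carrier M; y \<in> carrier M\<rbrakk> \<Longrightarrow> f (x \<oplus>\<^bsub>M\<^esub> y) = f x \<oplus>\<^bsub>N\<^esub> f y"
    "\<And>x a. \<lbrakk>x \<in> carrier M; a \<in> carrier R\<rbrakk> \<Longrightarrow> f (x \<bullet>\<^bsub>M\<^esub> a) = f x \<bullet>\<^bsub>N\<^esub> a"
  shows "f \<in> right_module_hom R M N"
  using assms by (auto simp: right_module_hom_def PiE_iff)

lemma right_module_hom_add:
  assumes M: "right_module R M" and N: "right_module R N"
    and f: "f \<in> right_module_hom R M N" and g: "g \<in> right_module_hom R M N"
  shows "f \<oplus>\<^bsub>hom_group R M N\<^esub> g \<in> right_module_hom R M N"
proof -
  interpret M: right_module R M by (rule M)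
  interpret N: right_module R N by (rule N)
  note f' = right_module_homD[OF f] and g' = right_module_homD[OF g]
  show ?thesis
    using f' g'
    by (intro right_module_homI)
       (auto simp: hom_group_def N.M.a_ac N.rsmult_l_distr M.rsmult_closed)
qed

lemma right_module_hom_minus:
  assumes M: "right_module R M" and N: "right_module R N"
    and f: "f \<in> right_module_hom R M N" and g: "g \<in> right_module_hom R M N"
  shows "(\<lambda>x\<in>carrier M. f x \<ominus>\<^bsub>N\<^esub> g x) \<in> right_module_hom R M N"
proof -
  interpret M: right_module R M by (rule M)
  interpret N: right_module R N by (rule N)
  note f' = right_module_homD[OF f] and g' = right_module_homD[OF g]
  have "\<ominus>\<^bsub>N\<^esub> (y \<bullet>\<^bsub>N\<^esub> a) = (\<ominus>\<^bsub>N\<^esub> y) \<bullet>\<^bsub>N\<^esub> a" if "y \<in> carrier N" "a \<in> carrier R" for y a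
    using that N.M.minus_equality[of "(\<ominus>\<^bsub>N\<^esub> y) \<bullet>\<^bsub>N\<^esub> a" "y \<bullet>\<^bsub>N\<^esub> a"]
    by (simp add: N.rsmult_l_distr[symmetric] N.M.l_neg N.rsmult_zero_left N.rsmult_closed)
  then show ?thesis
    using f' g'
    by (intro right_module_homI)
       (auto simp: a_minus_def N.M.a_ac N.M.minus_add N.rsmult_l_distr N.rsmult_closed M.rsmult_closed)
qed

section \<open>Extensions of a prime factor ring by an annihilator\<close>

text \<open>
  Let \<open>M = ann\<^sub>E(Q)\<close>, \<open>N = R/P\<close>, and let \<open>F\<close> and \<open>K\<close> be the free module on \<open>N\<close> and the kernel of
  \<open>F \<rightarrow> N\<close>.  For \<open>p \<in> P\<close> the multiple \<open>\<epsilon> p\<close> of the basis element \<open>\<epsilon>\<close> of the coset of \<open>1\<close> lies in \<open>K\<close>,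
  which turns a cocycle \<open>K \<rightarrow> M\<close> into a homomorphism \<open>P \<rightarrow> M\<close>.  Only its restriction to
  \<open>P \<inter> Q\<close> is needed, for that restriction depends only on the class in \<open>Ext\<^sup>1\<^sub>R(N, M)\<close> and
  determines it.
\<close>

locale annihilator_ext = R: ring R + P: ideal P R + Q: ideal Q R + E: right_module R E
  for R :: "('a, 'x) ring_scheme" (structure) and P Q and E :: "('a, 'e, 'z) right_module_scheme" (structure) +
  assumes injective: "injective R E"
begin

abbreviation "N \<equiv> quotient_right_module R P"
abbreviation "M \<equiv> E\<lparr>carrier := annihilator_in E Q\<rparr>"
abbreviation "F \<equiv> free_right_module R (carrier N)"
abbreviation "K \<equiv> relation_module R N"
abbreviation "H \<equiv> hom_group R K M"
abbreviation "B \<equiv> (\<lambda>g. restrict g (carrier K)) ` right_module_hom R F M"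
abbreviation "\<epsilon> \<equiv> single R (P +>\<^bsub>R\<^esub> \<one>\<^bsub>R\<^esub>)"

sublocale N: right_module R N by (rule P.right_module_quotient)
sublocale F: right_module R F by (rule R.right_module_free)
sublocale K: right_module R K by (rule N.right_module_relation)
sublocale M: right_module R M
  by (rule E.right_module_of_submodule[OF E.annihilator_in_submodule[OF Q.is_ideal]])

lemma M_annihilated: "\<lbrakk>x \<in> carrier M; q \<in> Q\<rbrakk> \<Longrightarrow> x \<bullet>\<^bsub>E\<^esub> q = \<zero>\<^bsub>E\<^esub>"
  by (simp add: annihilator_in_def)

lemma carrier_N: "carrier N = carrier (R Quot P)"
  by (simp add: quotient_right_module_def)

lemma N_simps:
  "\<zero>\<^bsub>N\<^esub> = P"
  "\<lbrakk>r \<in> carrier R; s \<in> carrier R\<rbrakk> \<Longrightarrow> (P +>\<^bsub>R\<^esub> r) \<oplus>\<^bsub>N\<^esub> (P +>\<^bsub>R\<^esub> s) = P +>\<^bsub>R\<^esub> (r \<oplus>\<^bsub>R\<^esub> s)"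
  "\<lbrakk>r \<in> carrier R; s \<in> carrier R\<rbrakk> \<Longrightarrow> (P +>\<^bsub>R\<^esub> r) \<bullet>\<^bsub>N\<^esub> s = P +>\<^bsub>R\<^esub> (r \<otimes>\<^bsub>R\<^esub> s)"
  by (simp_all add: quotient_right_module_def P.quot_zero P.quot_add P.quot_mult)

lemma coset_in_N: "r \<in> carrier R \<Longrightarrow> P +>\<^bsub>R\<^esub> r \<in> carrier N"
  by (simp add: carrier_N P.quot_coset_closed)

lemma presentation_coset_single:
  "\<lbrakk>r \<in> carrier R; a \<in> carrier R\<rbrakk> \<Longrightarrow> N.presentation (single R (P +>\<^bsub>R\<^esub> r) a) = P +>\<^bsub>R\<^esub> (r \<otimes>\<^bsub>R\<^esub> a)"
  by (simp add: N.presentation_single coset_in_N N_simps)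

lemma single_in_F: "\<lbrakk>r \<in> carrier R; a \<in> carrier R\<rbrakk> \<Longrightarrow> single R (P +>\<^bsub>R\<^esub> r) a \<in> carrier F"
  by (simp add: R.single_closed coset_in_N)

lemma K_iff: "\<phi> \<in> carrier K \<longleftrightarrow> \<phi> \<in> carrier F \<and> N.presentation \<phi> = P"
  by (simp add: N.carrier_relation_module N_simps)

lemma single_in_K: "\<lbrakk>r \<in> carrier R; p \<in> P\<rbrakk> \<Longrightarrow> single R (P +>\<^bsub>R\<^esub> r) p \<in> carrier K"
  using P.a_Hcarr[of p] P.I_l_closed[of p r]
  by (simp add: K_iff single_in_F presentation_coset_single P.a_rcos_const)

text \<open>
  A homomorphism \<open>\<gamma> : P \<rightarrow> M\<close> that vanishes on \<open>P \<inter> Q\<close> extends to \<open>P + Q\<close> by zero on \<open>Q\<close>, and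
  from there to \<open>R \<rightarrow> E\<close>.  The image \<open>m\<close> of \<open>1\<close> is annihilated by \<open>Q\<close>, so it lies in \<open>M\<close>.
\<close>

lemma hom_from_P_is_multiplication:
  assumes closed: "\<And>p. p \<in> P \<Longrightarrow> \<gamma> p \<in> carrier M"
    and add: "\<And>p p'. \<lbrakk>p \<in> P; p' \<in> P\<rbrakk> \<Longrightarrow> \<gamma> (p \<oplus>\<^bsub>R\<^esub> p') = \<gamma> p \<oplus>\<^bsub>E\<^esub> \<gamma> p'"
    and scale: "\<And>p a. \<lbrakk>p \<in> P; a \<in> carrier R\<rbrakk> \<Longrightarrow> \<gamma> (p \<otimes>\<^bsub>R\<^esub> a) = \<gamma> p \<bullet>\<^bsub>E\<^esub> a"
    and vanish: "\<And>x. x \<in> P \<inter> Q \<Longrightarrow> \<gamma> x = \<zero>\<^bsub>E\<^esub>"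
  obtains m where "m \<in> carrier M" "\<And>p. p \<in> P \<Longrightarrow> \<gamma> p = m \<bullet>\<^bsub>E\<^esub> p"
proof -
  have Pc: "p \<in> carrier R" if "p \<in> P" for p using that by simp
  have Qc: "q \<in> carrier R" if "q \<in> Q" for q using that by simp
  have \<gamma>E: "\<gamma> p \<in> carrier E" if "p \<in> P" for p using closed[OF that] by (simp add: annihilator_in_def)
  let ?reg = "regular_right_module R"
  interpret reg: right_module R ?reg by (rule right_module_regular[OF R.ring_axioms])
  define A where "A = {p \<oplus>\<^bsub>R\<^esub> q |p q. p \<in> P \<and> q \<in> Q}"
  \<comment> \<open>The choice of the summand in \<open>P\<close> is immaterial because \<open>\<gamma>\<close> vanishes on \<open>P \<inter> Q\<close>.\<close>
  define f where "f = (\<lambda>y\<in>A. \<gamma> (SOME p. p \<in> P \<and> (\<exists>q\<in>Q. y = p \<oplus>\<^bsub>R\<^esub> q)))"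
  have f: "f (p \<oplus>\<^bsub>R\<^esub> q) = \<gamma> p" if p: "p \<in> P" and q: "q \<in> Q" for p q
  proof -
    define p' where "p' = (SOME p'. p' \<in> P \<and> (\<exists>q'\<in>Q. p \<oplus>\<^bsub>R\<^esub> q = p' \<oplus>\<^bsub>R\<^esub> q'))"
    have "p' \<in> P \<and> (\<exists>q'\<in>Q. p \<oplus>\<^bsub>R\<^esub> q = p' \<oplus>\<^bsub>R\<^esub> q')"
      unfolding p'_def by (rule someI[of _ p]) (use p q in blast)
    then obtain q' where p': "p' \<in> P" and q': "q' \<in> Q" "p \<oplus>\<^bsub>R\<^esub> q = p' \<oplus>\<^bsub>R\<^esub> q'" by blast
    note cc = Pc[OF p] Qc[OF q] Pc[OF p'] Qc[OF q'(1)]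
    have "p \<ominus>\<^bsub>R\<^esub> p' = (p \<oplus>\<^bsub>R\<^esub> q) \<ominus>\<^bsub>R\<^esub> q \<ominus>\<^bsub>R\<^esub> p'"
      using cc by (simp add: a_minus_def R.a_assoc R.r_neg)
    also have "\<dots> = q' \<ominus>\<^bsub>R\<^esub> q"
      using cc unfolding q'(2) R.a_comm[OF cc(3,4)]
      by (simp add: a_minus_def R.a_assoc R.a_comm[of "\<ominus>\<^bsub>R\<^esub> q" "\<ominus>\<^bsub>R\<^esub> p'"] R.r_neg2)
    finally have "p \<ominus>\<^bsub>R\<^esub> p' \<in> P \<inter> Q"
      using p p' q q' by (simp add: a_minus_def) (metis P.a_closed P.a_inv_closed Q.a_closed Q.a_inv_closed)
    moreover have "p = (p \<ominus>\<^bsub>R\<^esub> p') \<oplus>\<^bsub>R\<^esub> p'"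
      using cc by (simp add: a_minus_def R.a_assoc R.l_neg)
    ultimately have "\<gamma> p = \<gamma> p'"
      using add[of "p \<ominus>\<^bsub>R\<^esub> p'" p'] vanish[of "p \<ominus>\<^bsub>R\<^esub> p'"] p' \<gamma>E[OF p'] by simp
    moreover have "p \<oplus>\<^bsub>R\<^esub> q \<in> A" using p q by (auto simp: A_def)
    ultimately show ?thesis by (simp add: f_def p'_def)
  qed
  have A_sub: "right_submodule A R ?reg"
  proof (rule reg.right_submoduleI)
    show "A \<subseteq> carrier ?reg" using Pc Qc by (auto simp: A_def regular_right_module_def)
    have "\<zero>\<^bsub>R\<^esub> = \<zero>\<^bsub>R\<^esub> \<oplus>\<^bsub>R\<^esub> \<zero>\<^bsub>R\<^esub>" by simp
    then have "\<zero>\<^bsub>R\<^esub> \<in> A" unfolding A_def using P.zero_closed Q.zero_closed by blast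
    then show "\<zero>\<^bsub>?reg\<^esub> \<in> A" by (simp add: regular_right_module_def)
  next
    fix x y assume "x \<in> A" "y \<in> A"
    then obtain p q p' q' where 1: "x = p \<oplus>\<^bsub>R\<^esub> q" "y = p' \<oplus>\<^bsub>R\<^esub> q'" "p \<in> P" "p' \<in> P" "q \<in> Q" "q' \<in> Q"
      unfolding A_def by blast
    then have "x \<oplus>\<^bsub>?reg\<^esub> y = (p \<oplus>\<^bsub>R\<^esub> p') \<oplus>\<^bsub>R\<^esub> (q \<oplus>\<^bsub>R\<^esub> q')"
      using Pc Qc by (simp add: regular_right_module_def R.a_ac)
    then show "x \<oplus>\<^bsub>?reg\<^esub> y \<in> A" using 1 unfolding A_def by blast
  next
    fix x a assume a: "a \<in> carrier R" and "x \<in> A"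
    then obtain p q where 1: "x = p \<oplus>\<^bsub>R\<^esub> q" "p \<in> P" "q \<in> Q" unfolding A_def by blast
    then have "x \<bullet>\<^bsub>?reg\<^esub> a = p \<otimes>\<^bsub>R\<^esub> a \<oplus>\<^bsub>R\<^esub> q \<otimes>\<^bsub>R\<^esub> a"
      using Pc Qc a by (simp add: regular_right_module_def R.l_distr)
    then show "x \<bullet>\<^bsub>?reg\<^esub> a \<in> A" using 1 a P.I_r_closed Q.I_r_closed unfolding A_def by blast
  qed
  have f_hom: "f \<in> right_module_hom R (?reg\<lparr>carrier := A\<rparr>) E"
  proof (rule right_module_homI)
    show "f \<in> extensional (carrier (?reg\<lparr>carrier := A\<rparr>))" by (simp add: f_def)
  next
    fix x assume "x \<in> carrier (?reg\<lparr>carrier := A\<rparr>)"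
    then obtain p q where 1: "x = p \<oplus>\<^bsub>R\<^esub> q" "p \<in> P" "q \<in> Q" by (auto simp: A_def)
    then show "f x \<in> carrier E" using f \<gamma>E by simp
  next
    fix x y assume "x \<in> carrier (?reg\<lparr>carrier := A\<rparr>)" "y \<in> carrier (?reg\<lparr>carrier := A\<rparr>)"
    then obtain p q p' q' where 1: "x = p \<oplus>\<^bsub>R\<^esub> q" "y = p' \<oplus>\<^bsub>R\<^esub> q'" "p \<in> P" "p' \<in> P" "q \<in> Q" "q' \<in> Q"
      by (auto simp: A_def)
    then have "x \<oplus>\<^bsub>R\<^esub> y = (p \<oplus>\<^bsub>R\<^esub> p') \<oplus>\<^bsub>R\<^esub> (q \<oplus>\<^bsub>R\<^esub> q')"
      using Pc Qc by (simp add: R.a_ac)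
    then have "f (x \<oplus>\<^bsub>R\<^esub> y) = f x \<oplus>\<^bsub>E\<^esub> f y" using f 1 add by simp
    then show "f (x \<oplus>\<^bsub>?reg\<lparr>carrier := A\<rparr>\<^esub> y) = f x \<oplus>\<^bsub>E\<^esub> f y"
      by (simp add: regular_right_module_def)
  next
    fix x a assume "x \<in> carrier (?reg\<lparr>carrier := A\<rparr>)" and a: "a \<in> carrier R"
    then obtain p q where 1: "x = p \<oplus>\<^bsub>R\<^esub> q" "p \<in> P" "q \<in> Q" by (auto simp: A_def)
    then have "x \<otimes>\<^bsub>R\<^esub> a = p \<otimes>\<^bsub>R\<^esub> a \<oplus>\<^bsub>R\<^esub> q \<otimes>\<^bsub>R\<^esub> a"
      using Pc Qc a by (simp add: R.l_distr)
    then have "f (x \<otimes>\<^bsub>R\<^esub> a) = f x \<bullet>\<^bsub>E\<^esub> a"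
      using f 1 scale a P.I_r_closed Q.I_r_closed by simp
    then show "f (x \<bullet>\<^bsub>?reg\<lparr>carrier := A\<rparr>\<^esub> a) = f x \<bullet>\<^bsub>E\<^esub> a"
      by (simp add: regular_right_module_def)
  qed
  obtain h where h: "h \<in> right_module_hom R ?reg E" and hf: "\<And>y. y \<in> A \<Longrightarrow> h y = f y"
    using injective_extend[OF injective reg.right_module_axioms A_sub f_hom] by blast
  define m where "m = h \<one>\<^bsub>R\<^esub>"
  have mE: "m \<in> carrier E"
    using right_module_homD(2)[OF h, of "\<one>\<^bsub>R\<^esub>"] by (simp add: m_def regular_right_module_def)
  have hm: "h r = m \<bullet>\<^bsub>E\<^esub> r" if "r \<in> carrier R" for r
    using right_module_homD(4)[OF h, of "\<one>\<^bsub>R\<^esub>" r] that by (simp add: m_def regular_right_module_def)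
  have mf: "m \<bullet>\<^bsub>E\<^esub> (p \<oplus>\<^bsub>R\<^esub> q) = \<gamma> p" if "p \<in> P" "q \<in> Q" for p q
    using hm[of "p \<oplus>\<^bsub>R\<^esub> q"] hf[of "p \<oplus>\<^bsub>R\<^esub> q"] f[OF that] that Pc Qc by (auto simp: A_def)
  have "m \<bullet>\<^bsub>E\<^esub> q = \<zero>\<^bsub>E\<^esub>" if "q \<in> Q" for q
    using mf[OF P.zero_closed that] vanish[of "\<zero>\<^bsub>R\<^esub>"] Qc[OF that] by simp
  then have "m \<in> carrier M" using mE by (simp add: annihilator_in_def)
  moreover have "\<gamma> p = m \<bullet>\<^bsub>E\<^esub> p" if "p \<in> P" for p
    using mf[OF that Q.zero_closed] Pc[OF that] by simp
  ultimately show thesis using that by blast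
qed

lemma cocycle_on_P:
  assumes g: "g \<in> right_module_hom R K M"
  shows "\<And>p. p \<in> P \<Longrightarrow> g (\<epsilon> p) \<in> carrier M"
    and "\<And>p p'. \<lbrakk>p \<in> P; p' \<in> P\<rbrakk> \<Longrightarrow> g (\<epsilon> (p \<oplus>\<^bsub>R\<^esub> p')) = g (\<epsilon> p) \<oplus>\<^bsub>E\<^esub> g (\<epsilon> p')"
    and "\<And>p a. \<lbrakk>p \<in> P; a \<in> carrier R\<rbrakk> \<Longrightarrow> g (\<epsilon> (p \<otimes>\<^bsub>R\<^esub> a)) = g (\<epsilon> p) \<bullet>\<^bsub>E\<^esub> a"
  using right_module_homD[OF g] single_in_K[OF R.one_closed] P.a_Hcarr
    R.single_add[of _ _ "P +>\<^bsub>R\<^esub> \<one>\<^bsub>R\<^esub>" "carrier N"] R.single_mult[of _ "P +>\<^bsub>R\<^esub> \<one>\<^bsub>R\<^esub>" _ "carrier N"]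
  by (simp_all add: N.relation_module_operations)

text \<open>
  This turns the action of \<open>R/P\<close> on cocycles into \<open>(fr)(x) = f(rx)\<close>.  Let \<open>\<delta>\<close> be the basis element
  of \<open>F\<close> at the coset of \<open>r\<close>.  Then \<open>d = \<delta> - \<epsilon> r\<close> lies in \<open>K\<close>, and a cocycle maps \<open>dx\<close> to zero
  for \<open>x \<in> Q\<close>, because \<open>MQ = 0\<close>.
\<close>

lemma cocycle_single_eq:
  assumes g: "g \<in> right_module_hom R K M" and r: "r \<in> carrier R" and x: "x \<in> P \<inter> Q"
  shows "g (single R (P +>\<^bsub>R\<^esub> r) x) = g (\<epsilon> (r \<otimes>\<^bsub>R\<^esub> x))"
proof -
  note g' = right_module_homD[OF g]
  have xc: "x \<in> carrier R" using x by simp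
  define d where "d = single R (P +>\<^bsub>R\<^esub> r) \<one>\<^bsub>R\<^esub> \<oplus>\<^bsub>F\<^esub> \<epsilon> (\<ominus>\<^bsub>R\<^esub> r)"
  have dK: "d \<in> carrier K"
    using r R.r_neg[OF r] P.coset_eq_self_iff[of "\<zero>\<^bsub>R\<^esub>"]
    by (simp add: K_iff d_def single_in_F N.presentation_add presentation_coset_single N_simps)
  have "d \<bullet>\<^bsub>F\<^esub> x \<oplus>\<^bsub>F\<^esub> \<epsilon> (r \<otimes>\<^bsub>R\<^esub> x) =
      single R (P +>\<^bsub>R\<^esub> r) x \<oplus>\<^bsub>F\<^esub> (\<epsilon> (\<ominus>\<^bsub>R\<^esub> r \<otimes>\<^bsub>R\<^esub> x) \<oplus>\<^bsub>F\<^esub> \<epsilon> (r \<otimes>\<^bsub>R\<^esub> x))"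
    using r xc unfolding d_def
    by (simp add: F.rsmult_l_distr single_in_F R.single_mult[symmetric] F.M.a_assoc)
  also have "\<epsilon> (\<ominus>\<^bsub>R\<^esub> r \<otimes>\<^bsub>R\<^esub> x) \<oplus>\<^bsub>F\<^esub> \<epsilon> (r \<otimes>\<^bsub>R\<^esub> x) = \<zero>\<^bsub>F\<^esub>"
    using r xc by (simp add: R.single_add[symmetric] R.l_minus R.l_neg R.single_zero)
  finally have eq: "d \<bullet>\<^bsub>F\<^esub> x \<oplus>\<^bsub>F\<^esub> \<epsilon> (r \<otimes>\<^bsub>R\<^esub> x) = single R (P +>\<^bsub>R\<^esub> r) x"
    using r xc by (simp add: single_in_F)
  have rx: "\<epsilon> (r \<otimes>\<^bsub>R\<^esub> x) \<in> carrier K" using single_in_K P.I_l_closed x r by simp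
  have "g (d \<bullet>\<^bsub>K\<^esub> x \<oplus>\<^bsub>K\<^esub> \<epsilon> (r \<otimes>\<^bsub>R\<^esub> x)) = g (d \<bullet>\<^bsub>K\<^esub> x) \<oplus>\<^bsub>M\<^esub> g (\<epsilon> (r \<otimes>\<^bsub>R\<^esub> x))"
    using g'(3)[OF K.rsmult_closed[OF dK xc] rx] .
  also have "g (d \<bullet>\<^bsub>K\<^esub> x) = \<zero>\<^bsub>M\<^esub>"
    using g'(4)[OF dK xc] g'(2)[OF dK] M_annihilated[of "g d" x] x by simp
  also have "\<zero>\<^bsub>M\<^esub> \<oplus>\<^bsub>M\<^esub> g (\<epsilon> (r \<otimes>\<^bsub>R\<^esub> x)) = g (\<epsilon> (r \<otimes>\<^bsub>R\<^esub> x))"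
    using g'(2)[OF rx] by (rule M.M.l_zero)
  finally show ?thesis using eq by (simp add: N.relation_module_operations)
qed

text \<open>
  \<open>F = K + \<epsilon>R\<close> with \<open>K \<inter> \<epsilon>R = \<epsilon>P\<close>.  If a cocycle \<open>g\<close> agrees on \<open>\<epsilon>P\<close> with \<open>\<epsilon>p \<mapsto> mp\<close>, then
  \<open>k + \<epsilon>r \<mapsto> g(k) + mr\<close> is a well-defined extension of \<open>g\<close> to \<open>F\<close>.
\<close>

lemma cocycle_extends:
  assumes g: "g \<in> right_module_hom R K M" and m: "m \<in> carrier M"
    and gm: "\<And>p. p \<in> P \<Longrightarrow> g (\<epsilon> p) = m \<bullet>\<^bsub>E\<^esub> p"
  shows "g \<in> B"
proof -
  note g' = right_module_homD[OF g, unfolded N.relation_module_operations]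
  \<comment> \<open>If \<open>r\<close> represents the image of \<open>\<phi>\<close> in \<open>R/P\<close>, then \<open>part \<phi> r = \<phi> - \<epsilon> r\<close> is the component of
    \<open>\<phi>\<close> in \<open>K\<close>, and \<open>W \<phi> r\<close> is the value that the extension takes at \<open>\<phi>\<close>.\<close>
  define part where "part \<phi> r = \<phi> \<oplus>\<^bsub>F\<^esub> \<epsilon> (\<ominus>\<^bsub>R\<^esub> r)" for \<phi> r
  define lifts where "lifts \<phi> r \<longleftrightarrow> r \<in> carrier R \<and> N.presentation \<phi> = P +>\<^bsub>R\<^esub> r" for \<phi> r
  define W where "W \<phi> r = g (part \<phi> r) \<oplus>\<^bsub>M\<^esub> m \<bullet>\<^bsub>M\<^esub> r" for \<phi> r
  have P0: "P +>\<^bsub>R\<^esub> \<zero>\<^bsub>R\<^esub> = P" using P.coset_eq_self_iff[of "\<zero>\<^bsub>R\<^esub>"] by simp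
  have part_K: "part \<phi> r \<in> carrier K" if "\<phi> \<in> carrier F" "lifts \<phi> r" for \<phi> r
    using that P0 R.r_neg
    by (simp add: part_def lifts_def K_iff single_in_F N.presentation_add presentation_coset_single
        N_simps)
  have W_closed: "W \<phi> r \<in> carrier M" if "\<phi> \<in> carrier F" "lifts \<phi> r" for \<phi> r
    unfolding W_def using that g'(2)[OF part_K[OF that]] m
    by (intro M.M.a_closed M.rsmult_closed) (auto simp: lifts_def)
  have W_unique: "W \<phi> r = W \<phi> t" if \<phi>: "\<phi> \<in> carrier F" and r: "lifts \<phi> r" and t: "lifts \<phi> t"
    for \<phi> r t
  proof -
    have c: "r \<in> carrier R" "t \<in> carrier R" using r t by (auto simp: lifts_def)
    have "t \<in> P +>\<^bsub>R\<^esub> r" using r t P.a_rcos_self[OF c(2)] by (simp add: lifts_def)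
    then obtain p where p: "p \<in> P" "t = p \<oplus>\<^bsub>R\<^esub> r" by (auto simp: a_r_coset_def')
    have pc: "p \<in> carrier R" using p by simp
    have "part \<phi> t \<oplus>\<^bsub>F\<^esub> \<epsilon> p = \<phi> \<oplus>\<^bsub>F\<^esub> (\<epsilon> (\<ominus>\<^bsub>R\<^esub> t) \<oplus>\<^bsub>F\<^esub> \<epsilon> p)"
      using \<phi> c pc by (simp add: part_def F.M.a_assoc single_in_F)
    also have "\<epsilon> (\<ominus>\<^bsub>R\<^esub> t) \<oplus>\<^bsub>F\<^esub> \<epsilon> p = \<epsilon> (\<ominus>\<^bsub>R\<^esub> t \<oplus>\<^bsub>R\<^esub> p)"
      using c pc by (simp add: R.single_add[symmetric])
    also have "\<ominus>\<^bsub>R\<^esub> t \<oplus>\<^bsub>R\<^esub> p = \<ominus>\<^bsub>R\<^esub> r"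
      using c(1) pc by (simp add: p(2) R.minus_add R.a_ac R.r_neg R.r_neg1 R.r_neg2)
    finally have "part \<phi> r = part \<phi> t \<oplus>\<^bsub>F\<^esub> \<epsilon> p" by (simp add: part_def)
    then have "g (part \<phi> r) = g (part \<phi> t) \<oplus>\<^bsub>M\<^esub> m \<bullet>\<^bsub>M\<^esub> p"
      using g'(3)[OF part_K[OF \<phi> t] single_in_K[OF R.one_closed p(1)]] gm[OF p(1)] by simp
    then have "W \<phi> r = g (part \<phi> t) \<oplus>\<^bsub>M\<^esub> m \<bullet>\<^bsub>M\<^esub> p \<oplus>\<^bsub>M\<^esub> m \<bullet>\<^bsub>M\<^esub> r" by (simp add: W_def)
    also have "\<dots> = g (part \<phi> t) \<oplus>\<^bsub>M\<^esub> (m \<bullet>\<^bsub>M\<^esub> p \<oplus>\<^bsub>M\<^esub> m \<bullet>\<^bsub>M\<^esub> r)"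
      using g'(2)[OF part_K[OF \<phi> t]] M.rsmult_closed[OF m pc] M.rsmult_closed[OF m c(1)]
      by (rule M.M.a_assoc)
    also have "\<dots> = W \<phi> t"
      unfolding W_def p(2) using M.rsmult_r_distr[OF m pc c(1)] by simp
    finally show ?thesis .
  qed
  have ex_lift: "\<exists>r. lifts \<phi> r" if \<phi>: "\<phi> \<in> carrier F" for \<phi>
  proof -
    have "N.presentation \<phi> \<in> carrier (R Quot P)"
      using N.presentation_closed[OF \<phi>] by (simp add: carrier_N)
    then show ?thesis by (rule P.quot_carrier_cases) (auto simp: lifts_def)
  qed
  define G where "G = (\<lambda>\<phi>\<in>carrier F. W \<phi> (SOME r. lifts \<phi> r))"
  have GW: "G \<phi> = W \<phi> r" if "\<phi> \<in> carrier F" "lifts \<phi> r" for \<phi> r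
    using W_unique[OF that(1) someI[of "lifts \<phi>", OF that(2)] that(2)] that(1) by (simp add: G_def)
  have "G \<in> right_module_hom R F M"
  proof (rule right_module_homI)
    show "G \<in> extensional (carrier F)" by (simp add: G_def)
  next
    fix \<phi> assume \<phi>: "\<phi> \<in> carrier F"
    then show "G \<phi> \<in> carrier M" using ex_lift[OF \<phi>] GW W_closed by metis
  next
    fix \<phi> \<psi> assume \<phi>: "\<phi> \<in> carrier F" and \<psi>: "\<psi> \<in> carrier F"
    obtain r t where r: "lifts \<phi> r" and t: "lifts \<psi> t" using ex_lift \<phi> \<psi> by blast
    have c: "r \<in> carrier R" "t \<in> carrier R" using r t by (auto simp: lifts_def)
    have rt: "lifts (\<phi> \<oplus>\<^bsub>F\<^esub> \<psi>) (r \<oplus>\<^bsub>R\<^esub> t)"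
      using r t \<phi> \<psi> by (simp add: lifts_def N.presentation_add N_simps)
    have "part (\<phi> \<oplus>\<^bsub>F\<^esub> \<psi>) (r \<oplus>\<^bsub>R\<^esub> t) = part \<phi> r \<oplus>\<^bsub>F\<^esub> part \<psi> t"
      using \<phi> \<psi> c
      by (simp add: part_def R.minus_add R.single_add[where X = "carrier N"] F.M.a_ac single_in_F)
    then have "g (part (\<phi> \<oplus>\<^bsub>F\<^esub> \<psi>) (r \<oplus>\<^bsub>R\<^esub> t)) = g (part \<phi> r) \<oplus>\<^bsub>M\<^esub> g (part \<psi> t)"
      using g'(3)[OF part_K[OF \<phi> r] part_K[OF \<psi> t]] by simp
    then have "W (\<phi> \<oplus>\<^bsub>F\<^esub> \<psi>) (r \<oplus>\<^bsub>R\<^esub> t) = W \<phi> r \<oplus>\<^bsub>M\<^esub> W \<psi> t"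
      unfolding W_def
      using M.rsmult_r_distr[OF m c] g'(2)[OF part_K[OF \<phi> r]] g'(2)[OF part_K[OF \<psi> t]]
        M.rsmult_closed[OF m c(1)] M.rsmult_closed[OF m c(2)] M.M.a_ac M.M.a_closed
      by (simp del: ring.simps partial_object.simps right_module.simps)
    then show "G (\<phi> \<oplus>\<^bsub>F\<^esub> \<psi>) = G \<phi> \<oplus>\<^bsub>M\<^esub> G \<psi>"
      using GW[OF F.M.a_closed[OF \<phi> \<psi>] rt] GW[OF \<phi> r] GW[OF \<psi> t] by simp
  next
    fix \<phi> a assume \<phi>: "\<phi> \<in> carrier F" and a: "a \<in> carrier R"
    obtain r where r: "lifts \<phi> r" using ex_lift \<phi> by blast
    have c: "r \<in> carrier R" using r by (auto simp: lifts_def)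
    have ra: "lifts (\<phi> \<bullet>\<^bsub>F\<^esub> a) (r \<otimes>\<^bsub>R\<^esub> a)"
      using r \<phi> a by (simp add: lifts_def N.presentation_rsmult N_simps)
    have "part (\<phi> \<bullet>\<^bsub>F\<^esub> a) (r \<otimes>\<^bsub>R\<^esub> a) = part \<phi> r \<bullet>\<^bsub>F\<^esub> a"
      using \<phi> c a by (simp add: part_def F.rsmult_l_distr single_in_F R.single_mult[symmetric] R.l_minus)
    then have "g (part (\<phi> \<bullet>\<^bsub>F\<^esub> a) (r \<otimes>\<^bsub>R\<^esub> a)) = g (part \<phi> r) \<bullet>\<^bsub>M\<^esub> a"
      using g'(4)[OF part_K[OF \<phi> r] a] by simp
    then have "W (\<phi> \<bullet>\<^bsub>F\<^esub> a) (r \<otimes>\<^bsub>R\<^esub> a) = W \<phi> r \<bullet>\<^bsub>M\<^esub> a"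
      unfolding W_def
      using M.rsmult_assoc[OF m c a]
        M.rsmult_l_distr[OF g'(2)[OF part_K[OF \<phi> r]] M.rsmult_closed[OF m c] a] by simp
    then show "G (\<phi> \<bullet>\<^bsub>F\<^esub> a) = G \<phi> \<bullet>\<^bsub>M\<^esub> a"
      using GW[OF F.rsmult_closed[OF \<phi> a] ra] GW[OF \<phi> r] by simp
  qed
  moreover have "g = restrict G (carrier K)"
  proof (rule extensionalityI[OF g'(1)])
    fix \<phi> assume \<phi>: "\<phi> \<in> carrier K"
    then have \<phi>F: "\<phi> \<in> carrier F" and l: "lifts \<phi> \<zero>\<^bsub>R\<^esub>" by (auto simp: K_iff lifts_def P0)
    have "part \<phi> \<zero>\<^bsub>R\<^esub> = \<phi>"
      using \<phi>F by (simp add: part_def R.single_zero[where X = "carrier N"])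
    then have "W \<phi> \<zero>\<^bsub>R\<^esub> = g \<phi>"
      unfolding W_def using M.rsmult_zero_right[OF m] M.M.r_zero[OF g'(2)[OF \<phi>]] by simp
    then show "g \<phi> = restrict G (carrier K) \<phi>" using \<phi> GW[OF \<phi>F l] by simp
  qed simp
  ultimately show ?thesis by blast
qed

text \<open>
  A homomorphism \<open>G\<close> on \<open>F\<close> has \<open>G(\<epsilon> x) = G(\<epsilon> 1)x\<close>, which is zero for \<open>x \<in> Q\<close>.  The converse is where
  the injectivity of \<open>E\<close> enters, through the two preceding extension steps.
\<close>

lemma coboundaries_eq:
  "B = {g \<in> right_module_hom R K M. \<forall>x\<in>P \<inter> Q. g (\<epsilon> x) = \<zero>\<^bsub>E\<^esub>}"
proof (intro equalityI subsetI)
  fix g assume "g \<in> B"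
  then obtain G where G: "G \<in> right_module_hom R F M" and g: "g = restrict G (carrier K)" by blast
  note G' = right_module_homD[OF G]
  have KF: "\<phi> \<in> carrier F" if "\<phi> \<in> carrier K" for \<phi> using that by (simp add: K_iff)
  have "g \<in> right_module_hom R K M"
    using G' KF K.M.a_closed K.rsmult_closed unfolding g
    by (intro right_module_homI) (simp_all add: N.relation_module_operations)
  moreover have "g (\<epsilon> x) = \<zero>\<^bsub>E\<^esub>" if x: "x \<in> P \<inter> Q" for x
  proof -
    have xc: "x \<in> carrier R" using x by simp
    have F1: "\<epsilon> \<one>\<^bsub>R\<^esub> \<in> carrier F" by (simp add: single_in_F)
    have "\<epsilon> x = \<epsilon> \<one>\<^bsub>R\<^esub> \<bullet>\<^bsub>F\<^esub> x" using xc by (simp add: R.single_mult[symmetric])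
    then have "G (\<epsilon> x) = G (\<epsilon> \<one>\<^bsub>R\<^esub>) \<bullet>\<^bsub>E\<^esub> x" using G'(4)[OF F1 xc] by simp
    then have "G (\<epsilon> x) = \<zero>\<^bsub>E\<^esub>" using M_annihilated[OF G'(2)[OF F1]] x by simp
    then show ?thesis using single_in_K[OF R.one_closed, of x] x by (simp add: g)
  qed
  ultimately show "g \<in> {g \<in> right_module_hom R K M. \<forall>x\<in>P \<inter> Q. g (\<epsilon> x) = \<zero>\<^bsub>E\<^esub>}" by blast
next
  fix g assume "g \<in> {g \<in> right_module_hom R K M. \<forall>x\<in>P \<inter> Q. g (\<epsilon> x) = \<zero>\<^bsub>E\<^esub>}"
  then have g: "g \<in> right_module_hom R K M" and vanish: "\<And>x. x \<in> P \<inter> Q \<Longrightarrow> g (\<epsilon> x) = \<zero>\<^bsub>E\<^esub>"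
    by auto
  obtain m where "m \<in> carrier M" "\<And>p. p \<in> P \<Longrightarrow> g (\<epsilon> p) = m \<bullet>\<^bsub>E\<^esub> p"
    using hom_from_P_is_multiplication[of "\<lambda>p. g (\<epsilon> p)"] cocycle_on_P[OF g] vanish by blast
  then show "g \<in> B" using cocycle_extends[OF g] by blast
qed

text \<open>
  The class of a cocycle is determined by its restriction to \<open>P \<inter> Q\<close>: this is the embedding of
  \<open>Ext\<^sup>1\<^sub>R(R/P, M)\<close> into \<open>Hom\<^sub>R(P \<inter> Q, M)\<close>.
\<close>

lemma ext_class_eq:
  assumes g: "g \<in> right_module_hom R K M"
  shows "B +>\<^bsub>H\<^esub> g = {h \<in> right_module_hom R K M. \<forall>x\<in>P \<inter> Q. h (\<epsilon> x) = g (\<epsilon> x)}"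
proof (intro equalityI subsetI)
  note add_H = right_module_hom_add[OF K.right_module_axioms M.right_module_axioms]
  have in_K: "\<epsilon> x \<in> carrier K" if "x \<in> P \<inter> Q" for x using single_in_K that by simp
  note g' = right_module_homD[OF g]
  {
    fix h assume "h \<in> B +>\<^bsub>H\<^esub> g"
    then obtain b where b: "b \<in> B" and h: "h = b \<oplus>\<^bsub>H\<^esub> g" by (auto simp: a_r_coset_def')
    have "b \<in> right_module_hom R K M" and b0: "\<And>x. x \<in> P \<inter> Q \<Longrightarrow> b (\<epsilon> x) = \<zero>\<^bsub>E\<^esub>"
      using b unfolding coboundaries_eq by auto
    then have "h \<in> right_module_hom R K M" unfolding h using add_H g by blast
    moreover have "h (\<epsilon> x) = g (\<epsilon> x)" if x: "x \<in> P \<inter> Q" for x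
      using M.M.l_zero[OF g'(2)[OF in_K[OF x]]] in_K[OF x] b0[OF x] by (simp add: h hom_group_def)
    ultimately show "h \<in> {h \<in> right_module_hom R K M. \<forall>x\<in>P \<inter> Q. h (\<epsilon> x) = g (\<epsilon> x)}" by blast
  next
    fix h assume "h \<in> {h \<in> right_module_hom R K M. \<forall>x\<in>P \<inter> Q. h (\<epsilon> x) = g (\<epsilon> x)}"
    then have h: "h \<in> right_module_hom R K M" and eq: "\<And>x. x \<in> P \<inter> Q \<Longrightarrow> h (\<epsilon> x) = g (\<epsilon> x)" by auto
    note h' = right_module_homD[OF h]
    define b where "b = (\<lambda>\<phi>\<in>carrier K. h \<phi> \<ominus>\<^bsub>M\<^esub> g \<phi>)"
    have "b \<in> right_module_hom R K M"
      unfolding b_def by (rule right_module_hom_minus[OF K.right_module_axioms M.right_module_axioms h g])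
    moreover have "b (\<epsilon> x) = \<zero>\<^bsub>E\<^esub>" if x: "x \<in> P \<inter> Q" for x
      using M.M.r_neg[OF g'(2)[OF in_K[OF x]]] in_K[OF x] eq[OF x] by (simp add: b_def a_minus_def)
    ultimately have "b \<in> B" unfolding coboundaries_eq by blast
    moreover have "h = b \<oplus>\<^bsub>H\<^esub> g"
    proof (rule extensionalityI[OF h'(1)])
      fix \<phi> assume \<phi>: "\<phi> \<in> carrier K"
      have "b \<phi> \<oplus>\<^bsub>M\<^esub> g \<phi> = h \<phi>"
        using \<phi> h'(2)[OF \<phi>] g'(2)[OF \<phi>] M.M.a_inv_closed[OF g'(2)[OF \<phi>]] M.M.l_neg[OF g'(2)[OF \<phi>]]
          M.M.a_assoc[of "h \<phi>" "\<ominus>\<^bsub>M\<^esub> g \<phi>" "g \<phi>"] M.M.r_zero[OF h'(2)[OF \<phi>]]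
        by (simp add: b_def a_minus_def)
      then show "h \<phi> = (b \<oplus>\<^bsub>H\<^esub> g) \<phi>" using \<phi> by (simp add: hom_group_def)
    qed (simp add: hom_group_def)
    ultimately show "h \<in> B +>\<^bsub>H\<^esub> g" by (auto simp: a_r_coset_def')
  }
qed

abbreviation "Ext1 \<equiv> ext1 R N (mult (R Quot P)) M"

lemma ext_zero: "\<zero>\<^bsub>Ext1\<^esub> = B"
  by (simp add: ext1_def Let_def)

lemma ext_carrier_cases:
  assumes "C \<in> carrier Ext1"
  obtains g where "g \<in> right_module_hom R K M"
    "C = {h \<in> right_module_hom R K M. \<forall>x\<in>P \<inter> Q. h (\<epsilon> x) = g (\<epsilon> x)}"
proof -
  obtain g where "g \<in> carrier H" "C = B +>\<^bsub>H\<^esub> g"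
    using assms by (auto simp: ext1_def Let_def A_RCOSETS_def')
  then show thesis using that ext_class_eq by (simp add: hom_group_def)
qed

text \<open>
  Under the embedding into \<open>Hom\<^sub>R(P \<inter> Q, M)\<close> the right action of \<open>R/P\<close> on \<open>Ext\<^sup>1\<close> becomes
  \<open>(fr)(x) = f(rx)\<close>; the coboundary \<open>b\<close> by which representatives differ vanishes on \<open>P \<inter> Q\<close>.
\<close>

lemma ext_rsmult:
  assumes C: "C \<in> carrier Ext1" and r: "r \<in> carrier R" and f: "f \<in> C"
    and h: "h \<in> C \<bullet>\<^bsub>Ext1\<^esub> (P +>\<^bsub>R\<^esub> r)" and x: "x \<in> P \<inter> Q"
  shows "h (\<epsilon> x) = f (\<epsilon> (r \<otimes>\<^bsub>R\<^esub> x))"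
proof -
  interpret S: ring "R Quot P" by (rule P.quotient_is_ring)
  define s where "s = (\<otimes>\<^bsub>R Quot P\<^esub>) (P +>\<^bsub>R\<^esub> r)"
  have s1: "s (P +>\<^bsub>R\<^esub> \<one>\<^bsub>R\<^esub>) = P +>\<^bsub>R\<^esub> r" using r by (simp add: s_def P.quot_mult)
  obtain g where C_eq: "C = {h \<in> right_module_hom R K M. \<forall>x\<in>P \<inter> Q. h (\<epsilon> x) = g (\<epsilon> x)}"
    using ext_carrier_cases[OF C] by blast
  obtain f' where f': "f' \<in> C" and "h \<in> B +>\<^bsub>H\<^esub> (\<lambda>\<phi>\<in>carrier K. f' (free_map R s \<phi>))"
    using h by (auto simp: ext1_def Let_def s_def)
  then obtain b where b: "b \<in> B" and h: "h = b \<oplus>\<^bsub>H\<^esub> (\<lambda>\<phi>\<in>carrier K. f' (free_map R s \<phi>))"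
    by (auto simp: a_r_coset_def')
  have f'_hom: "f' \<in> right_module_hom R K M" using f' C_eq by blast
  have xK: "\<epsilon> x \<in> carrier K" using single_in_K[OF R.one_closed] x by simp
  have rx: "r \<otimes>\<^bsub>R\<^esub> x \<in> P \<inter> Q" using x r P.I_l_closed Q.I_l_closed by simp
  have "b (\<epsilon> x) = \<zero>\<^bsub>E\<^esub>" using b x unfolding coboundaries_eq by blast
  then have "h (\<epsilon> x) = \<zero>\<^bsub>M\<^esub> \<oplus>\<^bsub>M\<^esub> f' (free_map R s (\<epsilon> x))"
    using xK by (simp add: h hom_group_def)
  also have "free_map R s (\<epsilon> x) = single R (P +>\<^bsub>R\<^esub> r) x"
    using R.free_map_single[of x s] x s1 by simp
  also have "f' (single R (P +>\<^bsub>R\<^esub> r) x) = f' (\<epsilon> (r \<otimes>\<^bsub>R\<^esub> x))"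
    by (rule cocycle_single_eq[OF f'_hom r x])
  also have "\<zero>\<^bsub>M\<^esub> \<oplus>\<^bsub>M\<^esub> f' (\<epsilon> (r \<otimes>\<^bsub>R\<^esub> x)) = f' (\<epsilon> (r \<otimes>\<^bsub>R\<^esub> x))"
    using cocycle_on_P(1)[OF f'_hom] rx by (intro M.M.l_zero) blast
  also have "\<dots> = f (\<epsilon> (r \<otimes>\<^bsub>R\<^esub> x))" using f f' rx unfolding C_eq by simp
  finally show ?thesis .
qed

text \<open>
  The restrictions to \<open>P \<inter> Q\<close> of all cocycles with class in \<open>X\<close> form a torsionfree family in the
  sense of \<open>linked_from_torsionfree_family\<close>: if \<open>f\<close> represents \<open>C \<in> X\<close> and \<open>fc\<close> vanishes on
  \<open>P \<inter> Q\<close> for a regular \<open>c\<close>, then \<open>Cc = 0\<close>, because a class is determined by its restriction,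
  and so \<open>C = 0\<close>.
\<close>

lemma linked_if_ext_has_torsionfree_submodule:
  assumes noeth: "right_noetherian R" and P: "prime_ideal P R"
    and tf_M: "\<And>x c. \<lbrakk>x \<in> carrier M; c \<in> carrier R; Q +>\<^bsub>R\<^esub> c \<in> regular_elements (R Quot Q);
        x \<bullet>\<^bsub>M\<^esub> c = \<zero>\<^bsub>M\<^esub>\<rbrakk> \<Longrightarrow> x = \<zero>\<^bsub>M\<^esub>"
    and X: "right_submodule X (R Quot P) Ext1" and X_nz: "X \<noteq> {\<zero>\<^bsub>Ext1\<^esub>}"
    and tf_X: "torsionfree (R Quot P) (Ext1\<lparr>carrier := X\<rparr>)"
  shows "linked R P Q"
proof -
  interpret X: additive_subgroup X Ext1 using X by (simp add: right_submodule_def)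
  have XC: "C \<in> carrier Ext1" if "C \<in> X" for C using X.a_subset that by blast
  have X_act: "C \<bullet>\<^bsub>Ext1\<^esub> (P +>\<^bsub>R\<^esub> r) \<in> X" if "C \<in> X" "r \<in> carrier R" for C r
    using X that P.quot_coset_closed by (simp add: right_submodule_def)
  have X_hom: "g \<in> right_module_hom R K M" if "C \<in> X" "g \<in> C" for C g
    using ext_carrier_cases[OF XC[OF that(1)]] that(2) by blast
  have X_ne: "\<exists>g. g \<in> C" if "C \<in> X" for C
    using ext_carrier_cases[OF XC[OF that]] by blast
  have X_class: "C = B" if C: "C \<in> X" and g: "g \<in> C" and g0: "\<forall>x\<in>P \<inter> Q. g (\<epsilon> x) = \<zero>\<^bsub>E\<^esub>" for C g
  proof -
    obtain g' where C_eq: "C = {h \<in> right_module_hom R K M. \<forall>x\<in>P \<inter> Q. h (\<epsilon> x) = g' (\<epsilon> x)}"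
      using ext_carrier_cases[OF XC[OF C]] by blast
    have "\<forall>x\<in>P \<inter> Q. g' (\<epsilon> x) = \<zero>\<^bsub>E\<^esub>" using g g0 C_eq by simp
    then show ?thesis unfolding C_eq coboundaries_eq by auto
  qed
  have X_torsionfree: "C = \<zero>\<^bsub>Ext1\<^esub>"
    if "C \<in> X" "c \<in> regular_elements (R Quot P)" "C \<bullet>\<^bsub>Ext1\<^esub> c = \<zero>\<^bsub>Ext1\<^esub>" for C c
    using tf_X that unfolding torsionfree_def by simp blast
  define ev where "ev g x = g (\<epsilon> x)" for g :: "('a set \<Rightarrow> 'a) \<Rightarrow> 'e" and x
  define \<F> where "\<F> = ev ` \<Union>X"
  have \<F>E: "\<exists>C g. C \<in> X \<and> g \<in> C \<and> g \<in> right_module_hom R K M \<and> f = ev g" if "f \<in> \<F>" for f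
    using that X_hom unfolding \<F>_def by blast
  have \<F>I: "ev g \<in> \<F>" if "C \<in> X" "g \<in> C" for C g using that by (auto simp: \<F>_def)
  have PQc: "x \<in> P \<inter> Q \<Longrightarrow> x \<in> P" for x by blast
  have "B \<in> X" using X.zero_closed by (simp only: ext_zero)
  then obtain C where C: "C \<in> X" "C \<noteq> B" using X_nz unfolding ext_zero by blast
  obtain g where gC: "g \<in> C" using X_ne[OF C(1)] by blast
  then obtain x0 where x0: "x0 \<in> P \<inter> Q" "g (\<epsilon> x0) \<noteq> \<zero>\<^bsub>E\<^esub>" using X_class[OF C(1)] C(2) by blast
  show ?thesis
  proof (rule linked_from_torsionfree_family[where \<F> = \<F>, OF M.right_module_axioms noeth P Q.is_ideal])
    fix x c
    assume "x \<in> carrier M" "c \<in> carrier R" "Q +>\<^bsub>R\<^esub> c \<in> regular_elements (R Quot Q)" "x \<bullet>\<^bsub>M\<^esub> c = \<zero>\<^bsub>M\<^esub>"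
    then show "x = \<zero>\<^bsub>M\<^esub>" by (rule tf_M)
  next
    fix f x assume "f \<in> \<F>" "x \<in> P \<inter> Q"
    then show "f x \<in> carrier M" using \<F>E[of f] cocycle_on_P(1) PQc unfolding ev_def by blast
  next
    fix f x y assume f: "f \<in> \<F>" and xy: "x \<in> P \<inter> Q" "y \<in> P \<inter> Q"
    obtain g where g: "g \<in> right_module_hom R K M" "f = ev g" using \<F>E[OF f] by blast
    show "f (x \<oplus>\<^bsub>R\<^esub> y) = f x \<oplus>\<^bsub>M\<^esub> f y"
      using cocycle_on_P(2)[OF g(1) PQc[OF xy(1)] PQc[OF xy(2)]] by (simp add: g(2) ev_def)
  next
    fix f x a assume f: "f \<in> \<F>" and x: "x \<in> P \<inter> Q" and a: "a \<in> carrier R"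
    obtain g where g: "g \<in> right_module_hom R K M" "f = ev g" using \<F>E[OF f] by blast
    show "f (x \<otimes>\<^bsub>R\<^esub> a) = f x \<bullet>\<^bsub>M\<^esub> a"
      using cocycle_on_P(3)[OF g(1) PQc[OF x] a] by (simp add: g(2) ev_def)
  next
    fix f p q assume f: "f \<in> \<F>" and p: "p \<in> P" and q: "q \<in> Q"
    obtain g where g: "g \<in> right_module_hom R K M" "f = ev g" using \<F>E[OF f] by blast
    have "g (\<epsilon> (p \<otimes>\<^bsub>R\<^esub> q)) = g (\<epsilon> p) \<bullet>\<^bsub>E\<^esub> q" using cocycle_on_P(3)[OF g(1) p] q by simp
    also have "\<dots> = \<zero>\<^bsub>E\<^esub>" using M_annihilated[OF cocycle_on_P(1)[OF g(1) p] q] .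
    finally show "f (p \<otimes>\<^bsub>R\<^esub> q) = \<zero>\<^bsub>M\<^esub>" by (simp add: g(2) ev_def)
  next
    fix f r assume f: "f \<in> \<F>" and r: "r \<in> carrier R"
    obtain C g where g: "C \<in> X" "g \<in> C" "f = ev g" using \<F>E[OF f] by blast
    obtain h where h: "h \<in> C \<bullet>\<^bsub>Ext1\<^esub> (P +>\<^bsub>R\<^esub> r)" using X_ne X_act g(1) r by blast
    have "ev h \<in> \<F>" using \<F>I[OF X_act[OF g(1) r] h] .
    moreover have "ev h x = f (r \<otimes>\<^bsub>R\<^esub> x)" if "x \<in> P \<inter> Q" for x
      using ext_rsmult[OF XC[OF g(1)] r g(2) h that] by (simp add: g(3) ev_def)
    ultimately show "\<exists>g\<in>\<F>. \<forall>x\<in>P \<inter> Q. g x = f (r \<otimes>\<^bsub>R\<^esub> x)" by blast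
  next
    fix f c x
    assume f: "f \<in> \<F>" and c: "c \<in> carrier R" and reg: "P +>\<^bsub>R\<^esub> c \<in> regular_elements (R Quot P)"
      and fc: "\<forall>x\<in>P \<inter> Q. f (c \<otimes>\<^bsub>R\<^esub> x) = \<zero>\<^bsub>M\<^esub>" and x: "x \<in> P \<inter> Q"
    obtain C g where g: "C \<in> X" "g \<in> C" "f = ev g" using \<F>E[OF f] by blast
    obtain h where h: "h \<in> C \<bullet>\<^bsub>Ext1\<^esub> (P +>\<^bsub>R\<^esub> c)" using X_ne X_act g(1) c by blast
    have "h (\<epsilon> y) = \<zero>\<^bsub>E\<^esub>" if "y \<in> P \<inter> Q" for y
      using ext_rsmult[OF XC[OF g(1)] c g(2) h that] fc that by (simp add: g(3) ev_def)
    then have "C \<bullet>\<^bsub>Ext1\<^esub> (P +>\<^bsub>R\<^esub> c) = \<zero>\<^bsub>Ext1\<^esub>"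
      using X_class[OF X_act[OF g(1) c] h] by (simp only: ext_zero) blast
    then have "C = \<zero>\<^bsub>Ext1\<^esub>" by (rule X_torsionfree[OF g(1) reg])
    then have "g \<in> B" using g(2) by (simp only: ext_zero)
    then show "f x = \<zero>\<^bsub>M\<^esub>" using x unfolding coboundaries_eq by (simp add: g(3) ev_def)
  next
    show "ev g \<in> \<F>" using \<F>I[OF C(1) gC] .
    show "x0 \<in> P \<inter> Q" by (rule x0(1))
    show "ev g x0 \<noteq> \<zero>\<^bsub>M\<^esub>" using x0(2) by (simp add: ev_def)
  qed
qed

end

theorem theorem2p4:
  fixes R :: "('a, 'x) ring_scheme"
    and E :: "('a, 'e) right_module"
  assumes "ring R" and "right_noetherian R"
    and "prime_ideal P R" and "prime_ideal Q R"
    and "tame_injective R Q E"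
    and "Ext = ext1 R (quotient_right_module R P) (mult (R Quot P))
                 (E\<lparr>carrier := annihilator_in E Q\<rparr>)"
    and "\<exists>X. right_submodule X (R Quot P) Ext \<and> X \<noteq> {\<zero>\<^bsub>Ext\<^esub>} \<and>
             torsionfree (R Quot P) (Ext\<lparr>carrier := X\<rparr>)"
  shows "linked R P Q"
proof -
  have inj: "injective R E"
    using assms(5) by (auto simp: tame_injective_def injective_hull_def)
  then have E: "right_module R E" by (simp add: injective_def)
  interpret annihilator_ext R P Q E
    using assms(1,3,4) inj E
    by (intro annihilator_ext.intro annihilator_ext_axioms.intro) (auto simp: prime_ideal_def)
  obtain X where "right_submodule X (R Quot P) Ext" "X \<noteq> {\<zero>\<^bsub>Ext\<^esub>}"
    "torsionfree (R Quot P) (Ext\<lparr>carrier := X\<rparr>)" using assms(7) by blast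
  moreover have "x = \<zero>\<^bsub>E\<^esub>" if "x \<in> annihilator_in E Q" "c \<in> carrier R"
    "Q +>\<^bsub>R\<^esub> c \<in> regular_elements (R Quot Q)" "x \<bullet>\<^bsub>E\<^esub> c = \<zero>\<^bsub>E\<^esub>" for x c
    using tame_injective_annihilator_torsionfree[OF assms(2,4,5)] that by blast
  ultimately show ?thesis
    using linked_if_ext_has_torsionfree_submodule[OF assms(2,3), of X] unfolding assms(6) by simp
qed

end
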